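(* Let $H$ be a complex Hilbert space and let $R_{z_1,z_2}$ be an operator-valued function depending on complex parameters $z_1,z_2\in\mathbb{T}_e$, whose values are bounded linear operators defined on the whole of $H$. Let $V_1,V_2$ be closed isometric operators in $H$ satisfying $$V_1V_2h=V_2V_1h,\qquad h\in D(V_1V_2)\cap D(V_2V_1).$$ Then $R_{z_1,z_2}$ is a generalized resolvent of the pair of isometric operators $V_1,V_2$ if and only if the following conditions are satisfied: 1) $R_{0,0}=E_H$; 2) $R_{z_1,z_2}^*=R_{\frac{1}{\overline{z_1}},\frac{1}{\overline{z_2}}}$ for all $z_1,z_2\in\mathbb{T}_e\setminus\{0\}$; 3) for every $h\in H$, for the function $f(z_1,z_2):=(R_{z_1,z_2}h,h)_H$, $z_1,z_2\in\mathbb{T}_e$, there exist the limits $$f(\infty,z_2):=\lim_{z_1\to\infty}f(z_1,z_2),\quad f(z_1,\infty):=\lim_{z_2\to\infty}f(z_1,z_2),\quad z_1,z_2\in\mathbb{T}_e;$$ $$f(\infty,\infty)=\lim_{z_2\to\infty}\lim_{z_1\to\infty}f(z_1,z_2),$$ and the function $f(z_1,z_2)$, $z_1,z_2\in\mathbb{T}_e\cup\{\infty\}$, extended by these relations, belongs to the class $H_2$; 4) $\frac12\left(E_H+R_{\zeta,0}\right)(E_H-\zeta V_1)g=g$ for all $\zeta\in\mathbb{T}_e$, $g\in D(V_1)$; 5) $\frac12\left(E_H+R_{0,\zeta}\right)(E_H-\zeta V_2)g=g$ for all $\zeta\in\mathbb{T}_e$, $g\in D(V_2)$.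
   Context: Notation: $\mathbb{T}_e=\{z\in\mathbb{C}:|z|\neq 1\}$. $E_H$ is the identity operator on $H$. Hilbert spaces are not necessarily separable; operators are linear. $D(A)$ is the domain of an operator $A$. A closed isometric operator $V$ in $H$ is a closed linear operator with domain $D(V)\subseteq H$ a (not necessarily dense, possibly zero) subspace, with $\|Vh\|=\|h\|$ for $h\in D(V)$. $P^{\widetilde H}_H$ is the orthogonal projection of a Hilbert space $\widetilde H\supseteq H$ onto its closed subspace $H$. Generalized resolvent of a pair: let $V_1,V_2$ be closed isometric operators in $H$ with $V_1V_2h=V_2V_1h$ for $h\in D(V_1V_2)\cap D(V_2V_1)$. An operator-valued function $R_{z_1,z_2}$ ($z_1,z_2\in\mathbb{T}_e$) is called a generalized resolvent of the pair $V_1,V_2$ if there exist a Hilbert space $\widetilde H\supseteq H$ and commuting unitary operators $U_1,U_2$ in $\widetilde H$ with $U_1\supseteq V_1$, $U_2\supseteq V_2$, such that $$R_{z_1,z_2}=P^{\widetilde H}_H(E_{\widetilde H}+z_1U_1)(E_{\widetilde H}-z_1U_1)^{-1}(E_{\widetilde H}+z_2U_2)(E_{\widetilde H}-z_2U_2)^{-1}\big|_H,\qquad z_1,z_2\in\mathbb{T}_e.$$ The class $H_2$ (introduced by Korányi; not a Hardy space) is the class of functions $f$ of two complex variables $z_1,z_2$ defined and holomorphic for all $|z_1|,|z_2|\neq 1$ (including $\infty$, where holomorphy at an infinite value of a variable is understood via $u=1/z$) and satisfying, with the convention $\overline{0}^{-1}=\infty$, $\overline{\infty}^{-1}=0$: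 (a) $f(\overline{z_1}^{-1},\overline{z_2}^{-1})=\overline{f(z_1,z_2)}$ for all $|z_1|,|z_2|\neq1$; (b) $f(z_1,z_2)-f(\overline{z_1}^{-1},z_2)-f(z_1,\overline{z_2}^{-1})+f(\overline{z_1}^{-1},\overline{z_2}^{-1})\geq0$ for $|z_1|,|z_2|<1$; (c) $f(z_1,0)+f(z_1,\infty)=0$ and $f(0,z_2)+f(\infty,z_2)=0$ for all $|z_1|\neq1$ and $|z_2|\neq1$. *)

theory Defs
  imports "HOL-Analysis.Analysis"
begin

section \<open>Complex Hilbert spaces with explicit carrier\<close>

text \<open>
  A generalized resolvent is defined by an existential quantification over Hilbert spaces.
  This rules out a type class, so all spaces are carrier-based structures.
  The inner product is linear in its first argument.
\<close>

record 'a hspace =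
  carrier :: "'a set"
  hzero :: "'a"  ("\<zero>\<index>")
  hadd :: "'a \<Rightarrow> 'a \<Rightarrow> 'a"  (infixl "\<oplus>\<index>" 65)
  hscale :: "complex \<Rightarrow> 'a \<Rightarrow> 'a"  (infixr "\<odot>\<index>" 75)
  hinner :: "'a \<Rightarrow> 'a \<Rightarrow> complex"

definition hminus :: "'a hspace \<Rightarrow> 'a \<Rightarrow> 'a \<Rightarrow> 'a"  ("(_ \<ominus>\<index> _)" [65, 66] 65) where
  "x \<ominus>\<^bsub>H\<^esub> y = x \<oplus>\<^bsub>H\<^esub> (- 1) \<odot>\<^bsub>H\<^esub> y"

definition hnorm :: "'a hspace \<Rightarrow> 'a \<Rightarrow> real" where
  "hnorm H x = sqrt (Re (hinner H x x))"

definition hconverges :: "'a hspace \<Rightarrow> (nat \<Rightarrow> 'a) \<Rightarrow> 'a \<Rightarrow> bool" where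
  "hconverges H X x \<longleftrightarrow> x \<in> carrier H \<and> (\<lambda>n. hnorm H (X n \<ominus>\<^bsub>H\<^esub> x)) \<longlonglongrightarrow> 0"

locale complex_hilbert_space =
  fixes H :: "'a hspace" (structure)
  assumes zero_closed: "\<zero> \<in> carrier H"
    and add_closed: "\<lbrakk>x \<in> carrier H; y \<in> carrier H\<rbrakk> \<Longrightarrow> x \<oplus> y \<in> carrier H"
    and scale_closed: "x \<in> carrier H \<Longrightarrow> c \<odot> x \<in> carrier H"
    and add_assoc: "\<lbrakk>x \<in> carrier H; y \<in> carrier H; z \<in> carrier H\<rbrakk>
      \<Longrightarrow> (x \<oplus> y) \<oplus> z = x \<oplus> (y \<oplus> z)"
    and add_commute: "\<lbrakk>x \<in> carrier H; y \<in> carrier H\<rbrakk> \<Longrightarrow> x \<oplus> y = y \<oplus> x"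
    and add_zero: "x \<in> carrier H \<Longrightarrow> x \<oplus> \<zero> = x"
    and add_inverse: "x \<in> carrier H \<Longrightarrow> \<exists>y\<in>carrier H. x \<oplus> y = \<zero>"
    and scale_add_right: "\<lbrakk>x \<in> carrier H; y \<in> carrier H\<rbrakk> \<Longrightarrow> c \<odot> (x \<oplus> y) = c \<odot> x \<oplus> c \<odot> y"
    and scale_add_left: "x \<in> carrier H \<Longrightarrow> (c + d) \<odot> x = c \<odot> x \<oplus> d \<odot> x"
    and scale_scale: "x \<in> carrier H \<Longrightarrow> c \<odot> (d \<odot> x) = (c * d) \<odot> x"
    and scale_one: "x \<in> carrier H \<Longrightarrow> 1 \<odot> x = x"
    and inner_add_left: "\<lbrakk>x \<in> carrier H; y \<in> carrier H; z \<in> carrier H\<rbrakk>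
      \<Longrightarrow> hinner H (x \<oplus> y) z = hinner H x z + hinner H y z"
    and inner_scale_left: "\<lbrakk>x \<in> carrier H; y \<in> carrier H\<rbrakk>
      \<Longrightarrow> hinner H (c \<odot> x) y = c * hinner H x y"
    and inner_commute: "\<lbrakk>x \<in> carrier H; y \<in> carrier H\<rbrakk>
      \<Longrightarrow> hinner H x y = cnj (hinner H y x)"
    and inner_nonneg: "x \<in> carrier H \<Longrightarrow> hinner H x x \<in> \<real>\<^sub>\<ge>\<^sub>0"
    and inner_eq_zero: "\<lbrakk>x \<in> carrier H; hinner H x x = 0\<rbrakk> \<Longrightarrow> x = \<zero>"
    and complete: "\<lbrakk>\<And>n. X n \<in> carrier H;
        \<And>e. e > 0 \<Longrightarrow> \<exists>N. \<forall>m\<ge>N. \<forall>n\<ge>N. hnorm H (X m \<ominus> X n) < e\<rbrakk>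
      \<Longrightarrow> \<exists>x. hconverges H X x"


section \<open>Operators\<close>

definition hlinear :: "'a hspace \<Rightarrow> 'b hspace \<Rightarrow> ('a \<Rightarrow> 'b) \<Rightarrow> bool" where
  "hlinear H K A \<longleftrightarrow> A \<in> carrier H \<rightarrow> carrier K \<and>
     (\<forall>x\<in>carrier H. \<forall>y\<in>carrier H. A (x \<oplus>\<^bsub>H\<^esub> y) = A x \<oplus>\<^bsub>K\<^esub> A y) \<and>
     (\<forall>c. \<forall>x\<in>carrier H. A (c \<odot>\<^bsub>H\<^esub> x) = c \<odot>\<^bsub>K\<^esub> A x)"

definition hbounded_linear :: "'a hspace \<Rightarrow> ('a \<Rightarrow> 'a) \<Rightarrow> bool" where
  "hbounded_linear H A \<longleftrightarrow> hlinear H H A \<and>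
     (\<exists>C. \<forall>x\<in>carrier H. hnorm H (A x) \<le> C * hnorm H x)"

text \<open>\<open>is_adjoint H A B\<close> means \<open>A\<^sup>* = B\<close>, for everywhere defined bounded operators.\<close>

definition is_adjoint :: "'a hspace \<Rightarrow> ('a \<Rightarrow> 'a) \<Rightarrow> ('a \<Rightarrow> 'a) \<Rightarrow> bool" where
  "is_adjoint H A B \<longleftrightarrow>
     (\<forall>x\<in>carrier H. \<forall>y\<in>carrier H. hinner H (A x) y = hinner H x (B y))"

definition hunitary :: "'a hspace \<Rightarrow> ('a \<Rightarrow> 'a) \<Rightarrow> bool" where
  "hunitary H U \<longleftrightarrow> hlinear H H U \<and> bij_betw U (carrier H) (carrier H) \<and>
     (\<forall>x\<in>carrier H. \<forall>y\<in>carrier H. hinner H (U x) (U y) = hinner H x y)"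

text \<open>
  Operators that are not everywhere defined are partial maps: \<open>dom V\<close> is the domain of
  \<open>V\<close>, and \<open>V \<circ>\<^sub>m W\<close> is the operator product with its natural domain
  \<open>{h \<in> dom W. W h \<in> dom V}\<close>.
\<close>

definition linear_operator :: "'a hspace \<Rightarrow> ('a \<rightharpoonup> 'a) \<Rightarrow> bool" where
  "linear_operator H V \<longleftrightarrow> dom V \<subseteq> carrier H \<and> ran V \<subseteq> carrier H \<and> \<zero>\<^bsub>H\<^esub> \<in> dom V \<and>
     (\<forall>x\<in>dom V. \<forall>y\<in>dom V. V (x \<oplus>\<^bsub>H\<^esub> y) = Some (the (V x) \<oplus>\<^bsub>H\<^esub> the (V y))) \<and>
     (\<forall>c. \<forall>x\<in>dom V. V (c \<odot>\<^bsub>H\<^esub> x) = Some (c \<odot>\<^bsub>H\<^esub> the (V x)))"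

definition closed_operator :: "'a hspace \<Rightarrow> ('a \<rightharpoonup> 'a) \<Rightarrow> bool" where
  "closed_operator H V \<longleftrightarrow> (\<forall>X x y. (\<forall>n. X n \<in> dom V) \<longrightarrow> hconverges H X x \<longrightarrow>
     hconverges H (\<lambda>n. the (V (X n))) y \<longrightarrow> V x = Some y)"

definition closed_isometric_operator :: "'a hspace \<Rightarrow> ('a \<rightharpoonup> 'a) \<Rightarrow> bool" where
  "closed_isometric_operator H V \<longleftrightarrow> linear_operator H V \<and> closed_operator H V \<and>
     (\<forall>h\<in>dom V. hnorm H (the (V h)) = hnorm H h)"


section \<open>Generalized resolvents of a pair of isometric operators\<close>

definition Te :: "complex set" where
  "Te = {z. cmod z \<noteq> 1}"

text \<open>The inclusion of a Hilbert space into a larger one is an inner product preserving map.\<close>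

definition hembedding :: "'a hspace \<Rightarrow> 'b hspace \<Rightarrow> ('a \<Rightarrow> 'b) \<Rightarrow> bool" where
  "hembedding H K J \<longleftrightarrow> hlinear H K J \<and>
     (\<forall>x\<in>carrier H. \<forall>y\<in>carrier H. hinner K (J x) (J y) = hinner H x y)"

text \<open>\<open>p\<close> is the orthogonal projection of \<open>x\<close> onto the subspace \<open>M\<close>.\<close>

definition is_orth_proj :: "'a hspace \<Rightarrow> 'a set \<Rightarrow> 'a \<Rightarrow> 'a \<Rightarrow> bool" where
  "is_orth_proj K M x p \<longleftrightarrow> p \<in> M \<and> (\<forall>m\<in>M. hinner K (x \<ominus>\<^bsub>K\<^esub> p) m = 0)"

text \<open>
  \<open>(E + z U) (E - z U)\<^sup>-\<^sup>1\<close>. It is only used for unitary \<open>U\<close> and \<open>z \<in> Te\<close>, where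
  \<open>E - z U\<close> is a bijection of the carrier.
\<close>

definition cayley :: "'a hspace \<Rightarrow> ('a \<Rightarrow> 'a) \<Rightarrow> complex \<Rightarrow> 'a \<Rightarrow> 'a" where
  "cayley K U z x =
     (let y = inv_into (carrier K) (\<lambda>y. y \<ominus>\<^bsub>K\<^esub> z \<odot>\<^bsub>K\<^esub> U y) x in y \<oplus>\<^bsub>K\<^esub> z \<odot>\<^bsub>K\<^esub> U y)"

text \<open>
  The type argument is the universe from which the carrier of the larger Hilbert space \<open>K\<close>
  is taken. \<open>J\<close> plays the role of the inclusion of \<open>H\<close> into \<open>K\<close>.
  The universe has to be large enough for minimal extensions. If \<open>K\<close> is the closed span of the
  vectors \<open>U1\<^sup>m (U2\<^sup>n (J h))\<close>, \<open>m, n \<in> \<int>\<close>, then \<open>x \<in> K\<close> is determined by the components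
  of \<open>U1\<^sup>m (U2\<^sup>n x)\<close> in \<open>H\<close>, so that \<^typ>\<open>int \<times> int \<Rightarrow> 'a\<close> suffices. With the universe
  \<^typ>\<open>(int \<times> int \<Rightarrow> 'a) + 'k\<close> for a type variable \<^typ>\<open>'k\<close>, no Hilbert space \<open>K\<close> is excluded,
  however large.
\<close>

definition generalized_resolvent ::
  "'k itself \<Rightarrow> 'a hspace \<Rightarrow> ('a \<rightharpoonup> 'a) \<Rightarrow> ('a \<rightharpoonup> 'a) \<Rightarrow> (complex \<Rightarrow> complex \<Rightarrow> 'a \<Rightarrow> 'a) \<Rightarrow> bool"
where
  "generalized_resolvent TYPE('k) H V1 V2 R \<longleftrightarrow>
    (\<exists>(K :: 'k hspace) J U1 U2.
       complex_hilbert_space K \<and> hembedding H K J \<and>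
       hunitary K U1 \<and> hunitary K U2 \<and> (\<forall>x\<in>carrier K. U1 (U2 x) = U2 (U1 x)) \<and>
       (\<forall>h\<in>dom V1. U1 (J h) = J (the (V1 h))) \<and>
       (\<forall>h\<in>dom V2. U2 (J h) = J (the (V2 h))) \<and>
       (\<forall>z1\<in>Te. \<forall>z2\<in>Te. \<forall>h\<in>carrier H.
          is_orth_proj K (J ` carrier H) (cayley K U1 z1 (cayley K U2 z2 (J h))) (J (R z1 z2 h))))"


section \<open>The class \<open>H\<^sub>2\<close> of Koranyi\<close>

text \<open>
  Points of the extended complex plane are elements of \<^typ>\<open>complex option\<close>, where \<^const>\<open>None\<close>
  stands for infinity (as in \<^const>\<open>Alexandroff_compactification\<close>).
\<close>

definition Te_inf :: "complex option set" where
  "Te_inf = insert None (Some ` Te)"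

text \<open>The map \<open>z \<mapsto> 1 / cnj z\<close> of the extended plane.\<close>

definition reflect :: "complex option \<Rightarrow> complex option" where
  "reflect z = (case z of None \<Rightarrow> Some 0
     | Some w \<Rightarrow> if w = 0 then None else Some (inverse (cnj w)))"

text \<open>The coordinate \<open>u = 1 / z\<close> at infinity, as a map from \<open>u\<close> to \<open>z\<close>.\<close>

definition chart_inf :: "complex \<Rightarrow> complex option" where
  "chart_inf u = (if u = 0 then None else Some (inverse u))"

text \<open>Joint holomorphy in two variables: complex Frechet differentiability at each point.\<close>

definition holomorphic2_on :: "(complex \<Rightarrow> complex \<Rightarrow> complex) \<Rightarrow> (complex \<times> complex) set \<Rightarrow> bool" where
  "holomorphic2_on f S \<longleftrightarrow> (\<forall>p\<in>S. \<exists>a b.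
     ((\<lambda>(z1, z2). f z1 z2) has_derivative (\<lambda>(h1, h2). a * h1 + b * h2)) (at p within S))"

text \<open>As \<open>Te\<close> is invariant under \<open>u \<mapsto> 1 / u\<close>, the two coordinates cover \<open>Te_inf\<close>.\<close>

definition class_H2 :: "(complex option \<Rightarrow> complex option \<Rightarrow> complex) \<Rightarrow> bool" where
  "class_H2 f \<longleftrightarrow>
     (\<forall>c1\<in>{Some, chart_inf}. \<forall>c2\<in>{Some, chart_inf}.
        holomorphic2_on (\<lambda>z1 z2. f (c1 z1) (c2 z2)) (Te \<times> Te)) \<and>
     (\<forall>z1\<in>Te_inf. \<forall>z2\<in>Te_inf. f (reflect z1) (reflect z2) = cnj (f z1 z2)) \<and>
     (\<forall>w1 w2. cmod w1 < 1 \<longrightarrow> cmod w2 < 1 \<longrightarrow>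
        (let z1 = Some w1; z2 = Some w2
         in f z1 z2 - f (reflect z1) z2 - f z1 (reflect z2) + f (reflect z1) (reflect z2)) \<in> \<real>\<^sub>\<ge>\<^sub>0) \<and>
     (\<forall>z1\<in>Te_inf. f z1 (Some 0) + f z1 None = 0) \<and>
     (\<forall>z2\<in>Te_inf. f (Some 0) z2 + f None z2 = 0)"

text \<open>\<open>F\<close> is the extension of \<open>f\<close> from \<open>Te \<times> Te\<close> by (iterated) limits at infinity.\<close>

definition limit_extension ::
  "(complex \<Rightarrow> complex \<Rightarrow> complex) \<Rightarrow> (complex option \<Rightarrow> complex option \<Rightarrow> complex) \<Rightarrow> bool" where
  "limit_extension f F \<longleftrightarrow>
     (\<forall>z1\<in>Te. \<forall>z2\<in>Te. F (Some z1) (Some z2) = f z1 z2) \<and>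
     (\<forall>z2\<in>Te. ((\<lambda>z1. f z1 z2) \<longlongrightarrow> F None (Some z2)) at_infinity) \<and>
     (\<forall>z1\<in>Te. ((\<lambda>z2. f z1 z2) \<longlongrightarrow> F (Some z1) None) at_infinity) \<and>
     ((\<lambda>z2. F None (Some z2)) \<longlongrightarrow> F None None) at_infinity"

end

theory Submission
  imports Defs "HOL-Complex_Analysis.Complex_Analysis"
begin

text \<open>
  Write \<open>C(z) = (E + z U) (E - z U)\<^sup>-\<^sup>1\<close> for the Cayley transform of a unitary operator. It equals \<open>- E\<close>
  at infinity, replacing \<open>z\<close> by \<open>1 / z\<close> changes it into minus the Cayley transform of \<open>U\<^sup>-\<^sup>1\<close>, and
  \<open>\<langle>C(z) x, y\<rangle> = \<langle>x, y\<rangle> + 2 \<Sum> z\<^sup>n \<langle>U\<^sup>n x, y\<rangle>\<close> (\<open>n \<ge> 1\<close>) in the disc. A generalized resolvent is the compression of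
  a product \<open>C\<^sub>1(z1) C\<^sub>2(z2)\<close>. This gives the algebraic conditions at once. Holomorphy in all four pairs
  of charts reduces to the finite chart (\<open>cayley2_holomorphic\<close>), and the combination in the positivity
  condition of the class \<open>H\<^sub>2\<close> equals \<open>4 (1 - \<bar>z1\<bar>\<^sup>2) (1 - \<bar>z2\<bar>\<^sup>2)\<close> times a squared norm (\<open>cayley_ext_poisson2\<close>).

  Conversely, let the conditions hold. For vectors \<open>x, y\<close> the function \<open>\<langle>R x, y\<rangle>\<close> is a polarisation of
  functions of the class \<open>H\<^sub>2\<close>. Expanding it in each variable at \<open>0\<close> and at infinity gives moments
  \<open>c p x y\<close> for \<open>p\<close> in the lattice of pairs of integers (\<open>has_moments2_exist\<close>), and the function is
  determined by its moments. The combination in the positivity condition is four times the Poisson sum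
  \<open>\<Sum> c (m, n) x x r\<^bsup>\<bar>m\<bar> + \<bar>n\<bar>\<^esup> e\<^bsup>i (m s + n t)\<^esup>\<close> at \<open>z1 = r e\<^bsup>i s\<^esup>\<close>, \<open>z2 = r e\<^bsup>i t\<^esup>\<close>. Integrating it against characters shows that \<open>c\<close> is a
  positive definite function of \<open>p\<close> whose values are sesquilinear forms (\<open>moments_positive_definite\<close>).
  By the construction of Naimark and Aronszajn it is \<open>\<langle>U\<^sub>1\<^sup>m U\<^sub>2\<^sup>n x, y\<rangle>\<close> for commuting unitary operators in
  a larger space (\<open>lattice_dilation\<close>): the space is the reproducing kernel Hilbert space of
  \<open>c (p - q) x y\<close> on pairs \<open>(p, x)\<close>, and the operators are the two shifts of \<open>p\<close>. Since the compression
  of \<open>C\<^sub>1(z1) C\<^sub>2(z2)\<close> has the same moments as \<open>R\<close>, the two agree.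

  The last two conditions say that the compression of \<open>(E - \<zeta> U)\<^sup>-\<^sup>1\<close> takes \<open>(E - \<zeta> V) g\<close> to \<open>g\<close>. If \<open>U\<close>
  extends \<open>V\<close>, this is clear; conversely a comparison of norms shows that already one value \<open>\<zeta> \<noteq> 0\<close>
  forces \<open>U g = V g\<close> (\<open>extension_of_resolvent\<close>).
\<close>

section \<open>Inner product spaces on a carrier\<close>

text \<open>Completeness is split off because the linear span of the kernel functions below carries an inner
  product before it is completed.\<close>

locale complex_inner_space =
  fixes H :: "'a hspace" (structure)
  assumes zero_closed: "\<zero> \<in> carrier H"
    and add_closed: "\<lbrakk>x \<in> carrier H; y \<in> carrier H\<rbrakk> \<Longrightarrow> x \<oplus> y \<in> carrier H"
    and scale_closed: "x \<in> carrier H \<Longrightarrow> c \<odot> x \<in> carrier H"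
    and add_assoc: "\<lbrakk>x \<in> carrier H; y \<in> carrier H; z \<in> carrier H\<rbrakk>
      \<Longrightarrow> (x \<oplus> y) \<oplus> z = x \<oplus> (y \<oplus> z)"
    and add_commute: "\<lbrakk>x \<in> carrier H; y \<in> carrier H\<rbrakk> \<Longrightarrow> x \<oplus> y = y \<oplus> x"
    and add_zero: "x \<in> carrier H \<Longrightarrow> x \<oplus> \<zero> = x"
    and add_inverse: "x \<in> carrier H \<Longrightarrow> \<exists>y\<in>carrier H. x \<oplus> y = \<zero>"
    and scale_add_right: "\<lbrakk>x \<in> carrier H; y \<in> carrier H\<rbrakk> \<Longrightarrow> c \<odot> (x \<oplus> y) = c \<odot> x \<oplus> c \<odot> y"
    and scale_add_left: "x \<in> carrier H \<Longrightarrow> (c + d) \<odot> x = c \<odot> x \<oplus> d \<odot> x"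
    and scale_scale: "x \<in> carrier H \<Longrightarrow> c \<odot> (d \<odot> x) = (c * d) \<odot> x"
    and scale_one: "x \<in> carrier H \<Longrightarrow> 1 \<odot> x = x"
    and inner_add_left: "\<lbrakk>x \<in> carrier H; y \<in> carrier H; z \<in> carrier H\<rbrakk>
      \<Longrightarrow> hinner H (x \<oplus> y) z = hinner H x z + hinner H y z"
    and inner_scale_left: "\<lbrakk>x \<in> carrier H; y \<in> carrier H\<rbrakk>
      \<Longrightarrow> hinner H (c \<odot> x) y = c * hinner H x y"
    and inner_commute: "\<lbrakk>x \<in> carrier H; y \<in> carrier H\<rbrakk>
      \<Longrightarrow> hinner H x y = cnj (hinner H y x)"
    and inner_nonneg: "x \<in> carrier H \<Longrightarrow> hinner H x x \<in> \<real>\<^sub>\<ge>\<^sub>0"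
    and inner_eq_zero: "\<lbrakk>x \<in> carrier H; hinner H x x = 0\<rbrakk> \<Longrightarrow> x = \<zero>"
begin

abbreviation ip (\<open>\<langle>_, _\<rangle>\<close>) where "ip x y \<equiv> hinner H x y"
abbreviation nrm (\<open>\<parallel>_\<parallel>\<close>) where "nrm x \<equiv> hnorm H x"

lemma minus_closed: "\<lbrakk>x \<in> carrier H; y \<in> carrier H\<rbrakk> \<Longrightarrow> x \<ominus> y \<in> carrier H"
  by (simp add: hminus_def add_closed scale_closed)

lemmas closed [simp, intro] = zero_closed add_closed scale_closed minus_closed

lemma inner_add_right: "\<lbrakk>x \<in> carrier H; y \<in> carrier H; z \<in> carrier H\<rbrakk>
    \<Longrightarrow> \<langle>z, x \<oplus> y\<rangle> = \<langle>z, x\<rangle> + \<langle>z, y\<rangle>"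
  using inner_commute[of z "x \<oplus> y"] inner_commute[of x z] inner_commute[of y z]
  by (simp add: inner_add_left)

lemma inner_scale_right: "\<lbrakk>x \<in> carrier H; y \<in> carrier H\<rbrakk> \<Longrightarrow> \<langle>y, c \<odot> x\<rangle> = cnj c * \<langle>y, x\<rangle>"
  using inner_commute[of y "c \<odot> x"] inner_commute[of x y] by (simp add: inner_scale_left)

lemma inner_minus_left: "\<lbrakk>x \<in> carrier H; y \<in> carrier H; z \<in> carrier H\<rbrakk>
    \<Longrightarrow> \<langle>x \<ominus> y, z\<rangle> = \<langle>x, z\<rangle> - \<langle>y, z\<rangle>"
  by (simp add: hminus_def inner_add_left inner_scale_left)

lemma inner_minus_right: "\<lbrakk>x \<in> carrier H; y \<in> carrier H; z \<in> carrier H\<rbrakk>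
    \<Longrightarrow> \<langle>z, x \<ominus> y\<rangle> = \<langle>z, x\<rangle> - \<langle>z, y\<rangle>"
  by (simp add: hminus_def inner_add_right inner_scale_right)

lemma zero_inner_left: "x \<in> carrier H \<Longrightarrow> \<langle>\<zero>, x\<rangle> = 0"
  using inner_add_left[of \<zero> \<zero> x] by (simp add: add_zero)

lemma zero_inner_right: "x \<in> carrier H \<Longrightarrow> \<langle>x, \<zero>\<rangle> = 0"
  using inner_add_right[of \<zero> \<zero> x] by (simp add: add_zero)

lemmas inner_simps = inner_add_left inner_add_right inner_scale_left inner_scale_right
  inner_minus_left inner_minus_right zero_inner_left zero_inner_right

lemma minus_eq_zeroD:
  assumes "x \<in> carrier H" "y \<in> carrier H" "x \<ominus> y = \<zero>" shows "x = y"
proof -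
  have "(x \<ominus> y) \<oplus> y = x \<oplus> ((- 1) \<odot> y \<oplus> y)"
    using assms(1,2) by (simp add: hminus_def add_assoc)
  also have "(- 1) \<odot> y \<oplus> y = ((- 1) + 1) \<odot> y"
    using assms scale_add_left[of y "-1" 1] scale_one by simp
  also have "((- 1) + 1) \<odot> y = \<zero>"
    by (rule inner_eq_zero) (use assms in \<open>simp_all add: inner_simps\<close>)
  finally have "(x \<ominus> y) \<oplus> y = x" using assms by (simp add: add_zero)
  moreover have "\<zero> \<oplus> y = y" using assms add_commute[of \<zero> y] by (simp add: add_zero)
  ultimately show ?thesis using assms by simp
qed

text \<open>Vector identities are decided by pairing both sides with all vectors; this turns them into
  identities between complex numbers.\<close>

lemma vector_eqI:
  assumes "x \<in> carrier H" "y \<in> carrier H" "\<And>g. g \<in> carrier H \<Longrightarrow> \<langle>x, g\<rangle> = \<langle>y, g\<rangle>"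
  shows "x = y"
proof (rule minus_eq_zeroD)
  show "x \<ominus> y = \<zero>"
    by (rule inner_eq_zero) (use assms in \<open>simp_all add: inner_minus_left\<close>)
qed (use assms in auto)

lemma inner_self_nonneg: "x \<in> carrier H \<Longrightarrow> 0 \<le> Re \<langle>x, x\<rangle>"
  using inner_nonneg[of x] by (simp add: complex_nonneg_Reals_iff)

lemma norm_ge_0: "x \<in> carrier H \<Longrightarrow> 0 \<le> \<parallel>x\<parallel>"
  by (simp add: hnorm_def inner_self_nonneg)

lemma inner_self: "x \<in> carrier H \<Longrightarrow> \<langle>x, x\<rangle> = of_real (\<parallel>x\<parallel>\<^sup>2)"
  using inner_nonneg[of x] by (simp add: hnorm_def complex_nonneg_Reals_iff complex_eq_iff)

lemma norm_sq: "x \<in> carrier H \<Longrightarrow> \<parallel>x\<parallel>\<^sup>2 = Re \<langle>x, x\<rangle>"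
  by (simp add: hnorm_def inner_self_nonneg)

lemma norm_eq_zeroD: "\<lbrakk>x \<in> carrier H; \<parallel>x\<parallel> = 0\<rbrakk> \<Longrightarrow> x = \<zero>"
  by (rule inner_eq_zero) (auto simp: inner_self)

lemma norm_zero: "\<parallel>\<zero>\<parallel> = 0"
  by (simp add: hnorm_def zero_inner_left)

lemma norm_scale: "x \<in> carrier H \<Longrightarrow> \<parallel>c \<odot> x\<parallel> = cmod c * \<parallel>x\<parallel>"
proof -
  assume x: "x \<in> carrier H"
  have "c * (cnj c * \<langle>x, x\<rangle>) = of_real ((cmod c * \<parallel>x\<parallel>)\<^sup>2)"
    using x by (simp add: inner_self power_mult_distrib complex_norm_square del: of_real_power) 
  then have "\<langle>c \<odot> x, c \<odot> x\<rangle> = of_real ((cmod c * \<parallel>x\<parallel>)\<^sup>2)"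
    using x by (simp only: inner_simps closed mult_ac)
  then have "\<parallel>c \<odot> x\<parallel>\<^sup>2 = (cmod c * \<parallel>x\<parallel>)\<^sup>2"
    using x by (simp only: norm_sq[of "c \<odot> x"] closed Re_complex_of_real)
  then show ?thesis using x by (simp add: norm_ge_0 power2_eq_iff_nonneg)
qed

lemma Cauchy_Schwarz:
  assumes "x \<in> carrier H" "y \<in> carrier H"
  shows "cmod \<langle>x, y\<rangle> \<le> \<parallel>x\<parallel> * \<parallel>y\<parallel>"
proof (cases "\<parallel>y\<parallel> = 0")
  case True
  then have "y = \<zero>" using assms norm_eq_zeroD by blast
  then show ?thesis using assms by (simp add: zero_inner_right norm_zero)
next
  case False
  define a where "a = \<langle>x, y\<rangle>"
  define n where "n = \<parallel>y\<parallel>"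
  define t where "t = a / of_real (n\<^sup>2)"
  have n: "n > 0" using False norm_ge_0[OF assms(2)] by (simp add: n_def)
  have yx: "\<langle>y, x\<rangle> = cnj a" using assms inner_commute a_def by blast
  have "\<langle>x \<ominus> t \<odot> y, x \<ominus> t \<odot> y\<rangle>
      = of_real (\<parallel>x\<parallel>\<^sup>2) - t * cnj a - cnj t * a + t * cnj t * of_real (n\<^sup>2)"
    using assms yx
    by (simp add: inner_simps inner_self[symmetric] n_def a_def[symmetric] algebra_simps)
      (simp add: inner_self)
  also have "\<dots> = of_real (\<parallel>x\<parallel>\<^sup>2 - (cmod a)\<^sup>2 / n\<^sup>2)"
  proof -
    have "t * cnj t * of_real (n\<^sup>2) = cnj t * a"
      using n by (simp add: t_def field_simps power2_eq_square power4_eq_xxxx)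
    moreover have "t * cnj a = of_real ((cmod a)\<^sup>2 / n\<^sup>2)"
      using complex_norm_square[of a] by (simp add: t_def)
    ultimately show ?thesis by (simp only: of_real_diff) simp
  qed
  finally have "0 \<le> \<parallel>x\<parallel>\<^sup>2 - (cmod a)\<^sup>2 / n\<^sup>2"
    using inner_self_nonneg[of "x \<ominus> t \<odot> y"] assms by simp
  then have "(cmod a)\<^sup>2 \<le> (\<parallel>x\<parallel> * n)\<^sup>2" using n by (simp add: field_simps power_mult_distrib)
  then show ?thesis
    using assms n norm_ge_0 by (simp add: a_def n_def power2_le_iff_abs_le)
qed

lemma norm_triangle:
  assumes "x \<in> carrier H" "y \<in> carrier H"
  shows "\<parallel>x \<oplus> y\<parallel> \<le> \<parallel>x\<parallel> + \<parallel>y\<parallel>"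
proof (rule power2_le_imp_le)
  have "\<parallel>x \<oplus> y\<parallel>\<^sup>2 = \<parallel>x\<parallel>\<^sup>2 + \<parallel>y\<parallel>\<^sup>2 + 2 * Re \<langle>x, y\<rangle>"
    using assms inner_commute[of y x] by (simp add: norm_sq inner_simps)
  also have "Re \<langle>x, y\<rangle> \<le> \<parallel>x\<parallel> * \<parallel>y\<parallel>"
    using Cauchy_Schwarz[OF assms] complex_Re_le_cmod order_trans by blast
  finally show "\<parallel>x \<oplus> y\<parallel>\<^sup>2 \<le> (\<parallel>x\<parallel> + \<parallel>y\<parallel>)\<^sup>2" by (simp add: power2_sum)
qed (use assms norm_ge_0 in auto)

lemma norm_minus_commute:
  assumes "x \<in> carrier H" "y \<in> carrier H" shows "\<parallel>x \<ominus> y\<parallel> = \<parallel>y \<ominus> x\<parallel>"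
  using assms by (simp add: hnorm_def inner_simps algebra_simps)

lemma minus_minus_telescope:
  "\<lbrakk>x \<in> carrier H; y \<in> carrier H; z \<in> carrier H\<rbrakk> \<Longrightarrow> (x \<ominus> y) \<oplus> (y \<ominus> z) = x \<ominus> z"
  by (rule vector_eqI) (simp_all add: inner_simps)

lemma dist_triangle:
  assumes "x \<in> carrier H" "y \<in> carrier H" "z \<in> carrier H"
  shows "\<parallel>x \<ominus> z\<parallel> \<le> \<parallel>x \<ominus> y\<parallel> + \<parallel>y \<ominus> z\<parallel>"
  using norm_triangle[of "x \<ominus> y" "y \<ominus> z"] assms by (simp add: minus_minus_telescope)

lemma norm_diff_le:
  assumes "x \<in> carrier H" "y \<in> carrier H" shows "\<bar>\<parallel>x\<parallel> - \<parallel>y\<parallel>\<bar> \<le> \<parallel>x \<ominus> y\<parallel>"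
proof -
  have "(x \<ominus> y) \<oplus> y = x" "(y \<ominus> x) \<oplus> x = y"
    by (rule vector_eqI; use assms in \<open>simp add: inner_simps\<close>)+
  then show ?thesis
    using norm_triangle[of "x \<ominus> y" y] norm_triangle[of "y \<ominus> x" x] norm_minus_commute[OF assms] assms by simp
qed

lemma polarization:
  assumes "x \<in> carrier H" "y \<in> carrier H"
  shows "\<langle>x, y\<rangle> = (of_real (\<parallel>x \<oplus> 1 \<odot> y\<parallel>\<^sup>2) - of_real (\<parallel>x \<oplus> (- 1) \<odot> y\<parallel>\<^sup>2)
    + \<i> * of_real (\<parallel>x \<oplus> \<i> \<odot> y\<parallel>\<^sup>2) - \<i> * of_real (\<parallel>x \<oplus> (- \<i>) \<odot> y\<parallel>\<^sup>2)) / 4"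
  unfolding inner_self[OF add_closed[OF assms(1) scale_closed[OF assms(2)]], symmetric]
  using assms by (simp add: inner_simps field_simps)

lemma dist_zero_iff: 
  assumes "x \<in> carrier H" "y \<in> carrier H" shows "\<parallel>x \<ominus> y\<parallel> = 0 \<longleftrightarrow> x = y"
proof
  assume "x = y"
  then show "\<parallel>x \<ominus> y\<parallel> = 0" using assms by (simp add: hnorm_def inner_simps)
qed (use assms norm_eq_zeroD minus_eq_zeroD in auto)

end

sublocale complex_hilbert_space \<subseteq> complex_inner_space
  by unfold_locales
    (fact zero_closed add_closed scale_closed add_assoc add_commute add_zero add_inverse
      scale_add_right scale_add_left scale_scale scale_one inner_add_left inner_scale_left
      inner_commute inner_nonneg inner_eq_zero)+

text \<open>A quadratic polynomial in \<open>t\<close> that is minimal at \<open>t = 0\<close> has no linear term. The common factor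
  \<open>d\<close> of the two coefficients comes from varying a vector in the direction of its own defect.\<close>

lemma quadratic_nonneg_imp_zero:
  fixes d q :: real
  assumes "0 \<le> d" "0 \<le> q" "\<And>t. 0 \<le> t\<^sup>2 * (d * q) - 2 * t * d"
  shows "d = 0"
proof -
  define t where "t = 1 / (1 + q)"
  have "t > 0" "t * q \<le> 1" using assms(2) by (auto simp: t_def field_simps)
  then have "t * (t * q) * d \<le> t * d"
    using assms(1) mult_right_mono[of "t * q" 1 "t * d"] by (simp add: mult_ac)
  then have "t * d \<le> 0" using assms(3)[of t] by (simp add: power2_eq_square mult_ac)
  then show ?thesis using \<open>t > 0\<close> assms(1) by (simp add: mult_le_0_iff)
qed

section \<open>The Riesz representation theorem\<close>

context complex_hilbert_space
begin

text \<open>The representing vector is the minimiser of \<open>\<parallel>x\<parallel>\<^sup>2 - 2 Re (F x)\<close>. A minimising sequence is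
  Cauchy by the parallelogram law, and the first variation at the minimum vanishes.\<close>

theorem Riesz_representation:
  fixes F :: "'a \<Rightarrow> complex"
  assumes add: "\<And>x y. \<lbrakk>x \<in> carrier H; y \<in> carrier H\<rbrakk> \<Longrightarrow> F (x \<oplus> y) = F x + F y"
    and scale: "\<And>c x. x \<in> carrier H \<Longrightarrow> F (c \<odot> x) = cnj c * F x"
    and bound: "\<And>x. x \<in> carrier H \<Longrightarrow> cmod (F x) \<le> C * \<parallel>x\<parallel>"
  obtains v where "v \<in> carrier H" "\<And>x. x \<in> carrier H \<Longrightarrow> F x = \<langle>v, x\<rangle>"
proof -
  define E where "E = (\<lambda>x. \<parallel>x\<parallel>\<^sup>2 - 2 * Re (F x))"
  have Fm: "F (x \<ominus> y) = F x - F y" if "x \<in> carrier H" "y \<in> carrier H" for x y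
    using that by (simp add: hminus_def add scale)
  have lower: "- C\<^sup>2 \<le> E x" if "x \<in> carrier H" for x
  proof -
    have "Re (F x) \<le> C * \<parallel>x\<parallel>" using bound[OF that] complex_Re_le_cmod order_trans by blast
    moreover have "0 \<le> (\<parallel>x\<parallel> - C)\<^sup>2" by simp
    ultimately show ?thesis by (simp add: E_def power2_diff mult.commute)
  qed
  define m where "m = (INF x\<in>carrier H. E x)"
  have bdd: "bdd_below (E ` carrier H)" using lower by (rule bdd_belowI2)
  have m_le: "m \<le> E x" if "x \<in> carrier H" for x
    unfolding m_def using bdd that by (rule cINF_lower)
  have "\<exists>x\<in>carrier H. E x < m + e" if "e > 0" for e
    using cINF_less_iff[OF _ bdd, of "m + e"] that zero_closed unfolding m_def[symmetric] by auto
  then have "\<forall>n. \<exists>x\<in>carrier H. E x < m + inverse (real (Suc n))" by simp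
  then obtain X where X: "\<And>n. X n \<in> carrier H" "\<And>n. E (X n) < m + inverse (real (Suc n))"
    by metis
  have par: "\<parallel>x \<ominus> y\<parallel>\<^sup>2 = 2 * E x + 2 * E y - 4 * E ((1/2) \<odot> (x \<oplus> y))"
    if "x \<in> carrier H" "y \<in> carrier H" for x y
    using that by (simp add: E_def norm_sq inner_simps add scale field_simps)
  have est: "\<parallel>X i \<ominus> X j\<parallel>\<^sup>2 \<le> 4 * inverse (real (Suc N))" if "i \<ge> N" "j \<ge> N" for i j N
  proof -
    have "inverse (real (Suc i)) \<le> inverse (real (Suc N))" "inverse (real (Suc j)) \<le> inverse (real (Suc N))"
      using that by auto
    moreover have "m \<le> E ((1/2) \<odot> (X i \<oplus> X j))" using m_le X(1) by simp
    ultimately show ?thesis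
      unfolding par[OF X(1) X(1)] using X(2)[of i] X(2)[of j] by linarith
  qed
  have "\<exists>N. \<forall>m\<ge>N. \<forall>n\<ge>N. \<parallel>X m \<ominus> X n\<parallel> < e" if "e > 0" for e
  proof -
    obtain N where N: "inverse (real (Suc N)) < e\<^sup>2 / 4"
      using \<open>e > 0\<close> reals_Archimedean[of "e\<^sup>2 / 4"] by auto
    have "\<parallel>X i \<ominus> X j\<parallel> < e" if "i \<ge> N" "j \<ge> N" for i j
    proof (rule power2_less_imp_less)
      show "\<parallel>X i \<ominus> X j\<parallel>\<^sup>2 < e\<^sup>2" using est[OF that] N by simp
    qed (use \<open>e > 0\<close> in simp)
    then show ?thesis by blast
  qed
  then obtain v where v: "hconverges H X v" using complete[of X] X(1) by blast
  have vc: "v \<in> carrier H" and lim: "(\<lambda>n. \<parallel>X n \<ominus> v\<parallel>) \<longlonglongrightarrow> 0"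
    using v by (auto simp: hconverges_def)
  have Ediff: "E v \<le> E (X n) + (2 * \<parallel>v\<parallel> + 2 * C) * \<parallel>X n \<ominus> v\<parallel>" for n
  proof -
    have "E v = E (X n) - \<parallel>X n \<ominus> v\<parallel>\<^sup>2 - 2 * Re \<langle>v, X n \<ominus> v\<rangle> + 2 * Re (F (X n \<ominus> v))"
      using X(1)[of n] vc inner_commute[of v "X n"]
      by (simp add: E_def norm_sq inner_simps Fm)
    moreover have "\<bar>Re \<langle>v, X n \<ominus> v\<rangle>\<bar> \<le> \<parallel>v\<parallel> * \<parallel>X n \<ominus> v\<parallel>"
      using Cauchy_Schwarz[of v "X n \<ominus> v"] abs_Re_le_cmod order_trans X(1) vc by blast
    moreover have "\<bar>Re (F (X n \<ominus> v))\<bar> \<le> C * \<parallel>X n \<ominus> v\<parallel>"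
      using bound[of "X n \<ominus> v"] abs_Re_le_cmod order_trans X(1) vc by blast
    moreover have "0 \<le> \<parallel>X n \<ominus> v\<parallel>\<^sup>2" by simp
    ultimately show ?thesis unfolding distrib_right by linarith
  qed
  have Ev: "E v \<le> m"
  proof (rule LIMSEQ_le_const)
    have "(\<lambda>n. m + inverse (real (Suc n)) + (2 * \<parallel>v\<parallel> + 2 * C) * \<parallel>X n \<ominus> v\<parallel>) \<longlonglongrightarrow> m + 0 + (2 * \<parallel>v\<parallel> + 2 * C) * 0"
      by (intro tendsto_intros lim LIMSEQ_inverse_real_of_nat)
    then show "(\<lambda>n. m + inverse (real (Suc n)) + (2 * \<parallel>v\<parallel> + 2 * C) * \<parallel>X n \<ominus> v\<parallel>) \<longlonglongrightarrow> m"
      by simp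
    have "E v \<le> m + inverse (real (Suc n)) + (2 * \<parallel>v\<parallel> + 2 * C) * \<parallel>X n \<ominus> v\<parallel>" for n
      using Ediff[of n] X(2)[of n] by linarith
    then show "\<exists>N. \<forall>n\<ge>N. E v \<le> m + inverse (real (Suc n)) + (2 * \<parallel>v\<parallel> + 2 * C) * \<parallel>X n \<ominus> v\<parallel>"
      by blast
  qed
  have "F x = \<langle>v, x\<rangle>" if x: "x \<in> carrier H" for x
  proof -
    define d where "d = F x - \<langle>v, x\<rangle>"
    have quad: "0 \<le> t\<^sup>2 * ((cmod d)\<^sup>2 * \<parallel>x\<parallel>\<^sup>2) - 2 * t * (cmod d)\<^sup>2" for t :: real
    proof -
      let ?s = "complex_of_real t * d"
      have "E (v \<oplus> ?s \<odot> x) = E v + Re (?s * cnj ?s * \<langle>x, x\<rangle>) - 2 * Re (cnj ?s * d)"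
        using x vc inner_commute[of x v]
        by (simp add: E_def norm_sq inner_simps add scale d_def algebra_simps)
      also have "?s * cnj ?s * \<langle>x, x\<rangle> = of_real (t\<^sup>2 * ((cmod d)\<^sup>2 * \<parallel>x\<parallel>\<^sup>2))"
        using x complex_norm_square[of d] by (simp add: inner_self power2_eq_square)
      also have "cnj ?s * d = of_real (t * (cmod d)\<^sup>2)"
        using complex_norm_square[of d] by (simp add: mult_ac)
      finally have "E (v \<oplus> ?s \<odot> x) = E v + t\<^sup>2 * ((cmod d)\<^sup>2 * \<parallel>x\<parallel>\<^sup>2) - 2 * (t * (cmod d)\<^sup>2)"
        by (simp only: Re_complex_of_real)
      moreover have "m \<le> E (v \<oplus> ?s \<odot> x)" using m_le x vc by simp
      ultimately show ?thesis using Ev by simp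
    qed
    have "(cmod d)\<^sup>2 = 0"
      by (rule quadratic_nonneg_imp_zero[OF _ _ quad]) auto
    then show ?thesis by (simp add: d_def)
  qed
  then show thesis using that vc by blast
qed

end

section \<open>The Hilbert space of a positive semidefinite kernel\<close>

text \<open>Only the set of functions and the inner product differ between the span of the kernel functions and
  its completion; the vector operations are pointwise in both.\<close>

definition fun_space ::
  "('i \<Rightarrow> complex) set \<Rightarrow> (('i \<Rightarrow> complex) \<Rightarrow> ('i \<Rightarrow> complex) \<Rightarrow> complex) \<Rightarrow> ('i \<Rightarrow> complex) hspace"
  where "fun_space S b = \<lparr>carrier = S, hzero = (\<lambda>_. 0), hadd = (\<lambda>f g i. f i + g i),
    hscale = (\<lambda>c f i. c * f i), hinner = b\<rparr>"

lemma fun_space_simps [simp]: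
  "carrier (fun_space S b) = S" "hzero (fun_space S b) = (\<lambda>_. 0)"
  "hadd (fun_space S b) f g = (\<lambda>i. f i + g i)" "hscale (fun_space S b) c f = (\<lambda>i. c * f i)"
  "hinner (fun_space S b) = b" "hminus (fun_space S b) f g = (\<lambda>i. f i - g i)"
  by (auto simp: fun_space_def hminus_def)

lemma fun_space_inner_space:
  assumes "(\<lambda>_. 0) \<in> S" "\<And>f g. \<lbrakk>f \<in> S; g \<in> S\<rbrakk> \<Longrightarrow> (\<lambda>i. f i + g i) \<in> S"
    "\<And>c f. f \<in> S \<Longrightarrow> (\<lambda>i. c * f i) \<in> S"
    "\<And>f g h. \<lbrakk>f \<in> S; g \<in> S; h \<in> S\<rbrakk> \<Longrightarrow> b (\<lambda>i. f i + g i) h = b f h + b g h"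
    "\<And>c f g. \<lbrakk>f \<in> S; g \<in> S\<rbrakk> \<Longrightarrow> b (\<lambda>i. c * f i) g = c * b f g"
    "\<And>f g. \<lbrakk>f \<in> S; g \<in> S\<rbrakk> \<Longrightarrow> b f g = cnj (b g f)"
    "\<And>f. f \<in> S \<Longrightarrow> b f f \<in> \<real>\<^sub>\<ge>\<^sub>0"
    "\<And>f. \<lbrakk>f \<in> S; b f f = 0\<rbrakk> \<Longrightarrow> f = (\<lambda>_. 0)"
  shows "complex_inner_space (fun_space S b)"
proof (unfold_locales, unfold fun_space_simps)
  fix f assume "f \<in> S"
  then show "\<exists>g\<in>S. (\<lambda>i. f i + g i) = (\<lambda>_. 0)"
    using assms(3)[of f "-1"] by (intro bexI[of _ "\<lambda>i. (-1) * f i"]) auto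
qed ((rule assms; assumption) | rule assms(1) | (simp add: algebra_simps; fail))+

locale psd_kernel =
  fixes k :: "'i \<Rightarrow> 'i \<Rightarrow> complex"
  assumes psd: "(\<Sum>(a, i)\<leftarrow>xs. \<Sum>(b, j)\<leftarrow>xs. a * cnj b * k i j) \<in> \<real>\<^sub>\<ge>\<^sub>0"
begin

text \<open>A list of pairs \<open>(a, i)\<close> stands for the formal linear combination \<open>\<Sum> a e\<^sub>i\<close>.
  Its inner product with \<open>e\<^sub>j\<close> is the value \<open>ev xs j\<close>, so \<open>ev xs\<close> is the function that it represents.\<close>

definition form :: "(complex \<times> 'i) list \<Rightarrow> (complex \<times> 'i) list \<Rightarrow> complex" where
  "form xs ys = (\<Sum>(a, i)\<leftarrow>xs. \<Sum>(b, j)\<leftarrow>ys. a * cnj b * k i j)"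

definition ev :: "(complex \<times> 'i) list \<Rightarrow> 'i \<Rightarrow> complex" where
  "ev xs j = (\<Sum>(a, i)\<leftarrow>xs. a * k i j)"

definition scl :: "complex \<Rightarrow> (complex \<times> 'i) list \<Rightarrow> (complex \<times> 'i) list" where
  "scl c = map (\<lambda>(a, i). (c * a, i))"

lemma ev_Nil [simp]: "ev [] = (\<lambda>_. 0)"
  and ev_Cons: "ev ((a, i) # xs) = (\<lambda>j. a * k i j + ev xs j)"
  and ev_append: "ev (xs @ ys) = (\<lambda>i. ev xs i + ev ys i)"
  by (auto simp: ev_def)

lemma ev_scl: "ev (scl c xs) = (\<lambda>i. c * ev xs i)"
proof
  show "ev (scl c xs) i = c * ev xs i" for i
    by (induction xs) (auto simp: ev_def scl_def algebra_simps)
qed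

lemma form_Cons_left: "form ((a, i) # xs) ys = a * (\<Sum>(b, j)\<leftarrow>ys. cnj b * k i j) + form xs ys"
  by (simp add: form_def sum_list_const_mult[symmetric] case_prod_unfold mult.assoc)

lemma form_eq_ev: "form xs ys = (\<Sum>(b, j)\<leftarrow>ys. cnj b * ev xs j)"
proof (induction xs)
  case Nil
  then show ?case by (simp add: form_def case_prod_unfold)
next
  case (Cons x xs)
  obtain a i where x: "x = (a, i)" by (cases x)
  show ?case unfolding x form_Cons_left Cons.IH ev_Cons
    by (induction ys) (auto simp: algebra_simps)
qed

lemma form_nonneg: "form xs xs \<in> \<real>\<^sub>\<ge>\<^sub>0"
  using psd by (simp add: form_def)

lemma kernel_commute: "k i j = cnj (k j i)"
proof -
  have d: "k i i \<in> \<real>\<^sub>\<ge>\<^sub>0" for i using psd[of "[(1, i)]"] by simp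
  have "k i i + k i j + (k j i + k j j) \<in> \<real>\<^sub>\<ge>\<^sub>0" using psd[of "[(1, i), (1, j)]"] by simp
  then have 1: "Im (k i j) + Im (k j i) = 0"
    using d[of i] d[of j] by (simp add: complex_nonneg_Reals_iff)
  have "k i i - \<i> * k i j + (\<i> * k j i + k j j) \<in> \<real>\<^sub>\<ge>\<^sub>0" using psd[of "[(1, i), (\<i>, j)]"] by simp
  then have 2: "Re (k j i) = Re (k i j)"
    using d[of i] d[of j] by (simp add: complex_nonneg_Reals_iff)
  show ?thesis using 1 2 by (simp add: complex_eq_iff)
qed

lemma form_commute: "form xs ys = cnj (form ys xs)"
proof (induction xs)
  case Nil
  then show ?case by (simp add: form_def case_prod_unfold)
next
  case (Cons x xs)
  obtain a i where x: "x = (a, i)" by (cases x)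
  have "a * (\<Sum>(b, j)\<leftarrow>ys. cnj b * k i j) = cnj (cnj a * ev ys i)"
    by (induction ys) (auto simp: ev_def algebra_simps kernel_commute[of i])
  then show ?case unfolding x form_Cons_left Cons.IH by (simp add: form_eq_ev[of ys])
qed

definition span_inner :: "('i \<Rightarrow> complex) \<Rightarrow> ('i \<Rightarrow> complex) \<Rightarrow> complex" where
  "span_inner f g = form (SOME xs. ev xs = f) (SOME xs. ev xs = g)"

text \<open>By \<open>form_eq_ev\<close> the form depends on its first argument only through the represented function, and by
  symmetry the same holds for the second.\<close>

lemma span_inner_ev: "span_inner (ev xs) (ev ys) = form xs ys"
proof -
  define xs' ys' where "xs' = (SOME zs. ev zs = ev xs)" and "ys' = (SOME zs. ev zs = ev ys)"
  have e: "ev xs' = ev xs" "ev ys' = ev ys"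
    unfolding xs'_def ys'_def by (rule someI[of _ xs], simp, rule someI[of _ ys], simp)
  have "form xs' ys' = form xs ys'" by (simp add: form_eq_ev e)
  also have "\<dots> = cnj (form ys' xs)" by (rule form_commute)
  also have "\<dots> = cnj (form ys xs)" by (simp add: form_eq_ev e)
  also have "\<dots> = form xs ys" by (rule form_commute[symmetric])
  finally show ?thesis by (simp add: span_inner_def xs'_def ys'_def)
qed

abbreviation kspan where "kspan \<equiv> fun_space (range ev) span_inner"

lemma kernel_in_span: "k i \<in> range ev"
  by (rule image_eqI[of _ _ "[(1, i)]"]) (auto simp: ev_Cons)

lemma span_reproducing: "f \<in> range ev \<Longrightarrow> span_inner f (k j) = f j"
  using span_inner_ev[of _ "[(1, j)]"] by (auto simp: ev_Cons form_eq_ev)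

lemma form_add_left: "form (xs @ ys) zs = form xs zs + form ys zs"
  unfolding form_eq_ev ev_append by (induction zs) (auto simp: algebra_simps)

lemma form_add_right: "form zs (xs @ ys) = form zs xs + form zs ys"
  by (simp add: form_eq_ev)

lemma form_scl_left: "form (scl c xs) ys = c * form xs ys"
  unfolding form_eq_ev ev_scl by (induction ys) (auto simp: algebra_simps)

text \<open>First variation of the form at \<open>xs\<close> in the direction \<open>ev xs j * e\<^sub>j\<close>.\<close>

lemma form_self_zero:
  assumes "form xs xs = 0" shows "ev xs = (\<lambda>_. 0)"
proof
  fix j
  define d where "d = ev xs j"
  have rj: "form xs [(1, j)] = d" by (simp add: form_eq_ev d_def)
  have quad: "0 \<le> t\<^sup>2 * ((cmod d)\<^sup>2 * Re (k j j)) - 2 * t * (cmod d)\<^sup>2" for t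
  proof -
    define s where "s = - complex_of_real t * d"
    let ?ys = "[(s, j)]"
    have "form (xs @ ?ys) (xs @ ?ys) = form xs xs + (cnj s * d) + cnj (cnj s * d) + s * cnj s * k j j"
    proof -
      have "form xs ?ys = cnj s * d" "form ?ys ?ys = s * cnj s * k j j"
        by (simp_all add: form_eq_ev ev_Cons d_def)
      then show ?thesis
        unfolding form_add_left form_add_right by (simp only: form_commute[of ?ys xs] add_ac)
    qed
    also have "cnj s * d = of_real (- t * (cmod d)\<^sup>2)"
      using complex_norm_square[of d] by (simp add: s_def mult_ac)
    also have "s * cnj s = of_real (t\<^sup>2 * (cmod d)\<^sup>2)"
      using complex_norm_square[of d] by (simp add: s_def power2_eq_square mult_ac)
    finally have *: "form (xs @ ?ys) (xs @ ?ys) = of_real (- t * (cmod d)\<^sup>2)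
        + cnj (of_real (- t * (cmod d)\<^sup>2)) + of_real (t\<^sup>2 * (cmod d)\<^sup>2) * k j j"
      unfolding assms by (simp only: add_0_left)
    have re: "Re (of_real a + cnj (of_real a) + of_real b * z) = 2 * a + b * Re z" for a b z
      by simp
    have "Re (form (xs @ ?ys) (xs @ ?ys))
        = 2 * (- t * (cmod d)\<^sup>2) + t\<^sup>2 * (cmod d)\<^sup>2 * Re (k j j)"
      unfolding * by (rule re)
    moreover have "2 * (- t * q) + t\<^sup>2 * q * r = t\<^sup>2 * (q * r) - 2 * t * q" for q r :: real
      by (simp add: algebra_simps)
    moreover have "0 \<le> Re (form (xs @ ?ys) (xs @ ?ys))"
      using form_nonneg by (simp only: complex_nonneg_Reals_iff)
    ultimately show ?thesis by metis
  qed
  have "0 \<le> Re (k j j)" using psd[of "[(1, j)]"] by (simp add: complex_nonneg_Reals_iff)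
  then have "(cmod d)\<^sup>2 = 0" by (intro quadratic_nonneg_imp_zero[OF _ _ quad]) auto
  then show "ev xs j = 0" by (simp add: d_def)
qed

lemma kspan_inner_space: "complex_inner_space kspan"
proof (rule fun_space_inner_space)
  show "(\<lambda>_. 0) \<in> range ev" by (rule image_eqI[of _ _ "[]"]) auto
next
  fix f g assume "f \<in> range ev" "g \<in> range ev"
  then show "(\<lambda>i. f i + g i) \<in> range ev" by (auto simp: ev_append[symmetric])
next
  fix f c assume "f \<in> range ev"
  then show "(\<lambda>i. c * f i) \<in> range ev" by (auto simp: ev_scl[symmetric])
next
  fix f g h assume "f \<in> range ev" "g \<in> range ev" "h \<in> range ev"
  then show "span_inner (\<lambda>i. f i + g i) h = span_inner f h + span_inner g h"
    by (auto simp: ev_append[symmetric] span_inner_ev form_add_left)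
next
  fix f g c assume "f \<in> range ev" "g \<in> range ev"
  then show "span_inner (\<lambda>i. c * f i) g = c * span_inner f g"
    by (auto simp: ev_scl[symmetric] span_inner_ev form_scl_left)
next
  fix f g assume "f \<in> range ev" "g \<in> range ev"
  then show "span_inner f g = cnj (span_inner g f)"
    by (auto simp: span_inner_ev intro: form_commute)
next
  fix f assume "f \<in> range ev"
  then show "span_inner f f \<in> \<real>\<^sub>\<ge>\<^sub>0" by (auto simp: span_inner_ev form_nonneg)
next
  fix f assume "f \<in> range ev" "span_inner f f = 0"
  then show "f = (\<lambda>_. 0)" using form_self_zero by (auto simp: span_inner_ev)
qed

sublocale sp: complex_inner_space kspan by (rule kspan_inner_space)

subsection \<open>Completion by pointwise limits\<close>

text \<open>Elements of the completion are the pointwise limits of Cauchy sequences of the span. The norm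
  extends as the limit of norms, and the inner product is recovered from it by polarisation. That
  the limit does not depend on the sequence rests on \<open>approximates_zero\<close>: a Cauchy sequence that
  tends to zero pointwise also tends to zero in norm.\<close>

abbreviation sdist :: "('i \<Rightarrow> complex) \<Rightarrow> ('i \<Rightarrow> complex) \<Rightarrow> real" where
  "sdist f g \<equiv> hnorm kspan (f \<ominus>\<^bsub>kspan\<^esub> g)"

definition approximates :: "(nat \<Rightarrow> 'i \<Rightarrow> complex) \<Rightarrow> ('i \<Rightarrow> complex) \<Rightarrow> bool" where
  "approximates X f \<longleftrightarrow> range X \<subseteq> range ev \<and>
     (\<forall>e>0. \<exists>N. \<forall>m\<ge>N. \<forall>n\<ge>N. sdist (X m) (X n) < e) \<and>
     (\<forall>i. (\<lambda>n. X n i) \<longlonglongrightarrow> f i)"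

lemma approximates_carrier: "approximates X f \<Longrightarrow> X n \<in> carrier kspan"
  by (auto simp: approximates_def)

lemma approximates_const: "f \<in> range ev \<Longrightarrow> approximates (\<lambda>_. f) f"
  using sp.norm_zero by (auto simp: approximates_def)

lemma approximates_add_scaled:
  assumes "approximates X f" "approximates Y g"
  shows "approximates (\<lambda>n i. X n i + c * Y n i) (\<lambda>i. f i + c * g i)"
  unfolding approximates_def
proof (intro conjI allI impI)
  note car = assms[THEN approximates_carrier]
  show "range (\<lambda>n i. X n i + c * Y n i) \<subseteq> range ev"
    using sp.add_closed[OF car(1) sp.scale_closed[OF car(2), of c]] unfolding fun_space_simps by blast
next
  note car = assms[THEN approximates_carrier]
  fix e :: real assume e: "e > 0"
  have c: "cmod c + 1 > 0" by (simp add: add_nonneg_pos)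
  obtain M where M: "\<And>m n. m \<ge> M \<Longrightarrow> n \<ge> M \<Longrightarrow> sdist (X m) (X n) < e / 2"
    using assms(1) e unfolding approximates_def by (metis half_gt_zero)
  obtain N where N: "\<And>m n. m \<ge> N \<Longrightarrow> n \<ge> N \<Longrightarrow> sdist (Y m) (Y n) < e / 2 / (cmod c + 1)"
    using assms(2) e c unfolding approximates_def by (metis half_gt_zero divide_pos_pos)
  have "sdist (\<lambda>i. X m i + c * Y m i) (\<lambda>i. X n i + c * Y n i) < e"
    if mn: "m \<ge> max M N" "n \<ge> max M N" for m n
  proof -
    have x: "X m \<ominus>\<^bsub>kspan\<^esub> X n \<in> carrier kspan" and y: "Y m \<ominus>\<^bsub>kspan\<^esub> Y n \<in> carrier kspan"
      by (intro sp.minus_closed car)+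
    have eq: "(\<lambda>i. X m i + c * Y m i) \<ominus>\<^bsub>kspan\<^esub> (\<lambda>i. X n i + c * Y n i)
      = (X m \<ominus>\<^bsub>kspan\<^esub> X n) \<oplus>\<^bsub>kspan\<^esub> c \<odot>\<^bsub>kspan\<^esub> (Y m \<ominus>\<^bsub>kspan\<^esub> Y n)"
      by (auto simp: algebra_simps)
    have "sdist (\<lambda>i. X m i + c * Y m i) (\<lambda>i. X n i + c * Y n i) \<le> sdist (X m) (X n) + cmod c * sdist (Y m) (Y n)"
      unfolding eq sp.norm_scale[OF y, symmetric] by (rule sp.norm_triangle[OF x sp.scale_closed[OF y]])
    moreover have "cmod c * sdist (Y m) (Y n) \<le> (cmod c + 1) * sdist (Y m) (Y n)"
      using sp.norm_ge_0[OF y] by (intro mult_right_mono) auto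
    moreover have "(cmod c + 1) * sdist (Y m) (Y n) < (cmod c + 1) * (e / 2 / (cmod c + 1))"
      using N[of m n] mn c by (intro mult_strict_left_mono) auto
    moreover have "(cmod c + 1) * (e / 2 / (cmod c + 1)) = e / 2"
      using c nonzero_mult_div_cancel_left[of "cmod c + 1" "e / 2"] by (simp only: times_divide_eq_right)
    moreover have "sdist (X m) (X n) < e / 2" using M[of m n] mn by simp
    ultimately show ?thesis by linarith
  qed
  then show "\<exists>N. \<forall>m\<ge>N. \<forall>n\<ge>N. sdist (\<lambda>i. X m i + c * Y m i) (\<lambda>i. X n i + c * Y n i) < e" by blast
qed (use assms in \<open>auto simp: approximates_def intro!: tendsto_intros\<close>)

lemma approximates_add:
  "\<lbrakk>approximates X f; approximates Y g\<rbrakk> \<Longrightarrow> approximates (\<lambda>n i. X n i + Y n i) (\<lambda>i. f i + g i)"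
  using approximates_add_scaled[of X f Y g 1] by simp

lemma approximates_scale:
  "approximates X f \<Longrightarrow> approximates (\<lambda>n i. c * X n i) (\<lambda>i. c * f i)"
  using approximates_add_scaled[OF approximates_const[OF sp.zero_closed[unfolded fun_space_simps]], of X f c] by simp

lemma approximates_bounded:
  assumes "approximates X f"
  obtains B N where "B > 0" "\<And>n. n \<ge> N \<Longrightarrow> hnorm kspan (X n) \<le> B"
proof -
  obtain N where N: "\<And>m n. m \<ge> N \<Longrightarrow> n \<ge> N \<Longrightarrow> sdist (X m) (X n) < 1"
    using assms unfolding approximates_def by (metis zero_less_one)
  have "hnorm kspan (X n) \<le> 1 + hnorm kspan (X N)" if "n \<ge> N" for n
    using N[OF that order_refl] sp.norm_diff_le[of "X n" "X N", OF approximates_carrier[OF assms] approximates_carrier[OF assms]]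
    by linarith
  moreover have "1 + hnorm kspan (X N) > 0"
    using sp.norm_ge_0[OF approximates_carrier[OF assms]] by (simp add: add_pos_nonneg)
  ultimately show thesis using that by blast
qed

lemma approximates_span_limit:
  assumes "approximates Z f" "g \<in> range ev"
  obtains L where "(\<lambda>n. span_inner (Z n) g) \<longlonglongrightarrow> L" "f = (\<lambda>_. 0) \<Longrightarrow> L = 0"
proof -
  obtain ys where g: "g = ev ys" using assms by blast
  have eq: "span_inner (Z n) g = (\<Sum>(b, j)\<leftarrow>ys. cnj b * Z n j)" for n
    using approximates_carrier[OF assms(1), of n] by (auto simp: g span_inner_ev form_eq_ev)
  have "(\<lambda>n. \<Sum>(b, j)\<leftarrow>ys. cnj b * Z n j) \<longlonglongrightarrow> (\<Sum>(b, j)\<leftarrow>ys. cnj b * f j)"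
    using assms(1) unfolding approximates_def
    by (induction ys) (auto intro!: tendsto_intros)
  moreover have "f = (\<lambda>_. 0) \<Longrightarrow> (\<Sum>(b, j)\<leftarrow>ys. cnj b * f j) = 0"
    by (induction ys) auto
  ultimately show thesis using that by (simp add: eq)
qed

text \<open>In \<open>\<parallel>Z\<^sub>n\<parallel>\<^sup>2 = \<langle>Z\<^sub>n, Z\<^sub>n - Z\<^sub>N\<rangle> + \<langle>Z\<^sub>n, Z\<^sub>N\<rangle>\<close> the first term is small by the Cauchy property, uniformly in
  \<open>n\<close>, and the second tends to zero for fixed \<open>N\<close> because it is a finite combination of point values.\<close>

lemma approximates_zero:
  assumes Z: "approximates Z (\<lambda>_. 0)"
  shows "(\<lambda>n. hnorm kspan (Z n)) \<longlonglongrightarrow> 0"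
proof -
  obtain B M where B: "B > 0" "\<And>n. n \<ge> M \<Longrightarrow> hnorm kspan (Z n) \<le> B"
    using approximates_bounded[OF Z] by blast
  note car = approximates_carrier[OF Z]
  have "(\<lambda>n. (hnorm kspan (Z n))\<^sup>2) \<longlonglongrightarrow> 0"
  proof (rule LIMSEQ_I)
    fix e :: real assume e: "e > 0"
    then obtain N where N: "\<And>m n. m \<ge> N \<Longrightarrow> n \<ge> N \<Longrightarrow> sdist (Z m) (Z n) < e / (2 * B)"
      using Z B unfolding approximates_def by (metis divide_pos_pos mult_pos_pos zero_less_numeral)
    obtain L where L: "(\<lambda>n. span_inner (Z n) (Z N)) \<longlonglongrightarrow> L" "L = 0"
      using approximates_span_limit[OF Z, of "Z N"] car by auto
    then obtain N' where N': "\<And>n. n \<ge> N' \<Longrightarrow> cmod (span_inner (Z n) (Z N)) < e / 2"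
      using LIMSEQ_D[OF L(1), of "e / 2"] e by auto
    have "norm ((hnorm kspan (Z n))\<^sup>2 - 0) < e" if "n \<ge> max M (max N N')" for n
    proof -
      have "(hnorm kspan (Z n))\<^sup>2 = Re (span_inner (Z n) (Z n \<ominus>\<^bsub>kspan\<^esub> Z N)) + Re (span_inner (Z n) (Z N))"
        using sp.inner_minus_right[OF car car car, of n n N] sp.norm_sq[OF car, of n] by simp
      also have "Re (span_inner (Z n) (Z n \<ominus>\<^bsub>kspan\<^esub> Z N)) \<le> B * (e / (2 * B))"
      proof -
        have "Re (span_inner (Z n) (Z n \<ominus>\<^bsub>kspan\<^esub> Z N)) \<le> hnorm kspan (Z n) * sdist (Z n) (Z N)"
          using order_trans[OF complex_Re_le_cmod sp.Cauchy_Schwarz[OF car sp.minus_closed[OF car car], of n n N]]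
          unfolding fun_space_simps(5) .
        also have "\<dots> \<le> B * (e / (2 * B))"
          using B that N[of n N] sp.norm_ge_0[OF car] sp.norm_ge_0[OF sp.minus_closed[OF car car]]
          by (intro mult_mono) (auto simp del: fun_space_simps intro: less_imp_le)
        finally show ?thesis .
      qed
      also have "Re (span_inner (Z n) (Z N)) < e / 2"
        using N'[of n] that complex_Re_le_cmod[of "span_inner (Z n) (Z N)"] by simp
      finally show ?thesis using B e by simp
    qed
    then show "\<exists>no. \<forall>n\<ge>no. norm ((hnorm kspan (Z n))\<^sup>2 - 0) < e" by blast
  qed
  then have "(\<lambda>n. sqrt ((hnorm kspan (Z n))\<^sup>2)) \<longlonglongrightarrow> sqrt 0" by (rule tendsto_real_sqrt)
  then show ?thesis using sp.norm_ge_0[OF car] by simp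
qed

lemma approximates_unique_norm:
  assumes "approximates X f" "approximates X' f"
  shows "(\<lambda>n. sdist (X n) (X' n)) \<longlonglongrightarrow> 0"
  using approximates_zero[of "\<lambda>n i. X n i + (-1) * X' n i"]
    approximates_add[OF assms(1) approximates_scale[OF assms(2), of "-1"]] by simp

lemma approximates_norm_convergent:
  assumes X: "approximates X f" shows "convergent (\<lambda>n. hnorm kspan (X n))"
proof -
  note car = approximates_carrier[OF X]
  have "Cauchy (\<lambda>n. hnorm kspan (X n))"
  proof (rule CauchyI)
    fix e :: real assume "e > 0"
    then obtain N where N: "\<And>m n. m \<ge> N \<Longrightarrow> n \<ge> N \<Longrightarrow> sdist (X m) (X n) < e"
      using X unfolding approximates_def by metis
    have "norm (hnorm kspan (X m) - hnorm kspan (X n)) < e" if "m \<ge> N" "n \<ge> N" for m n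
      using sp.norm_diff_le[of "X m" "X n", OF car car] N[OF that] unfolding real_norm_def by linarith
    then show "\<exists>M. \<forall>m\<ge>M. \<forall>n\<ge>M. norm (hnorm kspan (X m) - hnorm kspan (X n)) < e" by blast
  qed
  then show ?thesis by (simp add: Cauchy_convergent_iff)
qed

definition rk_norm :: "('i \<Rightarrow> complex) \<Rightarrow> real" where
  "rk_norm f = lim (\<lambda>n. hnorm kspan ((SOME X. approximates X f) n))"

lemma rk_norm_tendsto:
  assumes X: "approximates X f" shows "(\<lambda>n. hnorm kspan (X n)) \<longlonglongrightarrow> rk_norm f"
proof -
  define X' where "X' = (SOME X. approximates X f)"
  have X': "approximates X' f" unfolding X'_def by (rule someI[where P = "\<lambda>X. approximates X f", OF X])
  have "(\<lambda>n. hnorm kspan (X n) - hnorm kspan (X' n)) \<longlonglongrightarrow> 0"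
  proof (rule Lim_null_comparison[OF _ approximates_unique_norm[OF X X']], rule always_eventually, rule allI)
    show "norm (hnorm kspan (X n) - hnorm kspan (X' n)) \<le> sdist (X n) (X' n)" for n
      using sp.norm_diff_le[OF approximates_carrier[OF X] approximates_carrier[OF X']] by (simp only: real_norm_def)
  qed
  moreover have "(\<lambda>n. hnorm kspan (X' n)) \<longlonglongrightarrow> rk_norm f"
    using approximates_norm_convergent[OF X'] by (simp add: rk_norm_def X'_def convergent_LIMSEQ_iff)
  ultimately show ?thesis using tendsto_add by fastforce
qed

definition rk_inner :: "('i \<Rightarrow> complex) \<Rightarrow> ('i \<Rightarrow> complex) \<Rightarrow> complex" where
  "rk_inner f g = (of_real ((rk_norm (\<lambda>i. f i + 1 * g i))\<^sup>2) - of_real ((rk_norm (\<lambda>i. f i + (- 1) * g i))\<^sup>2)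
    + \<i> * of_real ((rk_norm (\<lambda>i. f i + \<i> * g i))\<^sup>2) - \<i> * of_real ((rk_norm (\<lambda>i. f i + (- \<i>) * g i))\<^sup>2)) / 4"

lemma rk_inner_tendsto:
  assumes X: "approximates X f" and Y: "approximates Y g"
  shows "(\<lambda>n. span_inner (X n) (Y n)) \<longlonglongrightarrow> rk_inner f g"
proof -
  have "span_inner (X n) (Y n) = (of_real ((hnorm kspan (\<lambda>i. X n i + 1 * Y n i))\<^sup>2)
      - of_real ((hnorm kspan (\<lambda>i. X n i + (- 1) * Y n i))\<^sup>2)
      + \<i> * of_real ((hnorm kspan (\<lambda>i. X n i + \<i> * Y n i))\<^sup>2)
      - \<i> * of_real ((hnorm kspan (\<lambda>i. X n i + (- \<i>) * Y n i))\<^sup>2)) / 4" for n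
    using sp.polarization[OF approximates_carrier[OF X, of n] approximates_carrier[OF Y, of n]]
    unfolding fun_space_simps .
  then show ?thesis
    unfolding rk_inner_def
    by (simp only:) (intro tendsto_intros rk_norm_tendsto approximates_add_scaled X Y; simp)
qed

definition rk_space :: "('i \<Rightarrow> complex) hspace" where
  "rk_space = fun_space {f. \<exists>X. approximates X f} rk_inner"

lemma rk_space_inner_space: "complex_inner_space rk_space"
  unfolding rk_space_def
proof (rule fun_space_inner_space, goal_cases)
  case 1
  then show ?case using approximates_const[of "\<lambda>_. 0"] sp.zero_closed by auto
next
  case (2 f g) then show ?case using approximates_add by blast
next
  case (3 c f) then show ?case using approximates_scale by blast
next
  case (4 f g h)
  then obtain X Y Z where a: "approximates X f" "approximates Y g" "approximates Z h" by auto
  have "(\<lambda>n. span_inner (\<lambda>i. X n i + Y n i) (Z n)) \<longlonglongrightarrow> rk_inner (\<lambda>i. f i + g i) h"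
    by (intro rk_inner_tendsto approximates_add a)
  moreover have "span_inner (\<lambda>i. X n i + Y n i) (Z n) = span_inner (X n) (Z n) + span_inner (Y n) (Z n)" for n
    using sp.inner_add_left a[THEN approximates_carrier] by simp
  ultimately show ?case
    using LIMSEQ_unique tendsto_add[OF rk_inner_tendsto[OF a(1,3)] rk_inner_tendsto[OF a(2,3)]] by simp
next
  case (5 c f g)
  then obtain X Y where a: "approximates X f" "approximates Y g" by auto
  have "(\<lambda>n. span_inner (\<lambda>i. c * X n i) (Y n)) \<longlonglongrightarrow> rk_inner (\<lambda>i. c * f i) g"
    by (intro rk_inner_tendsto approximates_scale a)
  moreover have "span_inner (\<lambda>i. c * X n i) (Y n) = c * span_inner (X n) (Y n)" for n
    using sp.inner_scale_left a[THEN approximates_carrier] by simp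
  ultimately show ?case
    using LIMSEQ_unique tendsto_mult_left[OF rk_inner_tendsto[OF a], of c] by simp
next
  case (6 f g)
  then obtain X Y where a: "approximates X f" "approximates Y g" by auto
  have "span_inner (X n) (Y n) = cnj (span_inner (Y n) (X n))" for n
    using sp.inner_commute[OF a[THEN approximates_carrier]] by (simp only: fun_space_simps)
  then have "(\<lambda>n. span_inner (X n) (Y n)) = (\<lambda>n. cnj (span_inner (Y n) (X n)))" by (rule ext)
  moreover have "(\<lambda>n. cnj (span_inner (Y n) (X n))) \<longlonglongrightarrow> cnj (rk_inner g f)"
    by (intro tendsto_cnj rk_inner_tendsto a)
  ultimately show ?case using LIMSEQ_unique[OF rk_inner_tendsto[OF a]] by metis
next
  case (7 f)
  then obtain X where a: "approximates X f" by auto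
  have n: "span_inner (X n) (X n) \<in> \<real>\<^sub>\<ge>\<^sub>0" for n
    using sp.inner_nonneg a[THEN approximates_carrier] by simp
  show ?case
    by (rule closed_sequentially[OF closed_nonneg_Reals_complex n rk_inner_tendsto[OF a a]])
next
  case (8 f)
  then obtain X where a: "approximates X f" by auto
  note car = a[THEN approximates_carrier]
  show ?case
  proof
    fix i
    have ki: "k i \<in> carrier kspan" using kernel_in_span by simp
    have "(\<lambda>n. sqrt (cmod (span_inner (X n) (X n))) * hnorm kspan (k i)) \<longlonglongrightarrow> sqrt (cmod 0) * hnorm kspan (k i)"
      using rk_inner_tendsto[OF a a] 8 by (intro tendsto_intros) simp
    then have lim: "(\<lambda>n. hnorm kspan (X n) * hnorm kspan (k i)) \<longlonglongrightarrow> 0"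
      using sp.inner_self[OF car] sp.norm_ge_0[OF car] by (simp add: norm_power)
    have "(\<lambda>n. X n i) \<longlonglongrightarrow> 0"
    proof (rule Lim_null_comparison[OF _ lim], rule always_eventually, rule allI)
      fix n show "norm (X n i) \<le> hnorm kspan (X n) * hnorm kspan (k i)"
        using sp.Cauchy_Schwarz[OF car ki, of n] span_reproducing[of "X n" i] car[of n] by simp
    qed
    then show "f i = 0" using a LIMSEQ_unique unfolding approximates_def by blast
  qed
qed

sublocale rk: complex_inner_space rk_space by (rule rk_space_inner_space)

lemma span_in_rk: "f \<in> range ev \<Longrightarrow> f \<in> carrier rk_space"
  using approximates_const by (auto simp: rk_space_def)

lemma kernel_in_rk [simp]: "k i \<in> carrier rk_space"
  by (intro span_in_rk kernel_in_span)

lemma rk_span_inner: "\<lbrakk>f \<in> range ev; g \<in> range ev\<rbrakk> \<Longrightarrow> rk_inner f g = span_inner f g"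
  using rk_inner_tendsto[OF approximates_const approximates_const, of f g]
  by (metis LIMSEQ_const_iff)

lemma rk_reproducing:
  assumes "f \<in> carrier rk_space" shows "hinner rk_space f (k i) = f i"
proof -
  obtain X where a: "approximates X f" using assms by (auto simp: rk_space_def)
  have "(\<lambda>n. span_inner (X n) (k i)) \<longlonglongrightarrow> rk_inner f (k i)"
    using rk_inner_tendsto[OF a approximates_const[OF kernel_in_span]] .
  moreover have "span_inner (X n) (k i) = X n i" for n
    using span_reproducing approximates_carrier[OF a, of n] by simp
  ultimately have "(\<lambda>n. X n i) \<longlonglongrightarrow> rk_inner f (k i)" by simp
  moreover have "(\<lambda>n. X n i) \<longlonglongrightarrow> f i" using a by (simp add: approximates_def)
  ultimately show ?thesis using LIMSEQ_unique by (simp add: rk_space_def)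
qed

lemma rk_dense:
  assumes "f \<in> carrier rk_space" "e > 0"
  obtains g where "g \<in> range ev" "hnorm rk_space (f \<ominus>\<^bsub>rk_space\<^esub> g) < e"
proof -
  obtain X where a: "approximates X f" using assms by (auto simp: rk_space_def)
  note car = a[THEN approximates_carrier]
  obtain N where N: "\<And>m n. m \<ge> N \<Longrightarrow> n \<ge> N \<Longrightarrow> sdist (X m) (X n) < e / 2"
    using a assms(2) unfolding approximates_def by (metis half_gt_zero)
  let ?D = "\<lambda>n i. X n i + (-1) * X N i"
  have D: "approximates ?D (\<lambda>i. f i + (-1) * X N i)"
    by (intro approximates_add a approximates_scale approximates_const) (use car in simp)
  have "(\<lambda>n. sqrt (Re (span_inner (?D n) (?D n)))) \<longlonglongrightarrow> hnorm rk_space (f \<ominus>\<^bsub>rk_space\<^esub> X N)"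
    using tendsto_real_sqrt[OF tendsto_Re[OF rk_inner_tendsto[OF D D]]]
    by (simp add: hnorm_def rk_space_def)
  moreover have "sqrt (Re (span_inner (?D n) (?D n))) = sdist (X n) (X N)" for n
    by (simp add: hnorm_def)
  ultimately have "hnorm rk_space (f \<ominus>\<^bsub>rk_space\<^esub> X N) \<le> e / 2"
    using N[of _ N] by (intro LIMSEQ_le_const2) (auto intro!: exI[of _ N] less_imp_le simp del: fun_space_simps(6))
  then show thesis using that[of "X N"] car[of N] assms(2) by simp
qed

text \<open>A Cauchy sequence \<open>F\<close> of the completion is replaced by a sequence \<open>X\<close> of the span with
  \<open>\<parallel>F\<^sub>n - X\<^sub>n\<parallel> \<rightarrow> 0\<close>. Point evaluations are bounded, so \<open>X\<close> converges pointwise, and its pointwise limit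
  is the limit of \<open>F\<close>.\<close>

theorem rk_hilbert_space: "complex_hilbert_space rk_space"
proof -
  have "\<exists>f. hconverges rk_space F f"
    if F: "\<And>n. F n \<in> carrier rk_space"
      and C: "\<And>e. e > 0 \<Longrightarrow> \<exists>N. \<forall>m\<ge>N. \<forall>n\<ge>N. hnorm rk_space (F m \<ominus>\<^bsub>rk_space\<^esub> F n) < e"
    for F :: "nat \<Rightarrow> 'i \<Rightarrow> complex"
  proof -
    have "\<forall>n. \<exists>g. g \<in> range ev \<and> hnorm rk_space (F n \<ominus>\<^bsub>rk_space\<^esub> g) < inverse (real (Suc n))"
      using rk_dense[OF F] by (metis inverse_positive_iff_positive of_nat_0_less_iff zero_less_Suc)
    then obtain X where X: "\<And>n. X n \<in> range ev"
      and close: "\<And>n. hnorm rk_space (F n \<ominus>\<^bsub>rk_space\<^esub> X n) < inverse (real (Suc n))" by metis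
    have Xrk: "X n \<in> carrier rk_space" for n using X span_in_rk by blast
    have small: "\<exists>N. \<forall>n\<ge>N. hnorm rk_space (F n \<ominus>\<^bsub>rk_space\<^esub> X n) < e" if "e > 0" for e
    proof -
      obtain N where N: "inverse (real (Suc N)) < e" using reals_Archimedean[OF \<open>e > 0\<close>] by auto
      have "hnorm rk_space (F n \<ominus>\<^bsub>rk_space\<^esub> X n) < e" if "n \<ge> N" for n
      proof -
        have "inverse (real (Suc n)) \<le> inverse (real (Suc N))" using that by auto
        then show ?thesis using close[of n] N by linarith
      qed
      then show ?thesis by blast
    qed
    have eqn: "sdist f g = hnorm rk_space (f \<ominus>\<^bsub>rk_space\<^esub> g)"
      if "f \<in> range ev" "g \<in> range ev" for f g
      using rk_span_inner sp.minus_closed[of f g] that by (simp add: hnorm_def rk_space_def)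
    have XC: "\<exists>N. \<forall>m\<ge>N. \<forall>n\<ge>N. sdist (X m) (X n) < e" if e: "e > 0" for e
    proof -
      obtain N1 where N1: "\<And>m n. m \<ge> N1 \<Longrightarrow> n \<ge> N1 \<Longrightarrow> hnorm rk_space (F m \<ominus>\<^bsub>rk_space\<^esub> F n) < e / 3"
        using C[of "e / 3"] e by auto
      obtain N2 where N2: "\<And>n. n \<ge> N2 \<Longrightarrow> hnorm rk_space (F n \<ominus>\<^bsub>rk_space\<^esub> X n) < e / 3"
        using small[of "e / 3"] e by auto
      have "sdist (X m) (X n) < e" if "m \<ge> max N1 N2" "n \<ge> max N1 N2" for m n
      proof -
        have "hnorm rk_space (X m \<ominus>\<^bsub>rk_space\<^esub> X n)
            \<le> hnorm rk_space (X m \<ominus>\<^bsub>rk_space\<^esub> F m) + (hnorm rk_space (F m \<ominus>\<^bsub>rk_space\<^esub> F n)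
              + hnorm rk_space (F n \<ominus>\<^bsub>rk_space\<^esub> X n))"
          using rk.dist_triangle[of "X m" "F m" "X n", OF Xrk F Xrk]
            rk.dist_triangle[of "F m" "F n" "X n", OF F F Xrk] by linarith
        then show ?thesis
          using N1[of m n] N2[of m] N2[of n] that rk.norm_minus_commute[OF Xrk F, of m m] X
          by (simp add: eqn del: fun_space_simps(6))
      qed
      then show ?thesis by blast
    qed
    have "\<exists>L. (\<lambda>n. X n i) \<longlonglongrightarrow> L" for i
    proof -
      have "Cauchy (\<lambda>n. X n i)"
      proof (rule CauchyI)
        fix e :: real assume e: "e > 0"
        have ki: "k i \<in> carrier kspan" using kernel_in_span by simp
        define B where "B = hnorm kspan (k i) + 1"
        have B: "B > 0" using sp.norm_ge_0[OF ki] by (simp add: B_def)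
        obtain N where N: "\<And>m n. m \<ge> N \<Longrightarrow> n \<ge> N \<Longrightarrow> sdist (X m) (X n) < e / B"
          using XC[of "e / B"] e B by auto
        have "norm (X m i - X n i) < e" if "m \<ge> N" "n \<ge> N" for m n
        proof -
          have d: "X m \<ominus>\<^bsub>kspan\<^esub> X n \<in> carrier kspan" using X by (intro sp.minus_closed) auto
          have "X m i - X n i = hinner kspan (X m \<ominus>\<^bsub>kspan\<^esub> X n) (k i)"
            using span_reproducing[of "X m \<ominus>\<^bsub>kspan\<^esub> X n" i] d by simp
          then have "norm (X m i - X n i) \<le> sdist (X m) (X n) * hnorm kspan (k i)"
            using sp.Cauchy_Schwarz[OF d ki] by simp
          also have "\<dots> \<le> sdist (X m) (X n) * B"
            using sp.norm_ge_0[OF d] by (intro mult_left_mono) (simp_all add: B_def)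
          also have "\<dots> < e / B * B" using N[OF that] B by (intro mult_strict_right_mono) auto
          finally show ?thesis using B by simp
        qed
        then show "\<exists>M. \<forall>m\<ge>M. \<forall>n\<ge>M. norm (X m i - X n i) < e" by blast
      qed
      then show ?thesis by (simp add: Cauchy_convergent_iff convergent_def)
    qed
    then obtain f where f: "\<And>i. (\<lambda>n. X n i) \<longlonglongrightarrow> f i" by metis
    have a: "approximates X f" unfolding approximates_def using X XC f by blast
    then have fc: "f \<in> carrier rk_space" by (auto simp: rk_space_def)
    have "(\<lambda>n. hnorm rk_space (F n \<ominus>\<^bsub>rk_space\<^esub> f)) \<longlonglongrightarrow> 0"
    proof (rule LIMSEQ_I)
      fix e :: real assume e: "e > 0"
      obtain N1 where N1: "\<And>m n. m \<ge> N1 \<Longrightarrow> n \<ge> N1 \<Longrightarrow> sdist (X m) (X n) < e / 3"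
        using XC[of "e / 3"] e by auto
      obtain N2 where N2: "\<And>n. n \<ge> N2 \<Longrightarrow> hnorm rk_space (F n \<ominus>\<^bsub>rk_space\<^esub> X n) < e / 3"
        using small[of "e / 3"] e by auto
      have "norm (hnorm rk_space (F n \<ominus>\<^bsub>rk_space\<^esub> f) - 0) < e" if n: "n \<ge> max N1 N2" for n
      proof -
        let ?D = "\<lambda>m i. X n i + (-1) * X m i"
        have D: "approximates ?D (\<lambda>i. X n i + (-1) * f i)"
          by (intro approximates_add a approximates_scale approximates_const X)
        have "(\<lambda>m. sqrt (Re (span_inner (?D m) (?D m)))) \<longlonglongrightarrow> hnorm rk_space (X n \<ominus>\<^bsub>rk_space\<^esub> f)"
          using tendsto_real_sqrt[OF tendsto_Re[OF rk_inner_tendsto[OF D D]]]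
          by (simp add: hnorm_def rk_space_def)
        moreover have "sqrt (Re (span_inner (?D m) (?D m))) = sdist (X n) (X m)" for m
          by (simp add: hnorm_def)
        ultimately have "hnorm rk_space (X n \<ominus>\<^bsub>rk_space\<^esub> f) \<le> e / 3"
          using N1[of n] n
          by (intro LIMSEQ_le_const2) (auto intro!: exI[of _ N1] less_imp_le simp del: fun_space_simps(6))
        then show ?thesis
          using rk.dist_triangle[OF F Xrk fc, of n n] N2[of n] n e
            rk.norm_ge_0[OF rk.minus_closed[OF F fc], of n] by simp
      qed
      then show "\<exists>no. \<forall>n\<ge>no. norm (hnorm rk_space (F n \<ominus>\<^bsub>rk_space\<^esub> f) - 0) < e" by blast
    qed
    then show ?thesis using fc by (auto simp: hconverges_def)
  qed
  then show ?thesis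
    by (intro complex_hilbert_space.intro rk.zero_closed rk.add_closed rk.scale_closed rk.add_assoc
      rk.add_commute rk.add_zero rk.add_inverse rk.scale_add_right rk.scale_add_left rk.scale_scale
      rk.scale_one rk.inner_add_left rk.inner_scale_left rk.inner_commute rk.inner_nonneg
      rk.inner_eq_zero) auto
qed

subsection \<open>Symmetries of the kernel are unitary\<close>

text \<open>Composition with \<open>t = s\<^sup>-\<^sup>1\<close> maps \<open>e\<^sub>i\<close> to \<open>e\<^bsub>s i\<^esub>\<close>, so it preserves the form on the span, and then the
  limits that define the completion.\<close>

lemma rk_symmetry_unitary:
  fixes s t :: "'i \<Rightarrow> 'i"
  assumes st: "\<And>i. s (t i) = i" "\<And>i. t (s i) = i" and inv: "\<And>i j. k (s i) (s j) = k i j"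
  defines "U \<equiv> (\<lambda>f i. f (t i))"
  shows "hunitary rk_space U" "\<And>i. U (k i) = k (s i)"
proof -
  have inv': "k (s i) j = k i (t j)" for i j using inv[of i "t j"] st by simp
  show Uk: "U (k i) = k (s i)" for i by (auto simp: U_def inv')
  have gen: "approximates (\<lambda>n. U (X n)) (U f) \<and> (\<lambda>n. span_inner (U (X n)) (U (Y n))) = (\<lambda>n. span_inner (X n) (Y n))"
    if X: "approximates X f" and Y: "approximates Y g" and "U = (\<lambda>f i. f (t i))" 
      and inv': "\<And>i j. k (s i) j = k i (t j)" and inv'': "\<And>i j. k (s i) (s j) = k i j"
    for X Y f g s t and U :: "('i \<Rightarrow> complex) \<Rightarrow> 'i \<Rightarrow> complex"
  proof -
    have "ev xs (t j) = ev (map (\<lambda>(a, i). (a, s i)) xs) j" for xs j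
      by (induction xs) (auto simp: ev_def inv')
    then have U_ev: "U (ev xs) = ev (map (\<lambda>(a, i). (a, s i)) xs)" for xs
      by (auto simp: that(3))
    have U_in: "U f \<in> range ev" if "f \<in> range ev" for f using that by (auto simp: U_ev)
    have U_inner: "span_inner (U f) (U g) = span_inner f g" if fg: "f \<in> range ev" "g \<in> range ev" for f g
    proof -
      obtain xs ys where "f = ev xs" "g = ev ys" using fg by blast
      then show ?thesis
        by (simp add: U_ev span_inner_ev form_def case_prod_unfold o_def inv'')
    qed
    note cX = approximates_carrier[OF X] and cY = approximates_carrier[OF Y]
    have "U (X m) \<ominus>\<^bsub>kspan\<^esub> U (X n) = U (X m \<ominus>\<^bsub>kspan\<^esub> X n)" for m n by (simp add: that(3))
    then have "hnorm kspan (U (X m) \<ominus>\<^bsub>kspan\<^esub> U (X n)) = sdist (X m) (X n)" for m n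
      using U_inner[of "X m \<ominus>\<^bsub>kspan\<^esub> X n" "X m \<ominus>\<^bsub>kspan\<^esub> X n"] sp.minus_closed[OF cX cX, of m n]
      by (simp add: hnorm_def)
    then have "approximates (\<lambda>n. U (X n)) (U f)"
      using X U_in unfolding approximates_def by (auto simp: that(3) image_subset_iff)
    then show ?thesis using U_inner cX cY by auto
  qed
  have car: "U f \<in> carrier rk_space" if f: "f \<in> carrier rk_space" for f
  proof -
    obtain X where X: "approximates X f" using f by (auto simp: rk_space_def)
    show ?thesis
      using gen[OF X X U_def[THEN meta_eq_to_obj_eq] inv' inv] unfolding rk_space_def by auto
  qed
  have invk: "k (t i) (t j) = k i j" "k (t i) j = k i (s j)" for i j
    using inv[of "t i" "t j"] inv[of "t i" j] st by auto
  have car': "(\<lambda>i. f (s i)) \<in> carrier rk_space" if f: "f \<in> carrier rk_space" for f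
  proof -
    obtain X where X: "approximates X f" using f by (auto simp: rk_space_def)
    show ?thesis using gen[OF X X refl invk(2,1)] unfolding rk_space_def by auto
  qed
  show "hunitary rk_space U"
    unfolding hunitary_def hlinear_def
  proof (intro conjI ballI allI)
    show "U \<in> carrier rk_space \<rightarrow> carrier rk_space" using car by auto
    show "bij_betw U (carrier rk_space) (carrier rk_space)"
      by (rule bij_betwI[of _ _ _ "\<lambda>f i. f (s i)"]) (use car car' st in \<open>auto simp: U_def\<close>)
  next
    fix f g assume "f \<in> carrier rk_space" "g \<in> carrier rk_space"
    then obtain X Y where X: "approximates X f" and Y: "approximates Y g" by (auto simp: rk_space_def)
    note g = gen[OF _ _ U_def[THEN meta_eq_to_obj_eq] inv' inv]
    have "(\<lambda>n. span_inner (X n) (Y n)) \<longlonglongrightarrow> rk_inner (U f) (U g)"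
      using rk_inner_tendsto[of "\<lambda>n. U (X n)" "U f" "\<lambda>n. U (Y n)" "U g"] g[OF X Y] g[OF Y X] by simp
    then show "hinner rk_space (U f) (U g) = hinner rk_space f g"
      using LIMSEQ_unique rk_inner_tendsto[OF X Y] by (auto simp: rk_space_def)
  qed (auto simp: U_def rk_space_def)
qed

end

section \<open>Unitary dilation of a positive definite function on the integer lattice\<close>

text \<open>Transport of structure along a map that is injective on the carrier. It places a Hilbert space into
  a prescribed universe.\<close>

definition image_space :: "('a \<Rightarrow> 'b) \<Rightarrow> 'a hspace \<Rightarrow> 'b hspace" where
  "image_space \<Phi> H = (let \<Psi> = inv_into (carrier H) \<Phi> in
    \<lparr>carrier = \<Phi> ` carrier H, hzero = \<Phi> \<zero>\<^bsub>H\<^esub>, hadd = (\<lambda>x y. \<Phi> (\<Psi> x \<oplus>\<^bsub>H\<^esub> \<Psi> y)),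
     hscale = (\<lambda>c x. \<Phi> (c \<odot>\<^bsub>H\<^esub> \<Psi> x)), hinner = (\<lambda>x y. hinner H (\<Psi> x) (\<Psi> y))\<rparr>)"

lemma image_space_carrier: "carrier (image_space \<Phi> H) = \<Phi> ` carrier H"
  and image_space_zero: "hzero (image_space \<Phi> H) = \<Phi> \<zero>\<^bsub>H\<^esub>"
  by (simp_all add: image_space_def Let_def)

lemma image_space_ops:
  assumes "inj_on \<Phi> (carrier H)" "x \<in> carrier H" "y \<in> carrier H"
  shows "hadd (image_space \<Phi> H) (\<Phi> x) (\<Phi> y) = \<Phi> (x \<oplus>\<^bsub>H\<^esub> y)"
    "hscale (image_space \<Phi> H) c (\<Phi> x) = \<Phi> (c \<odot>\<^bsub>H\<^esub> x)"
    "hinner (image_space \<Phi> H) (\<Phi> x) (\<Phi> y) = hinner H x y"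
  using assms by (simp_all add: image_space_def Let_def)

lemma image_space_hilbert:
  assumes "complex_hilbert_space H" and inj: "inj_on \<Phi> (carrier H)"
  shows "complex_hilbert_space (image_space \<Phi> H)"
proof -
  interpret complex_hilbert_space H by fact
  let ?K = "image_space \<Phi> H"
  note simps = image_space_carrier image_space_zero image_space_ops[OF inj]
  have minus: "hminus ?K (\<Phi> x) (\<Phi> y) = \<Phi> (x \<ominus>\<^bsub>H\<^esub> y)" if "x \<in> carrier H" "y \<in> carrier H" for x y
    using that by (simp add: hminus_def simps)
  have norm: "hnorm ?K (\<Phi> x) = hnorm H x" if "x \<in> carrier H" for x
    using that by (simp add: hnorm_def simps)
  show ?thesis
  proof (unfold_locales, unfold simps)
    show "\<Phi> \<zero>\<^bsub>H\<^esub> \<in> \<Phi> ` carrier H" using zero_closed by blast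
  next
    fix x y assume "x \<in> \<Phi> ` carrier H" "y \<in> \<Phi> ` carrier H"
    then obtain x' y' where xy: "x' \<in> carrier H" "y' \<in> carrier H" "x = \<Phi> x'" "y = \<Phi> y'" by blast
    show "hadd ?K x y = hadd ?K y x" "hinner ?K x y = cnj (hinner ?K y x)"
      unfolding xy(3,4) using add_commute[OF xy(1,2)] inner_commute[OF xy(1,2)] xy(1,2)
      by (simp_all only: simps)
    show "hadd ?K x y \<in> \<Phi> ` carrier H"
      "hscale ?K c (hadd ?K x y) = hadd ?K (hscale ?K c x) (hscale ?K c y)"
      "hinner ?K (hscale ?K c x) y = c * hinner ?K x y" for c
      using xy by (auto simp: simps scale_add_right inner_scale_left)
  next
    fix x c assume "x \<in> \<Phi> ` carrier H"
    then show "hscale ?K c x \<in> \<Phi> ` carrier H" by (auto simp: simps)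
  next
    fix x y z assume "x \<in> \<Phi> ` carrier H" "y \<in> \<Phi> ` carrier H" "z \<in> \<Phi> ` carrier H"
    then show "hadd ?K (hadd ?K x y) z = hadd ?K x (hadd ?K y z)"
      "hinner ?K (hadd ?K x y) z = hinner ?K x z + hinner ?K y z"
      by (auto simp: simps add_assoc inner_add_left)
  next
    fix x assume "x \<in> \<Phi> ` carrier H"
    then obtain x' where x': "x' \<in> carrier H" "x = \<Phi> x'" by blast
    then obtain y where "y \<in> carrier H" "x' \<oplus>\<^bsub>H\<^esub> y = \<zero>\<^bsub>H\<^esub>" using add_inverse by blast
    then show "\<exists>y\<in>\<Phi> ` carrier H. hadd ?K x y = \<Phi> \<zero>\<^bsub>H\<^esub>" 
      using x' by (intro bexI[of _ "\<Phi> y"]) (auto simp: simps)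
    show "hadd ?K x (\<Phi> \<zero>\<^bsub>H\<^esub>) = x" "hscale ?K (c + d) x = hadd ?K (hscale ?K c x) (hscale ?K d x)"
      "hscale ?K c (hscale ?K d x) = hscale ?K (c * d) x" "hscale ?K 1 x = x" 
      "hinner ?K x x \<in> \<real>\<^sub>\<ge>\<^sub>0" for c d
      using x' inner_nonneg by (auto simp: simps add_zero scale_add_left scale_scale scale_one)
    show "x = \<Phi> \<zero>\<^bsub>H\<^esub>" if "hinner ?K x x = 0"
      using that x' inner_eq_zero by (auto simp: simps)
  next
    fix X assume X: "\<And>n::nat. X n \<in> \<Phi> ` carrier H"
      and C: "\<And>e. e > 0 \<Longrightarrow> \<exists>N. \<forall>m\<ge>N. \<forall>n\<ge>N. hnorm ?K (hminus ?K (X m) (X n)) < e"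
    define Y where "Y n = inv_into (carrier H) \<Phi> (X n)" for n
    have Y: "Y n \<in> carrier H" "X n = \<Phi> (Y n)" for n
      unfolding Y_def using inv_into_into[OF X] f_inv_into_f[OF X] by simp_all
    have dist: "hnorm ?K (hminus ?K (X n) (\<Phi> y)) = hnorm H (Y n \<ominus>\<^bsub>H\<^esub> y)" if "y \<in> carrier H" for n y
      unfolding Y(2) minus[OF Y(1) that] by (rule norm[OF minus_closed[OF Y(1) that]])
    have "\<exists>y. hconverges H Y y"
    proof (rule complete[OF Y(1)])
      fix e :: real assume "e > 0"
      from C[OF this] show "\<exists>N. \<forall>m\<ge>N. \<forall>n\<ge>N. hnorm H (Y m \<ominus>\<^bsub>H\<^esub> Y n) < e"
        unfolding dist[OF Y(1), symmetric] Y(2)[symmetric] .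
    qed
    then obtain y where y: "y \<in> carrier H" "(\<lambda>n. hnorm H (Y n \<ominus>\<^bsub>H\<^esub> y)) \<longlonglongrightarrow> 0"
      by (auto simp: hconverges_def)
    have "hconverges ?K X (\<Phi> y)"
      unfolding hconverges_def dist[OF y(1)] image_space_carrier using y by blast
    then show "\<exists>x. hconverges ?K X x" by blast
  qed
qed

lemma image_space_unitary:
  assumes U: "hunitary H U" and H: "complex_hilbert_space H" and inj: "inj_on \<Phi> (carrier H)"
  defines "U' \<equiv> \<lambda>x. \<Phi> (U (inv_into (carrier H) \<Phi> x))"
  shows "hunitary (image_space \<Phi> H) U'" "\<And>x. x \<in> carrier H \<Longrightarrow> U' (\<Phi> x) = \<Phi> (U x)"
proof -
  interpret complex_hilbert_space H by fact
  show U': "U' (\<Phi> x) = \<Phi> (U x)" if "x \<in> carrier H" for x using that inj by (simp add: U'_def)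
  note simps = image_space_carrier image_space_zero image_space_ops[OF inj]
  have U_in: "U x \<in> carrier H" if "x \<in> carrier H" for x
    using U that by (auto simp: hunitary_def hlinear_def)
  have "bij_betw U' (\<Phi> ` carrier H) (\<Phi> ` carrier H)"
    unfolding bij_betw_def
  proof
    have "inj_on U (carrier H)" "U ` carrier H = carrier H"
      using U by (auto simp: hunitary_def bij_betw_def)
    then show "inj_on U' (\<Phi> ` carrier H)"
      using inj U_in by (auto simp: inj_on_def U') metis
    have "U' ` \<Phi> ` carrier H = \<Phi> ` U ` carrier H"
      by (simp add: image_image U' cong: image_cong)
    then show "U' ` \<Phi> ` carrier H = \<Phi> ` carrier H"
      by (simp only: \<open>U ` carrier H = carrier H\<close>)
  qed
  then show "hunitary (image_space \<Phi> H) U'"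
    using U U_in by (auto simp: hunitary_def hlinear_def simps U')
qed

text \<open>A form \<open>c p x y\<close>, positive definite in the lattice point \<open>p\<close>, is of the form
  \<open>\<langle>U\<^sup>p x, y\<rangle>\<close> for a pair of commuting unitary operators. \<open>E p x\<close> is the vector \<open>U\<^sup>p x\<close>.
  It is realised in the Hilbert space of the kernel \<open>c (p - q) x y\<close> on pairs \<open>(p, x)\<close>. An element
  of that space is a function of \<open>(p, x)\<close> that is conjugate linear and bounded in \<open>x\<close>, so the Riesz
  theorem turns it into a function from the lattice to vectors.\<close>

theorem (in complex_hilbert_space) lattice_dilation:
  fixes c :: "int \<times> int \<Rightarrow> 'a \<Rightarrow> 'a \<Rightarrow> complex"
  assumes add_left: "\<And>p x y z. \<lbrakk>x \<in> carrier H; y \<in> carrier H; z \<in> carrier H\<rbrakk>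
      \<Longrightarrow> c p (x \<oplus> y) z = c p x z + c p y z"
    and scale_left: "\<And>p a x y. \<lbrakk>x \<in> carrier H; y \<in> carrier H\<rbrakk> \<Longrightarrow> c p (a \<odot> x) y = a * c p x y"
    and scale_right: "\<And>p a x y. \<lbrakk>x \<in> carrier H; y \<in> carrier H\<rbrakk> \<Longrightarrow> c p x (a \<odot> y) = cnj a * c p x y"
    and zero: "\<And>x y. \<lbrakk>x \<in> carrier H; y \<in> carrier H\<rbrakk> \<Longrightarrow> c 0 x y = \<langle>x, y\<rangle>"
    and psd: "\<And>xs. snd ` set xs \<subseteq> carrier H \<Longrightarrow> (\<Sum>(p, x)\<leftarrow>xs. \<Sum>(q, y)\<leftarrow>xs. c (p - q) x y) \<in> \<real>\<^sub>\<ge>\<^sub>0"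
  obtains K :: "((int \<times> int \<Rightarrow> 'a) + 'k) hspace" and E U1 U2
  where "complex_hilbert_space K" "\<And>p x. x \<in> carrier H \<Longrightarrow> E p x \<in> carrier K"
    "\<And>p q x y. \<lbrakk>x \<in> carrier H; y \<in> carrier H\<rbrakk> \<Longrightarrow> hinner K (E p x) (E q y) = c (p - q) x y"
    "hunitary K U1" "hunitary K U2" "\<And>x. x \<in> carrier K \<Longrightarrow> U1 (U2 x) = U2 (U1 x)"
    "\<And>p x. x \<in> carrier H \<Longrightarrow> U1 (E p x) = E (p + (1, 0)) x"
    "\<And>p x. x \<in> carrier H \<Longrightarrow> U2 (E p x) = E (p + (0, 1)) x"
proof -
  \<comment> \<open>Vectors outside the carrier are read as zero, so that the kernel lives on a full type.\<close>
  define \<pi> where "\<pi> x = (if x \<in> carrier H then x else \<zero>)" for x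
  have \<pi>: "\<pi> x \<in> carrier H" for x by (simp add: \<pi>_def)
  define k where "k = (\<lambda>(p, x) (q, y). c (p - q) (\<pi> x) (\<pi> y))"
  interpret psd_kernel k
  proof
    fix xs :: "(complex \<times> (int \<times> int) \<times> 'a) list"
    define ys where "ys = map (\<lambda>(a, p, x). (p, a \<odot> \<pi> x)) xs"
    have "(\<Sum>(p, x)\<leftarrow>ys. \<Sum>(q, y)\<leftarrow>ys. c (p - q) x y) = (\<Sum>(a, i)\<leftarrow>xs. \<Sum>(b, j)\<leftarrow>xs. a * cnj b * k i j)"
      unfolding ys_def
      by (simp add: o_def case_prod_unfold k_def scale_left scale_right \<pi> mult_ac)
    moreover have "snd ` set ys \<subseteq> carrier H" by (auto simp: ys_def \<pi>)
    ultimately show "(\<Sum>(a, i)\<leftarrow>xs. \<Sum>(b, j)\<leftarrow>xs. a * cnj b * k i j) \<in> \<real>\<^sub>\<ge>\<^sub>0"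
      using psd[of ys] by simp
  qed
  have k_ip: "hinner rk_space (k (p, x)) (k (q, y)) = c (p - q) x y"
    if "x \<in> carrier H" "y \<in> carrier H" for p q x y
  proof -
    have "hinner rk_space (k (p, x)) (k (q, y)) = k (p, x) (q, y)"
      by (rule rk_reproducing[OF kernel_in_rk])
    also have "\<dots> = c (p - q) x y" using that by (simp add: k_def \<pi>_def)
    finally show ?thesis .
  qed
  have k_add: "k (p, x \<oplus> y) = (\<lambda>i. k (p, x) i + k (p, y) i)" if "x \<in> carrier H" "y \<in> carrier H" for p x y
    using that by (auto simp: k_def \<pi>_def add_left)
  have k_scale: "k (p, a \<odot> x) = (\<lambda>i. a * k (p, x) i)" if "x \<in> carrier H" for p x a
    using that by (auto simp: k_def \<pi>_def scale_left)
  have rk_ops: "hadd rk_space f g = (\<lambda>i. f i + g i)" "hscale rk_space a f = (\<lambda>i. a * f i)" for f g a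
    by (simp_all add: rk_space_def)
  have riesz: "\<exists>v. v \<in> carrier H \<and> (\<forall>x\<in>carrier H. f (p, x) = \<langle>v, x\<rangle>)" if f: "f \<in> carrier rk_space" for f p
  proof -
    have val: "f (p, x) = hinner rk_space f (k (p, x))" for x using rk_reproducing[OF f] by simp
    obtain v where "v \<in> carrier H" "\<And>x. x \<in> carrier H \<Longrightarrow> f (p, x) = \<langle>v, x\<rangle>"
    proof (rule Riesz_representation[of "\<lambda>x. f (p, x)" "hnorm rk_space f"])
      fix x y assume "x \<in> carrier H" "y \<in> carrier H"
      then show "f (p, x \<oplus> y) = f (p, x) + f (p, y)"
        using rk.inner_add_right[OF kernel_in_rk kernel_in_rk f] by (simp add: val k_add rk_ops)
    next
      fix x a assume "x \<in> carrier H"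
      then show "f (p, a \<odot> x) = cnj a * f (p, x)"
        using rk.inner_scale_right[OF kernel_in_rk f] by (simp add: val k_scale rk_ops)
    next
      fix x assume x: "x \<in> carrier H"
      then have "hnorm rk_space (k (p, x)) = hnorm H x"
        using k_ip[OF x x, of p p] zero[OF x x] by (simp add: hnorm_def zero_prod_def[symmetric])
      then show "cmod (f (p, x)) \<le> hnorm rk_space f * \<parallel>x\<parallel>"
        using rk.Cauchy_Schwarz[OF f kernel_in_rk] by (metis val)
    qed blast
    then show ?thesis by blast
  qed
  define \<Phi> :: "(((int \<times> int) \<times> 'a) \<Rightarrow> complex) \<Rightarrow> (int \<times> int \<Rightarrow> 'a) + 'k"
    where "\<Phi> f = Inl (\<lambda>p. SOME v. v \<in> carrier H \<and> (\<forall>x\<in>carrier H. f (p, x) = \<langle>v, x\<rangle>))" for f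
  have inj: "inj_on \<Phi> (carrier rk_space)"
  proof (rule inj_onI, rule ext, clarify)
    fix f g p x assume f: "f \<in> carrier rk_space" and g: "g \<in> carrier rk_space" and eq: "\<Phi> f = \<Phi> g"
    define v where "v = (SOME v. v \<in> carrier H \<and> (\<forall>x\<in>carrier H. f (p, x) = \<langle>v, x\<rangle>))"
    define w where "w = (SOME v. v \<in> carrier H \<and> (\<forall>x\<in>carrier H. g (p, x) = \<langle>v, x\<rangle>))"
    have "v = w"
      using eq unfolding \<Phi>_def v_def w_def sum.inject by (rule fun_cong)
    moreover have "\<forall>x\<in>carrier H. f (p, x) = \<langle>v, x\<rangle>"
      using someI_ex[OF riesz[OF f, of p]] unfolding v_def by blast
    moreover have "\<forall>x\<in>carrier H. g (p, x) = \<langle>w, x\<rangle>"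
      using someI_ex[OF riesz[OF g, of p]] unfolding w_def by blast
    ultimately have "f (p, x) = g (p, x)" if "x \<in> carrier H" for x
      using that by simp
    moreover have "h (p, x) = h (p, \<pi> x)" if "h \<in> carrier rk_space" for h
    proof -
      have "k (p, x) = k (p, \<pi> x)" using \<pi>[of x] by (auto simp: k_def \<pi>_def[of "\<pi> x"])
      then show ?thesis using rk_reproducing[OF that] by metis
    qed
    ultimately show "f (p, x) = g (p, x)" using f g \<pi> by metis
  qed
  define S :: "int \<times> int \<Rightarrow> ((int \<times> int) \<times> 'a) \<Rightarrow> ((int \<times> int) \<times> 'a)" where "S d = (\<lambda>(p, x). (p + d, x))" for d
  define U where "U d = (\<lambda>(f :: (int \<times> int) \<times> 'a \<Rightarrow> complex) i. f (S (- d) i))" for d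
  have S: "S d (S (- d) i) = i" "S (- d) (S d i) = i" "k (S d i) (S d j) = k i j" for d i j
    by (cases i; cases j; simp add: S_def k_def)+
  have U: "hunitary rk_space (U d)" "U d (k i) = k (S d i)" for d i
    unfolding U_def
    using rk_symmetry_unitary(1)[where s = "S d" and t = "S (- d)", OF S]
      rk_symmetry_unitary(2)[where s = "S d" and t = "S (- d)", OF S] by simp_all
  define K where "K = image_space \<Phi> rk_space"
  define U' where "U' d = (\<lambda>x. \<Phi> (U d (inv_into (carrier rk_space) \<Phi> x)))" for d
  have U': "hunitary K (U' d)" "\<And>f. f \<in> carrier rk_space \<Longrightarrow> U' d (\<Phi> f) = \<Phi> (U d f)" for d
    unfolding K_def U'_def using image_space_unitary[OF U(1)[of d] rk_hilbert_space inj] by simp_all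
  have U_in: "U d f \<in> carrier rk_space" if "f \<in> carrier rk_space" for d f
    using U(1)[of d] that by (auto simp: hunitary_def hlinear_def)
  show thesis
  proof (rule that[of K "\<lambda>p x. \<Phi> (k (p, x))" "U' (1, 0)" "U' (0, 1)"])
    show "complex_hilbert_space K" unfolding K_def by (rule image_space_hilbert[OF rk_hilbert_space inj])
    show "\<Phi> (k (p, x)) \<in> carrier K" for p x by (simp add: K_def image_space_carrier)
    show "hinner K (\<Phi> (k (p, x))) (\<Phi> (k (q, y))) = c (p - q) x y"
      if "x \<in> carrier H" "y \<in> carrier H" for p q x y
      using that by (simp add: K_def image_space_ops[OF inj] k_ip)
    show "U' (1, 0) (U' (0, 1) x) = U' (0, 1) (U' (1, 0) x)" if "x \<in> carrier K" for x
    proof -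
      obtain f where f: "f \<in> carrier rk_space" "x = \<Phi> f" using \<open>x \<in> carrier K\<close> by (auto simp: K_def image_space_carrier)
      have "U (1, 0) (U (0, 1) f) = U (0, 1) (U (1, 0) f)"
        by (auto simp: U_def S_def split: prod.splits)
      then show ?thesis using f U'(2) U_in by simp
    qed
    show "U' (1, 0) (\<Phi> (k (p, x))) = \<Phi> (k (p + (1, 0), x))"
      "U' (0, 1) (\<Phi> (k (p, x))) = \<Phi> (k (p + (0, 1), x))" for p x
      by (simp_all add: U'(2) U(2) S_def)
  qed (rule U')+
qed

section \<open>Unitary operators, their resolvents and Cayley transforms\<close>

lemma open_Te: "open Te"
proof -
  have "Te = - sphere 0 1" by (auto simp: Te_def)
  then show ?thesis by (metis closed_sphere open_Compl)
qed

lemma cnj_in_Te [simp]: "cnj z \<in> Te \<longleftrightarrow> z \<in> Te"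
  by (simp add: Te_def)

lemma inverse_in_Te: "z \<in> Te \<Longrightarrow> inverse z \<in> Te"
  by (auto simp: Te_def norm_inverse)

lemma zero_in_Te [simp]: "0 \<in> Te"
  by (simp add: Te_def)

lemma disc_in_Te: "cmod z < 1 \<Longrightarrow> z \<in> Te"
  by (simp add: Te_def)

lemma reflect_chart: "reflect (Some z) = chart_inf (cnj z)"
  by (auto simp: reflect_def chart_inf_def)

lemma Te_inf_cases:
  assumes "z \<in> Te_inf"
  obtains w where "w \<in> Te" "z = Some w" | u where "u \<in> Te" "z = chart_inf u"
  using assms by (auto simp: Te_inf_def chart_inf_def) (metis zero_in_Te)

context complex_hilbert_space
begin

lemma contraction_fixed_point:
  assumes f: "\<And>x. x \<in> carrier H \<Longrightarrow> f x \<in> carrier H" and q: "q < 1"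
    and contr: "\<And>x y. \<lbrakk>x \<in> carrier H; y \<in> carrier H\<rbrakk> \<Longrightarrow> \<parallel>f x \<ominus> f y\<parallel> \<le> q * \<parallel>x \<ominus> y\<parallel>"
  obtains x where "x \<in> carrier H" "f x = x"
proof -
  define d where "d x y = (if x \<in> carrier H \<and> y \<in> carrier H then \<parallel>x \<ominus> y\<parallel> else 0)" for x y
  interpret M: Metric_space "carrier H" d
  proof
    show "0 \<le> d x y" "d x y = d y x" for x y
      by (auto simp: d_def norm_ge_0 norm_minus_commute)
    show "d x y = 0 \<longleftrightarrow> x = y" if "x \<in> carrier H" "y \<in> carrier H" for x y
      using that by (simp add: d_def dist_zero_iff)
    show "d x z \<le> d x y + d y z" if "x \<in> carrier H" "y \<in> carrier H" "z \<in> carrier H" for x y z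
      using that by (simp add: d_def dist_triangle)
  qed
  have "M.mcomplete"
    unfolding M.mcomplete_def
  proof (intro allI impI)
    fix X :: "nat \<Rightarrow> 'a" assume "M.MCauchy X"
    then have X: "\<And>n. X n \<in> carrier H"
      and C: "\<And>e. e > 0 \<Longrightarrow> \<exists>N. \<forall>m n. N \<le> m \<longrightarrow> N \<le> n \<longrightarrow> d (X m) (X n) < e"
      unfolding M.MCauchy_def by auto
    have "\<exists>x. hconverges H X x"
    proof (rule complete[OF X])
      fix e :: real assume "e > 0"
      then show "\<exists>N. \<forall>m\<ge>N. \<forall>n\<ge>N. \<parallel>X m \<ominus> X n\<parallel> < e"
        using C[of e] X by (auto simp: d_def)
    qed
    then obtain x where x: "x \<in> carrier H" "(\<lambda>n. \<parallel>X n \<ominus> x\<parallel>) \<longlonglongrightarrow> 0" by (auto simp: hconverges_def)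
    then show "\<exists>x. limitin M.mtopology X x sequentially"
      using X by (auto simp: M.limitin_metric_dist_null d_def intro!: exI[of _ x])
  qed
  moreover have "carrier H \<noteq> {}" using zero_closed by blast
  ultimately obtain x where "x \<in> carrier H" "f x = x"
    by (rule M.Banach_fixedpoint_thm[of f q]) (use f q contr in \<open>auto simp: d_def\<close>)
  then show thesis using that by blast
qed

lemma hlinearD:
  assumes "hlinear H H A" 
  shows "x \<in> carrier H \<Longrightarrow> A x \<in> carrier H"
    "\<lbrakk>x \<in> carrier H; y \<in> carrier H\<rbrakk> \<Longrightarrow> A (x \<oplus> y) = A x \<oplus> A y"
    "x \<in> carrier H \<Longrightarrow> A (c \<odot> x) = c \<odot> A x"
    "\<lbrakk>x \<in> carrier H; y \<in> carrier H\<rbrakk> \<Longrightarrow> A (x \<ominus> y) = A x \<ominus> A y"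
  using assms by (auto simp: hlinear_def hminus_def Pi_iff)

lemma hunitary_linear: "hunitary H U \<Longrightarrow> hlinear H H U"
  by (simp add: hunitary_def)

lemma hunitary_closed: "\<lbrakk>hunitary H U; x \<in> carrier H\<rbrakk> \<Longrightarrow> U x \<in> carrier H"
  by (auto simp: hunitary_def hlinear_def)

lemma hunitary_inner:
  "\<lbrakk>hunitary H U; x \<in> carrier H; y \<in> carrier H\<rbrakk> \<Longrightarrow> \<langle>U x, U y\<rangle> = \<langle>x, y\<rangle>"
  by (simp add: hunitary_def)

lemma hunitary_norm: "\<lbrakk>hunitary H U; x \<in> carrier H\<rbrakk> \<Longrightarrow> \<parallel>U x\<parallel> = \<parallel>x\<parallel>"
  by (simp add: hnorm_def hunitary_inner)

abbreviation uinv :: "('a \<Rightarrow> 'a) \<Rightarrow> 'a \<Rightarrow> 'a" where "uinv U \<equiv> inv_into (carrier H) U"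

lemma uinv_cancel:
  assumes "hunitary H U" "x \<in> carrier H"
  shows "uinv U (U x) = x" "U (uinv U x) = x" "uinv U x \<in> carrier H"
proof -
  have "inj_on U (carrier H)" "U ` carrier H = carrier H"
    using assms(1) by (auto simp: hunitary_def bij_betw_def)
  then show "uinv U (U x) = x" "U (uinv U x) = x" "uinv U x \<in> carrier H"
    using assms(2) inv_into_into[of x U "carrier H"] f_inv_into_f[of x U "carrier H"] by auto
qed

lemma uinv_unitary:
  assumes U: "hunitary H U" shows "hunitary H (uinv U)"
proof -
  note c = uinv_cancel[OF U]
  have inner: "\<langle>uinv U x, uinv U y\<rangle> = \<langle>x, y\<rangle>" if "x \<in> carrier H" "y \<in> carrier H" for x y
    using hunitary_inner[OF U c(3) c(3), of x y] that c by simp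
  have "uinv U (x \<oplus> y) = uinv U x \<oplus> uinv U y" if "x \<in> carrier H" "y \<in> carrier H" for x y
  proof -
    have "U (uinv U x \<oplus> uinv U y) = x \<oplus> y"
      using hlinearD(2)[OF hunitary_linear[OF U] c(3) c(3), of x y] that c by simp
    then show ?thesis using c(1)[of "uinv U x \<oplus> uinv U y"] c(3) that by auto
  qed
  moreover have "uinv U (a \<odot> x) = a \<odot> uinv U x" if "x \<in> carrier H" for a x
  proof -
    have "U (a \<odot> uinv U x) = a \<odot> x"
      using hlinearD(3)[OF hunitary_linear[OF U] c(3), of x a] that c by simp
    then show ?thesis using c(1)[of "a \<odot> uinv U x"] c(3) that by auto
  qed
  moreover have "bij_betw (uinv U) (carrier H) (carrier H)"
    using U by (simp add: hunitary_def bij_betw_inv_into)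
  ultimately show ?thesis using inner c by (auto simp: hunitary_def hlinear_def)
qed

lemma uinv_adjoint:
  assumes U: "hunitary H U" "x \<in> carrier H" "y \<in> carrier H"
  shows "\<langle>U x, y\<rangle> = \<langle>x, uinv U y\<rangle>" "\<langle>x, U y\<rangle> = \<langle>uinv U x, y\<rangle>"
  using hunitary_inner[OF U(1), of x "uinv U y"] hunitary_inner[OF U(1), of "uinv U x" y] uinv_cancel[OF U(1)] assms
  by auto

definition resolvent :: "('a \<Rightarrow> 'a) \<Rightarrow> complex \<Rightarrow> 'a \<Rightarrow> 'a" where
  "resolvent U z x = inv_into (carrier H) (\<lambda>y. y \<ominus> z \<odot> U y) x"

lemma resolvent_lower_bound:
  assumes U: "hunitary H U" and y: "y \<in> carrier H"
  shows "\<bar>1 - cmod z\<bar> * \<parallel>y\<parallel> \<le> \<parallel>y \<ominus> z \<odot> U y\<parallel>"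
proof -
  have zU: "z \<odot> U y \<in> carrier H" using hunitary_closed[OF U y] by simp
  have n: "\<parallel>z \<odot> U y\<parallel> = cmod z * \<parallel>y\<parallel>"
    using hunitary_closed[OF U y] by (simp add: norm_scale hunitary_norm[OF U y])
  have "\<bar>1 - cmod z\<bar> * \<parallel>y\<parallel> = \<bar>\<parallel>y\<parallel> - cmod z * \<parallel>y\<parallel>\<bar>"
    using norm_ge_0[OF y] abs_mult[of "1 - cmod z" "\<parallel>y\<parallel>"] by (simp add: left_diff_distrib)
  also have "\<dots> \<le> \<parallel>y \<ominus> z \<odot> U y\<parallel>"
    using norm_diff_le[OF y zU] n by simp
  finally show ?thesis .
qed

text \<open>For \<open>\<bar>z\<bar> < 1\<close> the map \<open>y \<mapsto> x + z U y\<close> is a contraction. For \<open>\<bar>z\<bar> > 1\<close>, dividing \<open>y - z U y = x\<close> by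
  \<open>- z U\<close> gives an equation of the same kind for \<open>U\<^sup>-\<^sup>1\<close> and \<open>1 / z\<close>.\<close>

lemma resolvent_surj_disc:
  assumes U: "hunitary H U" and x: "x \<in> carrier H" and z: "cmod z < 1"
  shows "\<exists>y\<in>carrier H. y \<ominus> z \<odot> U y = x"
proof -
  note lin = hlinearD[OF hunitary_linear[OF U]] and cl = hunitary_closed[OF U]
  obtain y where y: "y \<in> carrier H" "x \<oplus> z \<odot> U y = y"
  proof (rule contraction_fixed_point[of "\<lambda>y. x \<oplus> z \<odot> U y" "cmod z"])
    fix y y' assume yy: "y \<in> carrier H" "y' \<in> carrier H"
    have "(x \<oplus> z \<odot> U y) \<ominus> (x \<oplus> z \<odot> U y') = z \<odot> U (y \<ominus> y')"
      by (rule vector_eqI) (use x yy in \<open>simp_all add: lin cl inner_simps algebra_simps\<close>)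
    then show "\<parallel>(x \<oplus> z \<odot> U y) \<ominus> (x \<oplus> z \<odot> U y')\<parallel> \<le> cmod z * \<parallel>y \<ominus> y'\<parallel>"
      using yy by (simp add: norm_scale cl hunitary_norm[OF U])
  qed (use x cl z in auto)
  have "y \<ominus> z \<odot> U y = x"
  proof (rule vector_eqI)
    fix g assume g: "g \<in> carrier H"
    have "\<langle>x \<oplus> z \<odot> U y, g\<rangle> = \<langle>y, g\<rangle>" using y by simp
    then show "\<langle>y \<ominus> z \<odot> U y, g\<rangle> = \<langle>x, g\<rangle>"
      using x y(1) g by (simp add: inner_simps cl) (simp add: algebra_simps)
  qed (use x y(1) cl in auto)
  then show ?thesis using y by blast
qed

lemma resolvent_bij:
  assumes U: "hunitary H U" and z: "z \<in> Te"
  shows "bij_betw (\<lambda>y. y \<ominus> z \<odot> U y) (carrier H) (carrier H)"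
  unfolding bij_betw_def
proof
  note lin = hlinearD[OF hunitary_linear[OF U]] and cl = hunitary_closed[OF U]
  show "inj_on (\<lambda>y. y \<ominus> z \<odot> U y) (carrier H)"
  proof (rule inj_onI)
    fix x y assume xy: "x \<in> carrier H" "y \<in> carrier H" and eq: "x \<ominus> z \<odot> U x = y \<ominus> z \<odot> U y"
    have "(x \<ominus> y) \<ominus> z \<odot> U (x \<ominus> y) = (x \<ominus> z \<odot> U x) \<ominus> (y \<ominus> z \<odot> U y)"
      by (rule vector_eqI) (use xy in \<open>simp_all add: lin cl inner_simps algebra_simps\<close>)
    also have "\<dots> = \<zero>"
      unfolding eq by (rule vector_eqI) (use xy in \<open>simp_all add: cl inner_simps\<close>)
    finally have "\<bar>1 - cmod z\<bar> * \<parallel>x \<ominus> y\<parallel> \<le> 0"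
      using resolvent_lower_bound[OF U, of "x \<ominus> y" z] xy by (simp add: norm_zero)
    moreover have "\<bar>1 - cmod z\<bar> > 0" using z by (simp add: Te_def)
    ultimately have "\<parallel>x \<ominus> y\<parallel> = 0"
      using norm_ge_0[of "x \<ominus> y"] xy by (simp add: mult_le_0_iff)
    then show "x = y" using dist_zero_iff xy by blast
  qed
  have "\<exists>y\<in>carrier H. y \<ominus> z \<odot> U y = x" if x: "x \<in> carrier H" for x
  proof (cases "cmod z < 1")
    case True
    then show ?thesis using resolvent_surj_disc[OF U x] by blast
  next
    case False
    then have "cmod (inverse z) < 1" "z \<noteq> 0"
      using z by (auto simp: Te_def norm_inverse inverse_less_1_iff)
    note V = uinv_unitary[OF U] and cV = uinv_cancel[OF U]
    obtain y where y: "y \<in> carrier H" "y \<ominus> inverse z \<odot> uinv U y = (- inverse z) \<odot> uinv U x"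
      using resolvent_surj_disc[OF V scale_closed[OF cV(3)[OF x]] \<open>cmod (inverse z) < 1\<close>] by blast
    have "U (y \<ominus> inverse z \<odot> uinv U y) = U ((- inverse z) \<odot> uinv U x)" using y(2) by simp
    then have eq: "U y \<ominus> inverse z \<odot> y = (- inverse z) \<odot> x"
      using x y(1) cV by (simp add: lin)
    have "y \<ominus> z \<odot> U y = x"
    proof (rule vector_eqI)
      fix g assume g: "g \<in> carrier H"
      have "\<langle>U y \<ominus> inverse z \<odot> y, g\<rangle> = \<langle>(- inverse z) \<odot> x, g\<rangle>" unfolding eq ..
      then have "\<langle>U y, g\<rangle> = inverse z * (\<langle>y, g\<rangle> - \<langle>x, g\<rangle>)"
        using x y(1) g by (simp add: inner_simps cl algebra_simps)
      then show "\<langle>y \<ominus> z \<odot> U y, g\<rangle> = \<langle>x, g\<rangle>"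
        using x y(1) g \<open>z \<noteq> 0\<close> by (simp add: inner_simps cl flip: mult.assoc)
    qed (use x y(1) cl in auto)
    then show ?thesis using y by blast
  qed
  then show "(\<lambda>y. y \<ominus> z \<odot> U y) ` carrier H = carrier H"
    using cl by (auto simp: image_iff)
qed

lemma resolvent_closed:
  assumes "hunitary H U" "z \<in> Te" "x \<in> carrier H"
  shows "resolvent U z x \<in> carrier H"
  unfolding resolvent_def using resolvent_bij[OF assms(1,2)] assms(3)
  by (metis bij_betw_def inv_into_into)

lemma resolvent_eq:
  assumes "hunitary H U" "z \<in> Te" "x \<in> carrier H"
  shows "resolvent U z x \<ominus> z \<odot> U (resolvent U z x) = x"
  using resolvent_bij[OF assms(1,2)] assms(3) f_inv_into_f[of x "\<lambda>y. y \<ominus> z \<odot> U y" "carrier H"]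
  by (simp add: resolvent_def bij_betw_def)

lemma resolvent_unique:
  assumes "hunitary H U" "z \<in> Te" "y \<in> carrier H" "y \<ominus> z \<odot> U y = x"
  shows "resolvent U z x = y"
  using resolvent_bij[OF assms(1,2)] assms(3,4) inv_into_f_f[of "\<lambda>y. y \<ominus> z \<odot> U y" "carrier H" y]
  by (simp add: resolvent_def bij_betw_def)

lemma resolvent_inner:
  assumes "hunitary H U" "z \<in> Te" "x \<in> carrier H" "g \<in> carrier H"
  shows "\<langle>x, g\<rangle> = \<langle>resolvent U z x, g\<rangle> - z * \<langle>U (resolvent U z x), g\<rangle>"
    "\<langle>g, x\<rangle> = \<langle>g, resolvent U z x\<rangle> - cnj z * \<langle>g, U (resolvent U z x)\<rangle>"
proof -
  let ?y = "resolvent U z x"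
  have y: "?y \<in> carrier H" "U ?y \<in> carrier H"
    using resolvent_closed[OF assms(1-3)] hunitary_closed[OF assms(1)] by auto
  have "\<langle>x, g\<rangle> = \<langle>?y \<ominus> z \<odot> U ?y, g\<rangle>" "\<langle>g, x\<rangle> = \<langle>g, ?y \<ominus> z \<odot> U ?y\<rangle>"
    using resolvent_eq[OF assms(1-3)] by simp_all
  then show "\<langle>x, g\<rangle> = \<langle>?y, g\<rangle> - z * \<langle>U ?y, g\<rangle>" "\<langle>g, x\<rangle> = \<langle>g, ?y\<rangle> - cnj z * \<langle>g, U ?y\<rangle>"
    using y assms by (simp_all add: inner_simps)
qed

lemma resolvent_zero: "\<lbrakk>hunitary H U; x \<in> carrier H\<rbrakk> \<Longrightarrow> resolvent U 0 x = x"
  by (rule resolvent_unique)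
    (auto intro!: vector_eqI simp: hunitary_closed inner_simps)

lemma resolvent_norm:
  assumes "hunitary H U" "z \<in> Te" "x \<in> carrier H"
  shows "\<bar>1 - cmod z\<bar> * \<parallel>resolvent U z x\<parallel> \<le> \<parallel>x\<parallel>"
  using resolvent_lower_bound[OF assms(1) resolvent_closed[OF assms], of z] resolvent_eq[OF assms] by simp

lemma resolvent_linear:
  assumes U: "hunitary H U" and z: "z \<in> Te" shows "hlinear H H (resolvent U z)"
proof -
  note lin = hlinearD[OF hunitary_linear[OF U]] and cl = hunitary_closed[OF U]
    and T = resolvent_closed[OF U z]
  have "resolvent U z (x \<oplus> y) = resolvent U z x \<oplus> resolvent U z y"
    if x: "x \<in> carrier H" and y: "y \<in> carrier H" for x y
  proof (rule resolvent_unique[OF U z])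
    note c = T[OF x] T[OF y] cl[OF T[OF x]] cl[OF T[OF y]]
    show "(resolvent U z x \<oplus> resolvent U z y) \<ominus> z \<odot> U (resolvent U z x \<oplus> resolvent U z y) = x \<oplus> y"
      by (rule vector_eqI)
        (use x y c in \<open>simp_all add: lin inner_simps resolvent_inner(1)[OF U z x]
          resolvent_inner(1)[OF U z y] algebra_simps\<close>)
  qed (use T x y in simp)
  moreover have "resolvent U z (a \<odot> x) = a \<odot> resolvent U z x" if x: "x \<in> carrier H" for a x
  proof (rule resolvent_unique[OF U z])
    note c = T[OF x] cl[OF T[OF x]]
    show "(a \<odot> resolvent U z x) \<ominus> z \<odot> U (a \<odot> resolvent U z x) = a \<odot> x"
      by (rule vector_eqI)
        (use x c in \<open>simp_all add: lin inner_simps resolvent_inner(1)[OF U z x] algebra_simps\<close>)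
  qed (use T x in simp)
  ultimately show ?thesis using T by (auto simp: hlinear_def)
qed

lemma resolvent_commute:
  assumes U: "hunitary H U" and z: "z \<in> Te" and W: "hlinear H H W"
    and comm: "\<And>x. x \<in> carrier H \<Longrightarrow> W (U x) = U (W x)" and x: "x \<in> carrier H"
  shows "W (resolvent U z x) = resolvent U z (W x)"
proof (rule resolvent_unique[OF U z, symmetric])
  let ?y = "resolvent U z x"
  have y: "?y \<in> carrier H" "U ?y \<in> carrier H"
    using resolvent_closed[OF U z x] hunitary_closed[OF U] by auto
  then show "W ?y \<in> carrier H" using hlinearD[OF W] by blast
  have "W ?y \<ominus> z \<odot> U (W ?y) = W (?y \<ominus> z \<odot> U ?y)"
    using y hlinearD[OF W] by (simp flip: comm)
  then show "W ?y \<ominus> z \<odot> U (W ?y) = W x" using resolvent_eq[OF U z x] by simp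
qed

lemma cayley_resolvent:
  assumes U: "hunitary H U" and z: "z \<in> Te" and x: "x \<in> carrier H"
  shows "cayley H U z x = 2 \<odot> resolvent U z x \<ominus> x"
proof -
  let ?y = "resolvent U z x"
  have y: "?y \<in> carrier H" "U ?y \<in> carrier H"
    using resolvent_closed[OF U z x] hunitary_closed[OF U] by auto
  have "cayley H U z x = ?y \<oplus> z \<odot> U ?y" by (simp add: cayley_def resolvent_def Let_def)
  also have "\<dots> = 2 \<odot> ?y \<ominus> x"
    by (rule vector_eqI) (use x y in \<open>simp_all add: inner_simps resolvent_inner(1)[OF U z x]\<close>)
  finally show ?thesis .
qed

lemma cayley_closed:
  "\<lbrakk>hunitary H U; z \<in> Te; x \<in> carrier H\<rbrakk> \<Longrightarrow> cayley H U z x \<in> carrier H"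
  by (simp add: cayley_resolvent resolvent_closed)

lemma cayley_inner:
  assumes "hunitary H U" "z \<in> Te" "x \<in> carrier H" "g \<in> carrier H"
  shows "\<langle>cayley H U z x, g\<rangle> = 2 * \<langle>resolvent U z x, g\<rangle> - \<langle>x, g\<rangle>"
    "\<langle>g, cayley H U z x\<rangle> = 2 * \<langle>g, resolvent U z x\<rangle> - \<langle>g, x\<rangle>"
  using assms resolvent_closed[OF assms(1-3)] by (simp_all add: cayley_resolvent inner_simps)

lemma cayley_zero: "\<lbrakk>hunitary H U; x \<in> carrier H\<rbrakk> \<Longrightarrow> cayley H U 0 x = x"
  by (auto intro!: vector_eqI simp: cayley_closed cayley_inner resolvent_zero)

lemma cayley_linear:
  assumes U: "hunitary H U" and z: "z \<in> Te" shows "hlinear H H (cayley H U z)"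
proof -
  note T = resolvent_closed[OF U z] and C = cayley_closed[OF U z]
    and lin = hlinearD[OF resolvent_linear[OF U z]]
  have "cayley H U z (x \<oplus> y) = cayley H U z x \<oplus> cayley H U z y" if "x \<in> carrier H" "y \<in> carrier H" for x y
    by (rule vector_eqI) (use that T C in \<open>simp_all add: cayley_inner[OF U z] inner_simps lin\<close>)
  moreover have "cayley H U z (a \<odot> x) = a \<odot> cayley H U z x" if "x \<in> carrier H" for a x
    by (rule vector_eqI) (use that T C in \<open>simp_all add: cayley_inner[OF U z] inner_simps lin(3) algebra_simps\<close>)
  ultimately show ?thesis using C by (auto simp: hlinear_def)
qed

lemma cayley_commute:
  assumes U: "hunitary H U" and z: "z \<in> Te" and W: "hlinear H H W"
    and comm: "\<And>x. x \<in> carrier H \<Longrightarrow> W (U x) = U (W x)" and x: "x \<in> carrier H"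
  shows "W (cayley H U z x) = cayley H U z (W x)"
  using hlinearD[OF W] resolvent_commute[OF assms] resolvent_closed[OF U z x] x
  by (simp add: cayley_resolvent[OF U z])

lemma resolvent_adjoint:
  assumes U: "hunitary H U" and z: "z \<in> Te" and x: "x \<in> carrier H" and y: "y \<in> carrier H"
  shows "\<langle>resolvent U z x, y\<rangle> = \<langle>x, resolvent (uinv U) (cnj z) y\<rangle>"
proof -
  note V = uinv_unitary[OF U]
  let ?a = "resolvent U z x" and ?b = "resolvent (uinv U) (cnj z) y"
  have a: "?a \<in> carrier H" and b: "?b \<in> carrier H"
    using resolvent_closed[OF U z x] resolvent_closed[OF V _ y] z by auto
  have "\<langle>?a, y\<rangle> = \<langle>?a, ?b\<rangle> - z * \<langle>?a, uinv U ?b\<rangle>"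
    using resolvent_inner(2)[OF V _ y a, of "cnj z"] z by simp
  also have "\<langle>?a, uinv U ?b\<rangle> = \<langle>U ?a, ?b\<rangle>" using uinv_adjoint(1)[OF U a b] by simp
  also have "\<langle>?a, ?b\<rangle> - z * \<langle>U ?a, ?b\<rangle> = \<langle>x, ?b\<rangle>" using resolvent_inner(1)[OF U z x b] by simp
  finally show ?thesis .
qed

lemma cayley_adjoint:
  assumes U: "hunitary H U" and z: "z \<in> Te" and x: "x \<in> carrier H" and y: "y \<in> carrier H"
  shows "\<langle>cayley H U z x, y\<rangle> = \<langle>x, cayley H (uinv U) (cnj z) y\<rangle>"
  using assms resolvent_adjoint[OF assms] uinv_unitary[OF U] by (simp add: cayley_inner)

text \<open>The Cayley transform extends to \<open>z = \<infinity>\<close> by the value \<open>- E\<close>, and the coordinate at infinity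
  exchanges \<open>U\<close> with its inverse. This reduces all four charts of a function of two variables to
  the finite one.\<close>

definition cayley_ext :: "('a \<Rightarrow> 'a) \<Rightarrow> complex option \<Rightarrow> 'a \<Rightarrow> 'a" where
  "cayley_ext U z x = (case z of None \<Rightarrow> (- 1) \<odot> x | Some w \<Rightarrow> cayley H U w x)"

lemma cayley_ext_Some [simp]: "cayley_ext U (Some z) x = cayley H U z x"
  and cayley_ext_None [simp]: "cayley_ext U None x = (- 1) \<odot> x"
  by (simp_all add: cayley_ext_def)

lemma cayley_ext_chart_inf:
  assumes U: "hunitary H U" and u: "u \<in> Te" and x: "x \<in> carrier H"
  shows "cayley_ext U (chart_inf u) x = (- 1) \<odot> cayley H (uinv U) u x"
proof (cases "u = 0")
  case True
  then show ?thesis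
    using x cayley_zero[OF uinv_unitary[OF U] x] by (simp add: chart_inf_def)
next
  case False
  note V = uinv_unitary[OF U] and iu = inverse_in_Te[OF u]
  let ?y = "resolvent U (inverse u) x"
  have y: "?y \<in> carrier H" "U ?y \<in> carrier H"
    using resolvent_closed[OF U iu x] hunitary_closed[OF U] by auto
  have w: "resolvent (uinv U) u x = x \<ominus> ?y"
  proof (rule resolvent_unique[OF V u])
    have "uinv U (x \<ominus> ?y) = (- inverse u) \<odot> ?y"
    proof -
      have "x \<ominus> ?y = U ((- inverse u) \<odot> ?y)"
        using hlinearD[OF hunitary_linear[OF U]] y x
        by (auto intro!: vector_eqI simp: inner_simps resolvent_inner(1)[OF U iu x])
      then show ?thesis using uinv_cancel(1)[OF U, of "(- inverse u) \<odot> ?y"] y by simp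
    qed
    then show "(x \<ominus> ?y) \<ominus> u \<odot> uinv U (x \<ominus> ?y) = x"
      using x y False by (auto intro!: vector_eqI simp: inner_simps)
  qed (use x y in simp)
  show ?thesis
    using x y False
    by (auto intro!: vector_eqI simp: chart_inf_def cayley_resolvent[OF U iu x] cayley_resolvent[OF V u x] w inner_simps)
qed

lemma cayley_ext_linear:
  assumes U: "hunitary H U" and z: "z \<in> Te_inf" shows "hlinear H H (cayley_ext U z)"
proof (cases z)
  case None
  have "hlinear H H (\<lambda>x. (- 1) \<odot> x)"
    by (auto simp: hlinear_def scale_add_right scale_scale mult.commute)
  moreover have "cayley_ext U None = (\<lambda>x. (- 1) \<odot> x)" by (rule ext) simp
  ultimately show ?thesis using None by simp
next
  case (Some w)
  moreover have "cayley_ext U (Some w) = cayley H U w" by (rule ext) simp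
  ultimately show ?thesis using cayley_linear[OF U, of w] z by (simp add: Te_inf_def image_iff)
qed

lemma cayley_ext_closed:
  "\<lbrakk>hunitary H U; z \<in> Te_inf; x \<in> carrier H\<rbrakk> \<Longrightarrow> cayley_ext U z x \<in> carrier H"
  using hlinearD(1)[OF cayley_ext_linear] by blast

lemma cayley_ext_commute:
  assumes U: "hunitary H U" and z: "z \<in> Te_inf" and W: "hlinear H H W"
    and comm: "\<And>x. x \<in> carrier H \<Longrightarrow> W (U x) = U (W x)" and x: "x \<in> carrier H"
  shows "W (cayley_ext U z x) = cayley_ext U z (W x)"
proof (cases z)
  case None
  then show ?thesis using hlinearD(3)[OF W x] by simp
next
  case (Some w)
  then show ?thesis using cayley_commute[OF U _ W comm x, of w] z by (simp add: Te_inf_def image_iff)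
qed

text \<open>Reflection takes the Cayley transform \<open>C(z)\<close> to \<open>- C(z)\<^sup>*\<close>, so this is the identity
  \<open>C(z) + C(z)\<^sup>* = 2 (1 - \<bar>z\<bar>\<^sup>2) T\<^sup>* T\<close> with \<open>T = (E - z U)\<^sup>-\<^sup>1\<close>.\<close>

lemma poisson_identity:
  assumes U: "hunitary H U" and z: "cmod z < 1" and a: "a \<in> carrier H" and b: "b \<in> carrier H"
  shows "\<langle>cayley_ext U (Some z) a, b\<rangle> - \<langle>cayley_ext U (reflect (Some z)) a, b\<rangle>
    = of_real (2 * (1 - (cmod z)\<^sup>2)) * \<langle>resolvent U z a, resolvent U z b\<rangle>"
proof -
  note V = uinv_unitary[OF U] and zT = disc_in_Te[OF z]
  have cz: "cnj z \<in> Te" using zT by simp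
  let ?y = "resolvent U z a" and ?w = "resolvent U z b"
  have y: "?y \<in> carrier H" "U ?y \<in> carrier H" and w: "?w \<in> carrier H" "U ?w \<in> carrier H"
    using resolvent_closed[OF U zT] hunitary_closed[OF U] a b by auto
  have r: "\<langle>cayley_ext U (reflect (Some z)) a, b\<rangle> = - \<langle>a, cayley H U z b\<rangle>"
  proof -
    have "\<langle>cayley_ext U (reflect (Some z)) a, b\<rangle> = - \<langle>cayley H (uinv U) (cnj z) a, b\<rangle>"
      using a b cayley_closed[OF V cz a] 
      by (simp add: reflect_chart cayley_ext_chart_inf[OF U cz a] inner_simps)
    also have "\<langle>cayley H (uinv U) (cnj z) a, b\<rangle> = cnj \<langle>b, cayley H (uinv U) (cnj z) a\<rangle>"
      using inner_commute cayley_closed[OF V cz a] b by blast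
    also have "\<langle>b, cayley H (uinv U) (cnj z) a\<rangle> = \<langle>cayley H U z b, a\<rangle>"
      using cayley_adjoint[OF U zT b a] by simp
    also have "cnj \<langle>cayley H U z b, a\<rangle> = \<langle>a, cayley H U z b\<rangle>"
      using inner_commute[OF a cayley_closed[OF U zT b]] by simp
    finally show ?thesis .
  qed
  define p q s where "p = \<langle>?y, ?w\<rangle>" and "q = \<langle>?y, U ?w\<rangle>" and "s = \<langle>U ?y, ?w\<rangle>"
  have UU: "\<langle>U ?y, U ?w\<rangle> = p" using hunitary_inner[OF U y(1) w(1)] by (simp add: p_def)
  have yb: "\<langle>?y, b\<rangle> = p - cnj z * q" and Uyb: "\<langle>U ?y, b\<rangle> = s - cnj z * p"
    using resolvent_inner(2)[OF U zT b y(1)] resolvent_inner(2)[OF U zT b y(2)] UU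
    by (simp_all add: p_def q_def s_def)
  have aw: "\<langle>a, ?w\<rangle> = p - z * s"
    using resolvent_inner(1)[OF U zT a w(1)] by (simp add: p_def s_def)
  have ab: "\<langle>a, b\<rangle> = (p - cnj z * q) - z * (s - cnj z * p)"
    using resolvent_inner(1)[OF U zT a b] by (simp add: yb Uyb)
  have "\<langle>cayley_ext U (Some z) a, b\<rangle> - \<langle>cayley_ext U (reflect (Some z)) a, b\<rangle>
      = 2 * \<langle>?y, b\<rangle> + 2 * \<langle>a, ?w\<rangle> - 2 * \<langle>a, b\<rangle>"
    unfolding r by (simp add: cayley_inner[OF U zT] a b)
  also have "\<dots> = 2 * (1 - z * cnj z) * p" unfolding yb aw ab by (simp add: algebra_simps)
  also have "z * cnj z = of_real ((cmod z)\<^sup>2)" by (simp add: complex_norm_square del: of_real_power)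
  finally show ?thesis by (simp add: p_def)
qed

subsection \<open>Power series\<close>

lemma funpow_closed: "\<lbrakk>hunitary H U; x \<in> carrier H\<rbrakk> \<Longrightarrow> (U ^^ n) x \<in> carrier H"
  by (induction n) (auto simp: hunitary_closed)

lemma funpow_norm: "\<lbrakk>hunitary H U; x \<in> carrier H\<rbrakk> \<Longrightarrow> \<parallel>(U ^^ n) x\<parallel> = \<parallel>x\<parallel>"
  by (induction n) (auto simp: hunitary_norm funpow_closed)

text \<open>The partial sums of the Neumann series differ from the resolvent \<open>T\<close> by \<open>z\<^sup>n U\<^sup>n T\<close>.\<close>

lemma resolvent_sums:
  assumes U: "hunitary H U" and z: "cmod z < 1" and x: "x \<in> carrier H" and y: "y \<in> carrier H"
  shows "(\<lambda>n. \<langle>(U ^^ n) x, y\<rangle> * z ^ n) sums \<langle>resolvent U z x, y\<rangle>"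
proof -
  note zT = disc_in_Te[OF z] and lin = hlinearD[OF hunitary_linear[OF U]] and cl = hunitary_closed[OF U]
  let ?t = "resolvent U z x"
  have t: "?t \<in> carrier H" using resolvent_closed[OF U zT x] .
  have step: "(U ^^ n) ?t \<ominus> z \<odot> (U ^^ Suc n) ?t = (U ^^ n) x" for n
  proof (induction n)
    case 0 show ?case using resolvent_eq[OF U zT x] by simp
  next
    case (Suc n)
    have c: "(U ^^ n) ?t \<in> carrier H" "(U ^^ Suc n) ?t \<in> carrier H"
      using funpow_closed[OF U t, of n] cl by auto
    have "(U ^^ Suc n) ?t \<ominus> z \<odot> (U ^^ Suc (Suc n)) ?t = U ((U ^^ n) ?t \<ominus> z \<odot> (U ^^ Suc n) ?t)"
      using c by (simp add: lin)
    then show ?case using Suc.IH by simp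
  qed
  have partial: "(\<Sum>k<n. \<langle>(U ^^ k) x, y\<rangle> * z ^ k) = \<langle>?t, y\<rangle> - z ^ n * \<langle>(U ^^ n) ?t, y\<rangle>" for n
  proof (induction n)
    case (Suc n)
    have c: "(U ^^ n) ?t \<in> carrier H" "(U ^^ Suc n) ?t \<in> carrier H"
      using funpow_closed[OF U t, of n] cl by auto
    have eq: "\<langle>(U ^^ n) x, y\<rangle> = \<langle>(U ^^ n) ?t, y\<rangle> - z * \<langle>(U ^^ Suc n) ?t, y\<rangle>"
      unfolding step[of n, symmetric] using c y by (simp add: inner_simps)
    show ?case unfolding sum.lessThan_Suc Suc.IH eq by (simp add: algebra_simps)
  qed simp
  have "(\<lambda>n. z ^ n * \<langle>(U ^^ n) ?t, y\<rangle>) \<longlonglongrightarrow> 0"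
  proof (rule Lim_null_comparison)
    show "\<forall>\<^sub>F n in sequentially. norm (z ^ n * \<langle>(U ^^ n) ?t, y\<rangle>) \<le> cmod z ^ n * (\<parallel>?t\<parallel> * \<parallel>y\<parallel>)"
    proof (intro always_eventually allI)
      fix n
      have "cmod \<langle>(U ^^ n) ?t, y\<rangle> \<le> \<parallel>?t\<parallel> * \<parallel>y\<parallel>"
        using Cauchy_Schwarz[OF funpow_closed[OF U t, of n] y] funpow_norm[OF U t, of n] by simp
      then show "norm (z ^ n * \<langle>(U ^^ n) ?t, y\<rangle>) \<le> cmod z ^ n * (\<parallel>?t\<parallel> * \<parallel>y\<parallel>)"
        by (simp add: norm_mult norm_power mult_left_mono)
    qed
    show "(\<lambda>n. cmod z ^ n * (\<parallel>?t\<parallel> * \<parallel>y\<parallel>)) \<longlonglongrightarrow> 0"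
      using tendsto_mult_right[OF LIMSEQ_realpow_zero[of "cmod z"], of "\<parallel>?t\<parallel> * \<parallel>y\<parallel>"] z by simp
  qed
  then have "(\<lambda>n. \<langle>?t, y\<rangle> - z ^ n * \<langle>(U ^^ n) ?t, y\<rangle>) \<longlonglongrightarrow> \<langle>?t, y\<rangle> - 0" by (intro tendsto_intros)
  then show ?thesis by (simp add: sums_def partial)
qed

lemma cayley_sums:
  assumes U: "hunitary H U" and z: "cmod z < 1" and x: "x \<in> carrier H" and y: "y \<in> carrier H"
  shows "(\<lambda>n. (if n = 0 then 1 else 2) * \<langle>(U ^^ n) x, y\<rangle> * z ^ n) sums \<langle>cayley H U z x, y\<rangle>"
proof -
  have "(\<lambda>n. 2 * (\<langle>(U ^^ n) x, y\<rangle> * z ^ n) - (if n = 0 then \<langle>x, y\<rangle> else 0))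
      sums (2 * \<langle>resolvent U z x, y\<rangle> - \<langle>x, y\<rangle>)"
    by (intro sums_diff sums_mult resolvent_sums assms sums_single[where f = "\<lambda>_. \<langle>x, y\<rangle>" and i = 0])
  moreover have "2 * (\<langle>(U ^^ n) x, y\<rangle> * z ^ n) - (if n = 0 then \<langle>x, y\<rangle> else 0)
      = (if n = 0 then 1 else 2) * \<langle>(U ^^ n) x, y\<rangle> * z ^ n" for n
    by (cases n) auto
  ultimately show ?thesis using cayley_inner(1)[OF U disc_in_Te[OF z] x y] by simp
qed

subsection \<open>Joint holomorphy\<close>

lemma resolvent_difference:
  assumes U: "hunitary H U" and z: "z \<in> Te" and w: "w \<in> Te" and x: "x \<in> carrier H"
  shows "resolvent U z x \<ominus> resolvent U w x = (z - w) \<odot> resolvent U z (U (resolvent U w x))"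
proof -
  let ?t = "resolvent U w x"
  have t: "?t \<in> carrier H" "U ?t \<in> carrier H"
    using resolvent_closed[OF U w x] hunitary_closed[OF U] by auto
  have "resolvent U z x = ?t \<oplus> (z - w) \<odot> resolvent U z (U ?t)"
  proof (rule resolvent_unique[OF U z])
    let ?s = "resolvent U z (U ?t)"
    have s: "?s \<in> carrier H" "U ?s \<in> carrier H"
      using resolvent_closed[OF U z t(2)] hunitary_closed[OF U] by auto
    note lin = hlinearD[OF hunitary_linear[OF U]]
    show "(?t \<oplus> (z - w) \<odot> ?s) \<ominus> z \<odot> U (?t \<oplus> (z - w) \<odot> ?s) = x"
      using s t x
      by (auto intro!: vector_eqI simp: inner_simps lin resolvent_inner(1)[OF U w x]
          resolvent_inner(1)[OF U z t(2)] algebra_simps)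
  qed (use t resolvent_closed[OF U z] in auto)
  then show ?thesis
    using t resolvent_closed[OF U z t(2)] by (auto intro!: vector_eqI simp: inner_simps)
qed

lemma resolvent_Lipschitz:
  assumes U: "hunitary H U" and w: "w \<in> Te"
  obtains d K where "d > 0" "K > 0" "\<And>z. cmod (z - w) < d \<Longrightarrow> z \<in> Te"
    "\<And>z x. \<lbrakk>cmod (z - w) < d; x \<in> carrier H\<rbrakk>
      \<Longrightarrow> \<parallel>resolvent U z x \<ominus> resolvent U w x\<parallel> \<le> K * cmod (z - w) * \<parallel>x\<parallel>"
proof -
  define d where "d = \<bar>1 - cmod w\<bar> / 2"
  have d: "d > 0" using w by (simp add: d_def Te_def)
  have far: "d \<le> \<bar>1 - cmod z\<bar>" if "cmod (z - w) < d" for z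
    using that norm_triangle_ineq3[of z w] unfolding d_def by argo
  have zT: "z \<in> Te" if "cmod (z - w) < d" for z
    using far[OF that] d by (auto simp: Te_def)
  have T: "\<parallel>resolvent U z x\<parallel> \<le> \<parallel>x\<parallel> / d" if z: "cmod (z - w) < d" and x: "x \<in> carrier H" for z x
  proof -
    have "d * \<parallel>resolvent U z x\<parallel> \<le> \<bar>1 - cmod z\<bar> * \<parallel>resolvent U z x\<parallel>"
      using far[OF z] norm_ge_0[OF resolvent_closed[OF U zT[OF z] x]] by (rule mult_right_mono)
    also have "\<dots> \<le> \<parallel>x\<parallel>" by (rule resolvent_norm[OF U zT[OF z] x])
    finally show ?thesis using d by (simp add: field_simps)
  qed
  have "\<parallel>resolvent U z x \<ominus> resolvent U w x\<parallel> \<le> (1 / d\<^sup>2) * cmod (z - w) * \<parallel>x\<parallel>"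
    if z: "cmod (z - w) < d" and x: "x \<in> carrier H" for z x
  proof -
    let ?t = "resolvent U w x"
    have t: "?t \<in> carrier H" "U ?t \<in> carrier H"
      using resolvent_closed[OF U w x] hunitary_closed[OF U] by auto
    have "\<parallel>resolvent U z (U ?t)\<parallel> \<le> \<parallel>?t\<parallel> / d"
      using T[OF z t(2)] hunitary_norm[OF U t(1)] by simp
    also have "\<dots> \<le> \<parallel>x\<parallel> / d / d" using T[of w x] x d by (intro divide_right_mono) auto
    finally have "cmod (z - w) * \<parallel>resolvent U z (U ?t)\<parallel> \<le> cmod (z - w) * (\<parallel>x\<parallel> / d / d)"
      by (rule mult_left_mono) simp
    then show ?thesis
      unfolding resolvent_difference[OF U zT[OF z] w x]
      using norm_scale[OF resolvent_closed[OF U zT[OF z] t(2)]] by (simp add: power2_eq_square mult.commute)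
  qed
  then show thesis using that[of d "1 / d\<^sup>2"] d zT by simp
qed

lemma cayley_Lipschitz:
  assumes U: "hunitary H U" and w: "w \<in> Te"
  obtains d K where "d > 0" "K > 0" "\<And>z. cmod (z - w) < d \<Longrightarrow> z \<in> Te"
    "\<And>z x. \<lbrakk>cmod (z - w) < d; x \<in> carrier H\<rbrakk>
      \<Longrightarrow> \<parallel>cayley H U z x \<ominus> cayley H U w x\<parallel> \<le> K * cmod (z - w) * \<parallel>x\<parallel>"
proof -
  obtain d K where dK: "d > 0" "K > 0" "\<And>z. cmod (z - w) < d \<Longrightarrow> z \<in> Te"
    "\<And>z x. \<lbrakk>cmod (z - w) < d; x \<in> carrier H\<rbrakk>
      \<Longrightarrow> \<parallel>resolvent U z x \<ominus> resolvent U w x\<parallel> \<le> K * cmod (z - w) * \<parallel>x\<parallel>"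
    using resolvent_Lipschitz[OF U w] by metis
  have "\<parallel>cayley H U z x \<ominus> cayley H U w x\<parallel> \<le> (2 * K) * cmod (z - w) * \<parallel>x\<parallel>"
    if z: "cmod (z - w) < d" and x: "x \<in> carrier H" for z x
  proof -
    note T = resolvent_closed[OF U dK(3)[OF z] x] resolvent_closed[OF U w x]
    have "cayley H U z x \<ominus> cayley H U w x = 2 \<odot> (resolvent U z x \<ominus> resolvent U w x)"
      using T x by (auto intro!: vector_eqI simp: cayley_resolvent[OF U dK(3)[OF z]] cayley_resolvent[OF U w] inner_simps)
    then show ?thesis using dK(4)[OF z x] T by (simp add: norm_scale)
  qed
  then show thesis using that[of d "2 * K"] dK by simp
qed

lemma cayley_field_derivative:
  assumes U: "hunitary H U" and w: "w \<in> Te" and x: "x \<in> carrier H" and y: "y \<in> carrier H"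
  shows "((\<lambda>z. \<langle>cayley H U z x, y\<rangle>) has_field_derivative
    2 * \<langle>resolvent U w (U (resolvent U w x)), y\<rangle>) (at w)"
proof -
  obtain d K where dK: "d > 0" "K > 0" "\<And>z. cmod (z - w) < d \<Longrightarrow> z \<in> Te"
    "\<And>z x. \<lbrakk>cmod (z - w) < d; x \<in> carrier H\<rbrakk>
      \<Longrightarrow> \<parallel>resolvent U z x \<ominus> resolvent U w x\<parallel> \<le> K * cmod (z - w) * \<parallel>x\<parallel>"
    using resolvent_Lipschitz[OF U w] by metis
  define v where "v = U (resolvent U w x)"
  have t: "resolvent U w x \<in> carrier H" and v: "v \<in> carrier H"
    using resolvent_closed[OF U w x] hunitary_closed[OF U] by (auto simp: v_def)
  have "((\<lambda>z. \<langle>resolvent U z v, y\<rangle> - \<langle>resolvent U w v, y\<rangle>) \<longlongrightarrow> 0) (at w)"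
  proof (rule Lim_null_comparison)
    show "\<forall>\<^sub>F z in at w. norm (\<langle>resolvent U z v, y\<rangle> - \<langle>resolvent U w v, y\<rangle>) \<le> K * cmod (z - w) * \<parallel>v\<parallel> * \<parallel>y\<parallel>"
      unfolding eventually_at
    proof (intro exI[of _ d] conjI ballI impI dK(1))
      fix z assume "z \<noteq> w \<and> dist z w < d"
      then have z: "cmod (z - w) < d" by (simp add: dist_norm)
      note T = resolvent_closed[OF U dK(3)[OF z] v] resolvent_closed[OF U w v]
      have "\<langle>resolvent U z v, y\<rangle> - \<langle>resolvent U w v, y\<rangle> = \<langle>resolvent U z v \<ominus> resolvent U w v, y\<rangle>"
        using T y by (simp add: inner_simps)
      then have "norm (\<langle>resolvent U z v, y\<rangle> - \<langle>resolvent U w v, y\<rangle>) \<le> \<parallel>resolvent U z v \<ominus> resolvent U w v\<parallel> * \<parallel>y\<parallel>"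
        using Cauchy_Schwarz[OF minus_closed[OF T] y] by simp
      also have "\<dots> \<le> K * cmod (z - w) * \<parallel>v\<parallel> * \<parallel>y\<parallel>"
        using dK(4)[OF z v] norm_ge_0[OF y] by (rule mult_right_mono)
      finally show "norm (\<langle>resolvent U z v, y\<rangle> - \<langle>resolvent U w v, y\<rangle>) \<le> K * cmod (z - w) * \<parallel>v\<parallel> * \<parallel>y\<parallel>" .
    qed
    have "((\<lambda>z. K * cmod (z - w) * \<parallel>v\<parallel> * \<parallel>y\<parallel>) \<longlongrightarrow> K * cmod (w - w) * \<parallel>v\<parallel> * \<parallel>y\<parallel>) (at w)"
      by (intro tendsto_intros)
    then show "((\<lambda>z. K * cmod (z - w) * \<parallel>v\<parallel> * \<parallel>y\<parallel>) \<longlongrightarrow> 0) (at w)" by simp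
  qed
  then have lim: "((\<lambda>z. 2 * \<langle>resolvent U z v, y\<rangle>) \<longlongrightarrow> 2 * \<langle>resolvent U w v, y\<rangle>) (at w)"
    by (intro tendsto_mult_left) (simp add: LIM_zero_iff)
  show ?thesis
    unfolding has_field_derivative_iff v_def[symmetric]
  proof (rule Lim_transform_within_open[OF lim open_Te w])
    fix z assume z: "z \<in> Te" "z \<noteq> w"
    note T = resolvent_closed[OF U z(1) x] t resolvent_closed[OF U z(1) v]
    have "\<langle>cayley H U z x, y\<rangle> - \<langle>cayley H U w x, y\<rangle> = 2 * \<langle>resolvent U z x \<ominus> resolvent U w x, y\<rangle>"
      using T x y by (simp add: cayley_inner[OF U z(1)] cayley_inner[OF U w] inner_simps)
    also have "\<dots> = 2 * ((z - w) * \<langle>resolvent U z v, y\<rangle>)"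
      unfolding resolvent_difference[OF U z(1) w x] v_def[symmetric] using T y by (simp add: inner_simps)
    finally show "2 * \<langle>resolvent U z v, y\<rangle> = (\<langle>cayley H U z x, y\<rangle> - \<langle>cayley H U w x, y\<rangle>) / (z - w)"
      using z by simp
  qed
qed

text \<open>Write \<open>f\<close> for the function and \<open>g\<close> for the sum of its two sections through \<open>(w1, w2)\<close>, which have
  complex derivatives. The increment of \<open>f - g\<close> is a mixed second difference, an inner product of two
  increments that are each Lipschitz in norm, so it is of second order.\<close>

lemma cayley2_holomorphic:
  assumes U1: "hunitary H U1" and U2: "hunitary H U2" and x: "x \<in> carrier H"
  shows "holomorphic2_on (\<lambda>z1 z2. \<langle>cayley H U1 z1 (cayley H U2 z2 x), x\<rangle>) (Te \<times> Te)"
  unfolding holomorphic2_on_def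
proof (clarify)
  fix w1 w2 assume w: "w1 \<in> Te" "w2 \<in> Te"
  note V1 = uinv_unitary[OF U1]
  define a b where "a = cayley H U2 w2 x" and "b = cayley H (uinv U1) (cnj w1) x"
  have ab: "a \<in> carrier H" "b \<in> carrier H"
    using cayley_closed[OF U2 w(2) x] cayley_closed[OF V1 _ x] w by (auto simp: a_def b_def)
  define D1 where "D1 = 2 * \<langle>resolvent U1 w1 (U1 (resolvent U1 w1 a)), x\<rangle>"
  define D2 where "D2 = 2 * \<langle>resolvent U2 w2 (U2 (resolvent U2 w2 x)), b\<rangle>"
  obtain d1 K1 where dK1: "d1 > 0" "K1 > 0" "\<And>z. cmod (z - cnj w1) < d1 \<Longrightarrow> z \<in> Te"
    "\<And>z x. \<lbrakk>cmod (z - cnj w1) < d1; x \<in> carrier H\<rbrakk>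
      \<Longrightarrow> \<parallel>cayley H (uinv U1) z x \<ominus> cayley H (uinv U1) (cnj w1) x\<parallel> \<le> K1 * cmod (z - cnj w1) * \<parallel>x\<parallel>"
    using cayley_Lipschitz[OF V1, of "cnj w1"] w by auto
  obtain d2 K2 where dK2: "d2 > 0" "K2 > 0" "\<And>z. cmod (z - w2) < d2 \<Longrightarrow> z \<in> Te"
    "\<And>z x. \<lbrakk>cmod (z - w2) < d2; x \<in> carrier H\<rbrakk>
      \<Longrightarrow> \<parallel>cayley H U2 z x \<ominus> cayley H U2 w2 x\<parallel> \<le> K2 * cmod (z - w2) * \<parallel>x\<parallel>"
    using cayley_Lipschitz[OF U2 w(2)] by auto
  define f where "f = (\<lambda>(z1, z2). \<langle>cayley H U1 z1 (cayley H U2 z2 x), x\<rangle>)"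
  define g where "g = (\<lambda>p :: complex \<times> complex. \<langle>cayley H U1 (fst p) a, x\<rangle> + \<langle>cayley H U2 (snd p) x, b\<rangle>)"
  let ?D = "\<lambda>(h1, h2). D1 * h1 + D2 * h2"
  have "((\<lambda>z. \<langle>cayley H U1 z a, x\<rangle>) has_derivative (\<lambda>h. D1 * h)) (at w1)"
    using cayley_field_derivative[OF U1 w(1) ab(1) x]
    by (simp add: has_field_derivative_def D1_def)
  then have d1: "((\<lambda>p. \<langle>cayley H U1 (fst p) a, x\<rangle>) has_derivative (\<lambda>h. D1 * fst h)) (at (w1, w2))"
    using has_derivative_compose[OF has_derivative_fst[OF has_derivative_ident[of "at (w1, w2)"]]] by simp
  have "((\<lambda>z. \<langle>cayley H U2 z x, b\<rangle>) has_derivative (\<lambda>h. D2 * h)) (at w2)"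
    using cayley_field_derivative[OF U2 w(2) x ab(2)]
    by (simp add: has_field_derivative_def D2_def)
  then have d2: "((\<lambda>p. \<langle>cayley H U2 (snd p) x, b\<rangle>) has_derivative (\<lambda>h. D2 * snd h)) (at (w1, w2))"
    using has_derivative_compose[OF has_derivative_snd[OF has_derivative_ident[of "at (w1, w2)"]]] by simp
  have "(g has_derivative (\<lambda>h. D1 * fst h + D2 * snd h)) (at (w1, w2))"
    unfolding g_def by (rule has_derivative_add[OF d1 d2])
  then have dg: "(g has_derivative ?D) (at (w1, w2))" by (simp add: case_prod_unfold)
  define r where "r p = f p - g p" for p
  define M where "M = K1 * K2 * \<parallel>x\<parallel>\<^sup>2"
  \<comment> \<open>The constant \<open>g (w1, w2)\<close> counts \<open>f (w1, w2)\<close> twice; it cancels in the increment of \<open>r\<close>.\<close>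
  have rdiff: "norm (r p - r (w1, w2)) \<le> M * (norm (p - (w1, w2)))\<^sup>2"
    if p: "dist p (w1, w2) < min d1 d2" for p
  proof -
    obtain z1 z2 where pz: "p = (z1, z2)" by (cases p)
    have n: "cmod (z1 - w1) \<le> norm (p - (w1, w2))" "cmod (z2 - w2) \<le> norm (p - (w1, w2))"
      unfolding pz using norm_fst_le[of "z1 - w1" "z2 - w2"] norm_snd_le[of "z2 - w2" "z1 - w1"] by simp_all
    then have z: "cmod (cnj z1 - cnj w1) < d1" "cmod (z2 - w2) < d2"
      using p complex_mod_cnj[of "z1 - w1"] by (simp_all add: dist_norm)
    have zT: "z1 \<in> Te" "z2 \<in> Te" using dK1(3)[OF z(1)] dK2(3)[OF z(2)] by simp_all
    define y b' where "y = cayley H U2 z2 x" and "b' = cayley H (uinv U1) (cnj z1) x"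
    have c: "y \<in> carrier H" "b' \<in> carrier H"
      using cayley_closed[OF U2 zT(2) x] cayley_closed[OF V1 _ x] zT by (auto simp: y_def b'_def)
    have "r p - r (w1, w2) = \<langle>y, b'\<rangle> - \<langle>a, b'\<rangle> - \<langle>y, b\<rangle> + \<langle>a, b\<rangle>"
      using cayley_adjoint[OF U1 zT(1) c(1) x] cayley_adjoint[OF U1 zT(1) ab(1) x]
        cayley_adjoint[OF U1 w(1) ab(1) x]
      by (simp add: pz r_def f_def g_def a_def[symmetric] y_def[symmetric] b_def[symmetric] b'_def[symmetric])
    also have "\<dots> = \<langle>y \<ominus> a, b' \<ominus> b\<rangle>" using c ab by (simp add: inner_simps)
    finally have "norm (r p - r (w1, w2)) \<le> \<parallel>y \<ominus> a\<parallel> * \<parallel>b' \<ominus> b\<parallel>"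
      using Cauchy_Schwarz c ab by simp
    also have "\<dots> \<le> (K2 * norm (p - (w1, w2)) * \<parallel>x\<parallel>) * (K1 * norm (p - (w1, w2)) * \<parallel>x\<parallel>)"
    proof (rule mult_mono)
      show "\<parallel>y \<ominus> a\<parallel> \<le> K2 * norm (p - (w1, w2)) * \<parallel>x\<parallel>"
        using dK2(4)[OF z(2) x] n(2) dK2(2) norm_ge_0[OF x] unfolding y_def a_def
        by (elim order_trans) (intro mult_right_mono mult_left_mono; simp)
      have "cmod (cnj z1 - cnj w1) \<le> norm (p - (w1, w2))"
        using n(1) complex_mod_cnj[of "z1 - w1"] by simp
      then show "\<parallel>b' \<ominus> b\<parallel> \<le> K1 * norm (p - (w1, w2)) * \<parallel>x\<parallel>"
        using dK1(4)[OF z(1) x] dK1(2) norm_ge_0[OF x] unfolding b'_def b_def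
        by (elim order_trans) (intro mult_right_mono mult_left_mono; simp)
    qed (use dK2(2) norm_ge_0 x c ab in auto)
    also have "\<dots> = M * (norm (p - (w1, w2)))\<^sup>2" by (simp add: M_def power2_eq_square mult_ac)
    finally show ?thesis .
  qed
  have "(r has_derivative (\<lambda>_. 0)) (at (w1, w2))"
    unfolding has_derivative_iff_norm
  proof
    show "((\<lambda>p. norm (r p - r (w1, w2) - 0) / norm (p - (w1, w2))) \<longlongrightarrow> 0) (at (w1, w2))"
    proof (rule Lim_null_comparison)
      show "\<forall>\<^sub>F p in at (w1, w2). norm (norm (r p - r (w1, w2) - 0) / norm (p - (w1, w2)))
          \<le> M * norm (p - (w1, w2))"
        unfolding eventually_at
      proof (intro exI[of _ "min d1 d2"] conjI ballI impI)
        fix p assume p: "p \<noteq> (w1, w2) \<and> dist p (w1, w2) < min d1 d2"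
        then have pos: "norm (p - (w1, w2)) > 0" by simp
        have "norm (r p - r (w1, w2)) \<le> M * norm (p - (w1, w2)) * norm (p - (w1, w2))"
          using rdiff[of p] p by (simp add: power2_eq_square mult.assoc)
        then show "norm (norm (r p - r (w1, w2) - 0) / norm (p - (w1, w2))) \<le> M * norm (p - (w1, w2))"
          using pos by (simp add: divide_le_eq)
      qed (use dK1 dK2 in auto)
      have "((\<lambda>p. M * norm (p - (w1, w2))) \<longlongrightarrow> M * norm ((w1, w2) - (w1, w2))) (at (w1, w2))"
        by (intro tendsto_intros)
      then show "((\<lambda>p. M * norm (p - (w1, w2))) \<longlongrightarrow> 0) (at (w1, w2))" by simp
    qed
  qed simp
  then have "((\<lambda>p. r p + g p) has_derivative (\<lambda>h. 0 + ?D h)) (at (w1, w2))"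
    by (rule has_derivative_add[OF _ dg])
  then have "(f has_derivative ?D) (at (w1, w2))" by (simp add: r_def)
  then have "(f has_derivative ?D) (at (w1, w2) within Te \<times> Te)" by (rule has_derivative_at_withinI)
  then show "\<exists>a b. ((\<lambda>(z1, z2). \<langle>cayley H U1 z1 (cayley H U2 z2 x), x\<rangle>) has_derivative
      (\<lambda>(h1, h2). a * h1 + b * h2)) (at (w1, w2) within Te \<times> Te)"
    unfolding f_def by blast
qed

end

section \<open>Trigonometric moments in one variable\<close>

lemma power_series_coefficient:
  fixes g :: "complex \<Rightarrow> complex"
  assumes "\<And>z. cmod z < 1 \<Longrightarrow> (\<lambda>n. a n * z ^ n) sums g z"
  shows "(deriv ^^ n) g 0 / fact n = a n"
proof -
  have "\<forall>\<^sub>F u in nhds 0. (\<lambda>n. fps_nth (Abs_fps a) n * u ^ n) sums g u"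
    using assms eventually_nhds_in_open[of "ball 0 1" "0 :: complex"]
    by (auto elim!: eventually_mono)
  then have "g has_fps_expansion Abs_fps a" by (rule has_fps_expansionI)
  then show ?thesis using fps_nth_fps_expansion by fastforce
qed

text \<open>Parametrised over the circle of radius \<open>r\<close>, this is Cauchy's formula for the \<open>k\<close>-th derivative at
  the origin if \<open>k \<ge> 0\<close>, and the integral of a holomorphic function if \<open>k < 0\<close>.\<close>

lemma circle_coefficient:
  fixes g :: "complex \<Rightarrow> complex"
  assumes g: "\<And>z. cmod z < 1 \<Longrightarrow> (\<lambda>n. a n * z ^ n) sums g z" and r: "0 < r" "r < 1"
  shows "((\<lambda>t. g (of_real r * cis (2 * pi * t)) * cis (- (2 * pi * of_int k * t)))
    has_integral (if k < 0 then 0 else a (nat k) * of_real r ^ nat k)) {0..1}"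
proof -
  have hol: "g holomorphic_on ball 0 1"
    by (rule power_series_holomorphic[of _ _ a]) (use g in \<open>simp add: dist_norm\<close>)
  have sub: "cball 0 r \<subseteq> ball (0::complex) 1" using r by auto
  have hol_c: "g holomorphic_on cball 0 r" and hol_b: "g holomorphic_on ball 0 r"
    using hol sub ball_subset_cball by (blast intro: holomorphic_on_subset)+
  have cont: "continuous_on (cball 0 r) g" by (rule holomorphic_on_imp_continuous_on[OF hol_c])
  define e where "e t = cis (2 * pi * t)" for t
  have e: "circlepath 0 r t = of_real r * e t"
    "vector_derivative (circlepath 0 r) (at t) = 2 * pi * \<i> * r * e t" for t
    by (simp add: circlepath e_def cis_conv_exp mult_ac)
      (simp add: vector_derivative_circlepath e_def cis_conv_exp mult_ac)
  have e0: "e t \<noteq> 0" for t by (simp add: e_def)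
  have e_pow: "e t ^ n = cis (2 * pi * real n * t)" for t n
    unfolding e_def Complex.DeMoivre by (simp add: mult_ac)
  show ?thesis
  proof (cases "k < 0")
    case False
    define n where "n = nat k"
    have k: "k = int n" using False by (simp add: n_def)
    have "((\<lambda>u. g u / (u - 0) ^ Suc n) has_contour_integral ((2 * pi * \<i>) / fact n * (deriv ^^ n) g 0)) (circlepath 0 r)"
      by (rule Cauchy_has_contour_integral_higher_derivative_circlepath[OF cont hol_b]) (use r in simp)
    also have "(2 * pi * \<i>) / fact n * (deriv ^^ n) g 0 = 2 * pi * \<i> * a n"
    proof -
      have "(deriv ^^ n) g 0 = fact n * a n"
        using power_series_coefficient[of a g n, OF g] by (simp add: field_simps)
      then show ?thesis by simp
    qed
    finally have "((\<lambda>t. g (of_real r * e t) / (of_real r * e t) ^ Suc n * (2 * pi * \<i> * r * e t))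
        has_integral 2 * pi * \<i> * a n) {0..1}"
      unfolding has_contour_integral e(2) unfolding e(1) by simp
    then have "((\<lambda>t. (of_real r ^ n / (2 * pi * \<i>)) * (g (of_real r * e t) / (of_real r * e t) ^ Suc n * (2 * pi * \<i> * r * e t)))
        has_integral (of_real r ^ n / (2 * pi * \<i>)) * (2 * pi * \<i> * a n)) {0..1}"
      by (rule has_integral_mult_right)
    moreover have "(of_real r ^ n / (2 * pi * \<i>)) * (g (of_real r * e t) / (of_real r * e t) ^ Suc n * (2 * pi * \<i> * r * e t))
        = g (of_real r * cis (2 * pi * t)) * cis (- (2 * pi * of_int k * t))" for t
    proof -
      have "cis (- (2 * pi * of_int k * t)) = inverse (e t ^ n)" by (simp add: k e_pow)
      then show ?thesis
        using r e0[of t] unfolding e_def[symmetric] by (simp add: field_simps)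
    qed
    ultimately show ?thesis using False r by (simp add: n_def mult.commute)
  next
    case True
    define m where "m = nat (- k) - 1"
    have k: "k = - int (Suc m)" using True by (simp add: m_def)
    have "((\<lambda>u. g u * u ^ m) has_contour_integral 0) (circlepath 0 r)"
      by (rule Cauchy_theorem_convex_simple[of _ "cball 0 r"])
        (use r hol_c in \<open>auto intro!: holomorphic_intros\<close>)
    then have "((\<lambda>t. g (of_real r * e t) * (of_real r * e t) ^ m * (2 * pi * \<i> * r * e t)) has_integral 0) {0..1}"
      unfolding has_contour_integral e(2) unfolding e(1) by simp
    then have "((\<lambda>t. inverse (of_real r ^ Suc m * (2 * pi * \<i>)) * (g (of_real r * e t) * (of_real r * e t) ^ m * (2 * pi * \<i> * r * e t)))
        has_integral inverse (of_real r ^ Suc m * (2 * pi * \<i>)) * 0) {0..1}"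
      by (rule has_integral_mult_right)
    moreover have "inverse (of_real r ^ Suc m * (2 * pi * \<i>)) * (g (of_real r * e t) * (of_real r * e t) ^ m * (2 * pi * \<i> * r * e t))
        = g (of_real r * cis (2 * pi * t)) * cis (- (2 * pi * of_int k * t))" for t
    proof -
      have "cis (- (2 * pi * of_int k * t)) = e t ^ Suc m" unfolding e_pow
        by (rule arg_cong[of _ _ cis]) (simp add: k algebra_simps)
      then show ?thesis
        using r e0[of t] unfolding e_def[symmetric] by (simp add: field_simps)
    qed
    ultimately show ?thesis using True by simp
  qed
qed

text \<open>For \<open>\<phi> z = \<integral> (1 + z \<zeta>) / (1 - z \<zeta>) d\<mu>(\<zeta>)\<close> the numbers \<open>\<gamma> k\<close> are the moments \<open>\<integral> \<zeta>\<^sup>k d\<mu>\<close>: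
  the nonnegative ones are read off from the expansion at \<open>0\<close>, the others from that at infinity.\<close>

definition has_moments :: "(complex option \<Rightarrow> complex) \<Rightarrow> (int \<Rightarrow> complex) \<Rightarrow> bool" where
  "has_moments \<phi> \<gamma> \<longleftrightarrow> (\<forall>z. cmod z < 1 \<longrightarrow>
     (\<lambda>n. (if n = 0 then 1 else 2) * \<gamma> (int n) * z ^ n) sums \<phi> (Some z) \<and>
     (\<lambda>n. (if n = 0 then 1 else 2) * \<gamma> (- int n) * z ^ n) sums (- \<phi> (chart_inf z)))"

lemma has_moments_exist:
  assumes h: "(\<lambda>z. \<phi> (Some z)) holomorphic_on Te" "(\<lambda>z. \<phi> (chart_inf z)) holomorphic_on Te"
    and z: "\<phi> (Some 0) + \<phi> None = 0"
  shows "\<exists>\<gamma>. has_moments \<phi> \<gamma>"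
proof -
  define a b where "a n = (deriv ^^ n) (\<lambda>z. \<phi> (Some z)) 0 / fact n"
    and "b n = (deriv ^^ n) (\<lambda>z. \<phi> (chart_inf z)) 0 / fact n" for n
  have sub: "ball 0 1 \<subseteq> Te" by (auto simp: Te_def)
  have a: "(\<lambda>n. a n * z ^ n) sums \<phi> (Some z)" if "cmod z < 1" for z
    using holomorphic_power_series[OF holomorphic_on_subset[OF h(1) sub], of z] that by (simp add: a_def)
  have b: "(\<lambda>n. b n * z ^ n) sums \<phi> (chart_inf z)" if "cmod z < 1" for z
    using holomorphic_power_series[OF holomorphic_on_subset[OF h(2) sub], of z] that by (simp add: b_def)
  have ab: "a 0 = - b 0" using z by (simp add: a_def b_def chart_inf_def eq_neg_iff_add_eq_0)
  define \<gamma> where "\<gamma> k = (if k = 0 then a 0 else if k > 0 then a (nat k) / 2 else - b (nat (- k)) / 2)" for k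
  have \<gamma>: "(if n = 0 then 1 else 2) * \<gamma> (int n) = a n"
    "(if n = 0 then 1 else 2) * \<gamma> (- int n) = - b n" for n
    by (auto simp: \<gamma>_def ab)
  have "has_moments \<phi> \<gamma>"
    unfolding has_moments_def \<gamma> using a b by (simp add: sums_minus)
  then show ?thesis by blast
qed

text \<open>The difference of \<open>\<phi>\<close> at a point and its reflection is twice the Poisson integral of the measure, so
  its Fourier coefficients on the circle of radius \<open>r\<close> are \<open>2 r\<^bsup>\<bar>k\<bar>\<^esup> \<gamma> k\<close>.\<close>

lemma has_moments_integral:
  assumes m: "has_moments \<phi> \<gamma>" and r: "0 < r" "r < 1"
  shows "((\<lambda>t. (\<phi> (Some (of_real r * cis (2 * pi * t))) - \<phi> (reflect (Some (of_real r * cis (2 * pi * t)))))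
      * cis (- (2 * pi * of_int k * t))) has_integral 2 * of_real r ^ nat \<bar>k\<bar> * \<gamma> k) {0..1}"
proof -
  define a where "a n = (if n = 0 then 1 else 2) * \<gamma> (int n)" for n
  define b where "b n = (if n = 0 then 1 else 2) * \<gamma> (- int n)" for n
  have a: "(\<lambda>n. a n * z ^ n) sums \<phi> (Some z)" if "cmod z < 1" for z
    using m that by (simp add: has_moments_def a_def)
  have b: "(\<lambda>n. cnj (b n) * z ^ n) sums cnj (- \<phi> (chart_inf (cnj z)))" if "cmod z < 1" for z
  proof -
    have "(\<lambda>n. b n * cnj z ^ n) sums (- \<phi> (chart_inf (cnj z)))"
      using m that unfolding has_moments_def b_def by (metis complex_mod_cnj)
    then show ?thesis using sums_cnj by fastforce
  qed
  let ?z = "\<lambda>t. of_real r * cis (2 * pi * t)"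
  have I1: "((\<lambda>t. \<phi> (Some (?z t)) * cis (- (2 * pi * of_int k * t)))
      has_integral (if k < 0 then 0 else a (nat k) * of_real r ^ nat k)) {0..1}"
    by (rule circle_coefficient[OF a r])
  have "((\<lambda>t. cnj (- \<phi> (chart_inf (cnj (?z t)))) * cis (- (2 * pi * of_int (- k) * t)))
      has_integral (if - k < 0 then 0 else cnj (b (nat (- k))) * of_real r ^ nat (- k))) {0..1}"
    by (rule circle_coefficient[OF b r])
  from iffD2[OF has_integral_cnj this] have "((\<lambda>t. cnj (cnj (- \<phi> (chart_inf (cnj (?z t)))) * cis (- (2 * pi * of_int (- k) * t))))
      has_integral cnj (if - k < 0 then 0 else cnj (b (nat (- k))) * of_real r ^ nat (- k))) {0..1}"
    by (simp only: o_def)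
  moreover have "cnj (cnj (- \<phi> (chart_inf (cnj (?z t)))) * cis (- (2 * pi * of_int (- k) * t)))
    = - \<phi> (reflect (Some (?z t))) * cis (- (2 * pi * of_int k * t))" for t
    by (simp add: reflect_chart cis_cnj)
  ultimately have I2: "((\<lambda>t. - \<phi> (reflect (Some (?z t))) * cis (- (2 * pi * of_int k * t)))
      has_integral (if k > 0 then 0 else b (nat (- k)) * of_real r ^ nat (- k))) {0..1}"
    by (cases "k > 0") simp_all
  have "(if k < 0 then 0 else a (nat k) * of_real r ^ nat k) + (if k > 0 then 0 else b (nat (- k)) * of_real r ^ nat (- k))
      = 2 * of_real r ^ nat \<bar>k\<bar> * \<gamma> k"
    by (auto simp: a_def b_def not_less)
  then show ?thesis
    using has_integral_add[OF I1 I2] by (simp add: algebra_simps)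
qed

lemma has_moments_unique:
  assumes "has_moments \<phi> \<gamma>" "has_moments \<phi> \<gamma>'" shows "\<gamma> = \<gamma>'"
proof
  fix k
  have "2 * of_real (1/2) ^ nat \<bar>k\<bar> * \<gamma> k = 2 * of_real (1/2) ^ nat \<bar>k\<bar> * \<gamma>' k"
    by (rule has_integral_unique[OF has_moments_integral has_moments_integral]) (use assms in simp_all)
  then show "\<gamma> k = \<gamma>' k" by simp
qed

lemma has_moments_determine:
  assumes m: "has_moments \<phi> \<gamma>" "has_moments \<psi> \<gamma>" and z: "z \<in> Te_inf"
  shows "\<phi> z = \<psi> z"
proof -
  have "\<phi> (Some w) = \<psi> (Some w)" "\<phi> (chart_inf w) = \<psi> (chart_inf w)" if "cmod w < 1" for w
    using m that unfolding has_moments_def by (meson sums_unique2 neg_equal_iff_equal)+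
  moreover have "\<exists>w. cmod w < 1 \<and> (z = Some w \<or> z = chart_inf w)"
  proof (cases z)
    case None
    then show ?thesis by (intro exI[of _ 0]) (simp add: chart_inf_def)
  next
    case (Some w)
    then have "cmod w \<noteq> 1" using z by (auto simp: Te_inf_def Te_def)
    show ?thesis
    proof (cases "cmod w < 1")
      case False
      then have "cmod w > 1" using \<open>cmod w \<noteq> 1\<close> by simp
      then have "cmod (inverse w) < 1" "w \<noteq> 0" by (auto simp: norm_inverse inverse_less_1_iff)
      then show ?thesis using Some by (intro exI[of _ "inverse w"]) (simp add: chart_inf_def)
    qed (use Some in blast)
  qed
  ultimately show ?thesis by blast
qed

lemma has_moments_cong:
  assumes "\<And>z. z \<in> Te_inf \<Longrightarrow> \<phi> z = \<psi> z" "has_moments \<psi> \<gamma>"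
  shows "has_moments \<phi> \<gamma>"
proof -
  have "Some w \<in> Te_inf" "chart_inf w \<in> Te_inf" if "cmod w < 1" for w
    using that by (auto simp: Te_inf_def Te_def chart_inf_def norm_inverse)
  then show ?thesis using assms by (simp add: has_moments_def)
qed

lemma has_moments_add:
  assumes "has_moments \<phi> \<gamma>" "has_moments \<psi> \<delta>"
  shows "has_moments (\<lambda>z. \<phi> z + \<psi> z) (\<lambda>k. \<gamma> k + \<delta> k)"
  unfolding has_moments_def
proof (intro allI impI conjI)
  fix z :: complex assume z: "cmod z < 1"
  note m = assms[unfolded has_moments_def, rule_format, OF z]
  show "(\<lambda>n. (if n = 0 then 1 else 2) * (\<gamma> (int n) + \<delta> (int n)) * z ^ n) sums (\<phi> (Some z) + \<psi> (Some z))"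
    "(\<lambda>n. (if n = 0 then 1 else 2) * (\<gamma> (- int n) + \<delta> (- int n)) * z ^ n) sums (- (\<phi> (chart_inf z) + \<psi> (chart_inf z)))"
    using sums_add[OF m(1)[THEN conjunct1] m(2)[THEN conjunct1]] sums_add[OF m(1)[THEN conjunct2] m(2)[THEN conjunct2]]
    by (simp_all add: algebra_simps)
qed

lemma has_moments_scale:
  assumes "has_moments \<phi> \<gamma>" shows "has_moments (\<lambda>z. c * \<phi> z) (\<lambda>k. c * \<gamma> k)"
  unfolding has_moments_def
proof (intro allI impI conjI)
  fix z :: complex assume z: "cmod z < 1"
  note m = assms[unfolded has_moments_def, rule_format, OF z]
  show "(\<lambda>n. (if n = 0 then 1 else 2) * (c * \<gamma> (int n)) * z ^ n) sums (c * \<phi> (Some z))"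
    "(\<lambda>n. (if n = 0 then 1 else 2) * (c * \<gamma> (- int n)) * z ^ n) sums (- (c * \<phi> (chart_inf z)))"
    using sums_mult[OF m[THEN conjunct1], of c] sums_mult[OF m[THEN conjunct2], of c]
    by (simp_all add: mult_ac)
qed

section \<open>Moments in two variables\<close>

lemma holomorphic2_imp_continuous:
  assumes "holomorphic2_on f S" shows "continuous_on S (\<lambda>(z, w). f z w)"
  using assms has_derivative_continuous unfolding holomorphic2_on_def continuous_on_eq_continuous_within by blast

lemma holomorphic2_imp_holomorphic:
  assumes f: "holomorphic2_on f (A \<times> B)"
  shows "w \<in> B \<Longrightarrow> (\<lambda>z. f z w) holomorphic_on A" "z \<in> A \<Longrightarrow> (\<lambda>w. f z w) holomorphic_on B"
proof -
  show "(\<lambda>z. f z w) holomorphic_on A" if w: "w \<in> B"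
    unfolding holomorphic_on_def
  proof
    fix z assume z: "z \<in> A"
    then obtain a b where d: "((\<lambda>(z, w). f z w) has_derivative (\<lambda>(h, k). a * h + b * k)) (at (z, w) within A \<times> B)"
      using f w unfolding holomorphic2_on_def by blast
    have "((\<lambda>x. (x, w)) has_derivative (\<lambda>h. (h, 0))) (at z within A)"
      by (intro derivative_eq_intros) auto
    then have "((\<lambda>x. (\<lambda>(z, w). f z w) (x, w)) has_derivative (\<lambda>h. (\<lambda>(h, k). a * h + b * k) (h, 0))) (at z within A)"
      by (rule has_derivative_in_compose) (rule has_derivative_subset[OF d], use w in auto)
    then have "((\<lambda>x. f x w) has_derivative (\<lambda>h. a * h)) (at z within A)" by simp
    then show "(\<lambda>z. f z w) field_differentiable at z within A"
      by (auto simp: field_differentiable_def has_field_derivative_def)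
  qed
  show "(\<lambda>w. f z w) holomorphic_on B" if z: "z \<in> A"
    unfolding holomorphic_on_def
  proof
    fix w assume w: "w \<in> B"
    then obtain a b where d: "((\<lambda>(z, w). f z w) has_derivative (\<lambda>(h, k). a * h + b * k)) (at (z, w) within A \<times> B)"
      using f z unfolding holomorphic2_on_def by blast
    have "((\<lambda>x. (z, x)) has_derivative (\<lambda>h. (0, h))) (at w within B)"
      by (intro derivative_eq_intros) auto
    then have "((\<lambda>x. (\<lambda>(z, w). f z w) (z, x)) has_derivative (\<lambda>h. (\<lambda>(h, k). a * h + b * k) (0, h))) (at w within B)"
      by (rule has_derivative_in_compose) (rule has_derivative_subset[OF d], use z in auto)
    then have "((\<lambda>x. f z x) has_derivative (\<lambda>h. b * h)) (at w within B)" by simp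
    then show "(\<lambda>w. f z w) field_differentiable at w within B"
      by (auto simp: field_differentiable_def has_field_derivative_def)
  qed
qed

lemma holomorphic2_add:
  assumes "holomorphic2_on f S" "holomorphic2_on g S"
  shows "holomorphic2_on (\<lambda>z w. f z w + g z w) S"
  unfolding holomorphic2_on_def
proof
  fix p assume "p \<in> S"
  then obtain a b c d where "((\<lambda>(z, w). f z w) has_derivative (\<lambda>(h, k). a * h + b * k)) (at p within S)"
    "((\<lambda>(z, w). g z w) has_derivative (\<lambda>(h, k). c * h + d * k)) (at p within S)"
    using assms unfolding holomorphic2_on_def by meson
  from has_derivative_add[OF this]
  have "((\<lambda>(z, w). f z w + g z w) has_derivative (\<lambda>(h, k). (a + c) * h + (b + d) * k)) (at p within S)"
    by (simp add: case_prod_unfold algebra_simps)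
  then show "\<exists>a b. ((\<lambda>(z, w). f z w + g z w) has_derivative (\<lambda>(h, k). a * h + b * k)) (at p within S)" by blast
qed

lemma holomorphic2_scale:
  assumes "holomorphic2_on f S" shows "holomorphic2_on (\<lambda>z w. c * f z w) S"
  unfolding holomorphic2_on_def
proof
  fix p assume "p \<in> S"
  then obtain a b where "((\<lambda>(z, w). f z w) has_derivative (\<lambda>(h, k). a * h + b * k)) (at p within S)"
    using assms unfolding holomorphic2_on_def by meson
  from has_derivative_mult_right[OF this, of c]
  have "((\<lambda>(z, w). c * f z w) has_derivative (\<lambda>(h, k). (c * a) * h + (c * b) * k)) (at p within S)"
    by (simp add: case_prod_unfold algebra_simps)
  then show "\<exists>a b. ((\<lambda>(z, w). c * f z w) has_derivative (\<lambda>(h, k). a * h + b * k)) (at p within S)" by blast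
qed

text \<open>By Morera's theorem: triangle integrals may be taken under the integral sign.\<close>

lemma holomorphic_parametric_integral:
  fixes g :: "complex \<Rightarrow> real \<Rightarrow> complex"
  assumes S: "open S" and cont: "continuous_on (S \<times> {0..1}) (\<lambda>(z, t). g z t)"
    and hol: "\<And>t. t \<in> {0..1} \<Longrightarrow> (\<lambda>z. g z t) holomorphic_on S"
  shows "(\<lambda>z. integral {0..1} (g z)) holomorphic_on S"
proof -
  define J where "J a b t = integral {0..1} (\<lambda>x. g (linepath a b x) t * (b - a))" for a b t
  have lp: "linepath a b x \<in> S" if "closed_segment a b \<subseteq> S" "x \<in> {0..1}" for a b x
    using that linepath_in_path[of x a b] by auto
  have contL: "continuous_on ({0..1} \<times> {0..1}) (\<lambda>(t, x). g (linepath a b x) t * (b - a))"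
    if "closed_segment a b \<subseteq> S" for a b
  proof -
    have "continuous_on ({0..1} \<times> {0..1}) (\<lambda>p. (\<lambda>(z, t). g z t) (linepath a b (snd p), fst p))"
      by (rule continuous_on_compose2[OF cont])
        (use lp[OF that] in \<open>auto intro!: continuous_intros simp: linepath_def\<close>)
    then show ?thesis by (simp add: case_prod_unfold continuous_on_mult_right)
  qed
  have J_int: "J a b integrable_on {0..1}" if "closed_segment a b \<subseteq> S" for a b
    using integral_continuous_on_param[of "{0..1}" 0 1 "\<lambda>t x. g (linepath a b x) t * (b - a)"] contL[OF that]
    by (intro integrable_continuous_real) (simp add: J_def[abs_def])
  have swap: "contour_integral (linepath a b) (\<lambda>z. integral {0..1} (g z)) = integral {0..1} (J a b)"
    if "closed_segment a b \<subseteq> S" for a b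
  proof -
    have "contour_integral (linepath a b) (\<lambda>z. integral {0..1} (g z))
        = integral {0..1} (\<lambda>x. integral {0..1} (\<lambda>t. g (linepath a b x) t * (b - a)))"
      by (simp add: contour_integral_integral)
    also have "\<dots> = integral {0..1} (\<lambda>t. integral {0..1} (\<lambda>x. g (linepath a b x) t * (b - a)))"
      using integral_swap_continuous[of 0 0 1 1 "\<lambda>t x. g (linepath a b x) t * (b - a)", symmetric] contL[OF that]
      by (simp add: cbox_Pair_eq)
    finally show ?thesis unfolding J_def[abs_def] .
  qed
  have "(\<lambda>z. integral {0..1} (g z)) analytic_on S"
  proof (rule Morera_triangle[OF _ S])
    show "continuous_on S (\<lambda>z. integral {0..1} (g z))"
      using integral_continuous_on_param[of S 0 1 g] cont by simp
    fix a b c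
    have "contour_integral (linepath a b) (\<lambda>z. integral {0..1} (g z))
      + contour_integral (linepath b c) (\<lambda>z. integral {0..1} (g z))
      + contour_integral (linepath c a) (\<lambda>z. integral {0..1} (g z)) = 0"
      if abc: "convex hull {a, b, c} \<subseteq> S"
    proof -
    have seg: "closed_segment a b \<subseteq> S" "closed_segment b c \<subseteq> S" "closed_segment c a \<subseteq> S"
      using abc by (auto simp: segment_convex_hull intro!: order_trans[OF hull_mono abc])
    have "J a b t + J b c t + J c a t = 0" if t: "t \<in> {0..1}" for t
    proof -
      have J: "J a b t = contour_integral (linepath a b) (\<lambda>z. g z t)" for a b
        by (simp add: J_def contour_integral_integral)
      have hol': "(\<lambda>z. g z t) holomorphic_on convex hull {a, b, c}"
        by (rule holomorphic_on_subset[OF hol[OF t] abc])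
      have "contour_integral (linepath a b +++ linepath b c +++ linepath c a) (\<lambda>z. g z t) = 0"
        by (rule contour_integral_unique[OF Cauchy_theorem_triangle[OF hol']])
      moreover have ci: "(\<lambda>z. g z t) contour_integrable_on linepath a b" if "closed_segment a b \<subseteq> S" for a b
        using holomorphic_on_imp_continuous_on[OF hol[OF t]] that
        by (intro contour_integrable_continuous_linepath) (blast intro: continuous_on_subset)
      ultimately show ?thesis
        unfolding J using ci[OF seg(1)] ci[OF seg(2)] ci[OF seg(3)]
        by (simp add: contour_integrable_joinI add.assoc)
    qed
    then have "integral {0..1} (\<lambda>t. J a b t + J b c t + J c a t) = 0"
      using integral_cong[of "{0..1}" "\<lambda>t. J a b t + J b c t + J c a t" "\<lambda>_. 0"] by simp
    moreover have "integral {0..1} (\<lambda>t. J a b t + J b c t + J c a t)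
        = integral {0..1} (J a b) + integral {0..1} (J b c) + integral {0..1} (J c a)"
      using J_int[OF seg(1)] J_int[OF seg(2)] J_int[OF seg(3)]
      by (simp add: Henstock_Kurzweil_Integration.integral_add integrable_add)
    ultimately show ?thesis using seg by (simp add: swap)
    qed
    then show "convex hull {a, b, c} \<subseteq> S \<longrightarrow> contour_integral (linepath a b) (\<lambda>z. integral {0..1} (g z))
      + contour_integral (linepath b c) (\<lambda>z. integral {0..1} (g z))
      + contour_integral (linepath c a) (\<lambda>z. integral {0..1} (g z)) = 0" by blast
  qed
  then show ?thesis by (rule analytic_imp_holomorphic)
qed

text \<open>The moments are integrals over one fixed circle, here that of radius \<open>1 / 2\<close>.\<close>

lemma moment_holomorphic:
  assumes A: "holomorphic2_on (\<lambda>z u. G z (Some u)) (Te \<times> Te)"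
    and B: "holomorphic2_on (\<lambda>z u. G z (chart_inf u)) (Te \<times> Te)"
    and m: "\<And>z. z \<in> Te \<Longrightarrow> has_moments (G z) (c z)"
  shows "(\<lambda>z. c z k) holomorphic_on Te"
proof -
  let ?u = "\<lambda>t. of_real (1/2) * cis (2 * pi * t)"
  define g where "g z t = (G z (Some (?u t)) - G z (chart_inf (cnj (?u t)))) * cis (- (2 * pi * of_int k * t))" for z t
  have u: "?u t \<in> Te" "cnj (?u t) \<in> Te" for t by (simp_all add: Te_def norm_mult)
  have "continuous_on (Te \<times> {0..1}) (\<lambda>(z, t). g z t)"
  proof -
    have 1: "continuous_on (Te \<times> {0..1}) (\<lambda>p. (\<lambda>(z, u). G z (Some u)) (fst p, ?u (snd p)))"
      by (rule continuous_on_compose2[OF holomorphic2_imp_continuous[OF A]])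
        (use u in \<open>auto intro!: continuous_intros simp: cis_conv_exp\<close>)
    have 2: "continuous_on (Te \<times> {0..1}) (\<lambda>p. (\<lambda>(z, u). G z (chart_inf u)) (fst p, cnj (?u (snd p))))"
      by (rule continuous_on_compose2[OF holomorphic2_imp_continuous[OF B]])
        (use u in \<open>auto intro!: continuous_intros simp: cis_conv_exp\<close>)
    have 3: "continuous_on (Te \<times> {0..1}) (\<lambda>p :: complex \<times> real. cis (- (2 * pi * of_int k * snd p)))"
      by (intro continuous_intros)
    show ?thesis
      using continuous_on_mult[OF continuous_on_diff[OF 1 2] 3] by (simp add: g_def case_prod_unfold)
  qed
  moreover have "(\<lambda>z. g z t) holomorphic_on Te" for t
    unfolding g_def using holomorphic2_imp_holomorphic(1)[OF A u(1)[of t]] holomorphic2_imp_holomorphic(1)[OF B u(2)[of t]]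
    by (intro holomorphic_intros)
  ultimately have "(\<lambda>z. integral {0..1} (g z)) holomorphic_on Te"
    by (intro holomorphic_parametric_integral open_Te)
  then have "(\<lambda>z. integral {0..1} (g z) / (2 * (1/2) ^ nat \<bar>k\<bar>)) holomorphic_on Te"
    by (intro holomorphic_intros) auto
  moreover have "integral {0..1} (g z) / (2 * (1/2) ^ nat \<bar>k\<bar>) = c z k" if "z \<in> Te" for z
  proof -
    have "reflect (Some (?u t)) = chart_inf (cnj (?u t))" for t
      by (rule reflect_chart)
    then have "(g z has_integral 2 * of_real (1/2) ^ nat \<bar>k\<bar> * c z k) {0..1}"
      using has_moments_integral[OF m[OF that], of "1/2" k] by (simp add: g_def[abs_def])
    then show ?thesis by (simp add: integral_unique)
  qed
  ultimately show ?thesis by (simp cong: holomorphic_cong)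
qed

text \<open>Moments are taken in the second variable first: \<open>c z n\<close> is the \<open>n\<close>-th moment of \<open>F z\<close>.\<close>

definition has_moments2 :: "(complex option \<Rightarrow> complex option \<Rightarrow> complex) \<Rightarrow> (int \<times> int \<Rightarrow> complex) \<Rightarrow> bool" where
  "has_moments2 F \<gamma> \<longleftrightarrow> (\<exists>c. (\<forall>z\<in>Te_inf. has_moments (F z) (c z)) \<and>
     (\<forall>n. has_moments (\<lambda>z. c z n) (\<lambda>m. \<gamma> (m, n))))"

definition charts_holomorphic :: "(complex option \<Rightarrow> complex option \<Rightarrow> complex) \<Rightarrow> bool" where
  "charts_holomorphic F \<longleftrightarrow> (\<forall>c1\<in>{Some, chart_inf}. \<forall>c2\<in>{Some, chart_inf}.
     holomorphic2_on (\<lambda>z1 z2. F (c1 z1) (c2 z2)) (Te \<times> Te))"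

lemma chart_in_Te_inf: "\<lbrakk>c \<in> {Some, chart_inf}; z \<in> Te\<rbrakk> \<Longrightarrow> c z \<in> Te_inf"
  by (cases "z = 0") (auto simp: Te_inf_def chart_inf_def intro!: imageI inverse_in_Te)

text \<open>As a function of the first variable, a moment in the second variable inherits holomorphy from
  \<open>moment_holomorphic\<close> and the normalisation at \<open>0\<close> and infinity from uniqueness of moments, so that
  moments can be taken once more.\<close>

lemma has_moments2_exist:
  assumes F: "charts_holomorphic F"
    and z2: "\<And>z1. z1 \<in> Te_inf \<Longrightarrow> F z1 (Some 0) + F z1 None = 0"
    and z1: "\<And>z2. z2 \<in> Te_inf \<Longrightarrow> F (Some 0) z2 + F None z2 = 0"
  shows "\<exists>\<gamma>. has_moments2 F \<gamma>"
proof -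
  have Fc: "holomorphic2_on (\<lambda>z1 z2. F (c1 z1) (c2 z2)) (Te \<times> Te)"
    if "c1 \<in> {Some, chart_inf}" "c2 \<in> {Some, chart_inf}" for c1 c2
    using F that unfolding charts_holomorphic_def by blast
  have "\<exists>\<gamma>. has_moments (F z) \<gamma>" if z: "z \<in> Te_inf" for z
  proof -
    obtain c1 w where w: "c1 \<in> {Some, chart_inf}" "w \<in> Te" "z = c1 w"
      using z by (rule Te_inf_cases) blast+
    show ?thesis
      using w z2[OF z] holomorphic2_imp_holomorphic(2)[OF Fc[OF w(1)] w(2)]
      by (intro has_moments_exist) auto
  qed
  then obtain c where c: "\<And>z. z \<in> Te_inf \<Longrightarrow> has_moments (F z) (c z)" by metis
  have "\<exists>\<gamma>. has_moments (\<lambda>z. c z n) \<gamma>" for n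
  proof (rule has_moments_exist)
    have hol: "(\<lambda>z. c (c1 z) n) holomorphic_on Te" if "c1 \<in> {Some, chart_inf}" for c1
      by (rule moment_holomorphic[of "\<lambda>z. F (c1 z)"])
        (use Fc[OF that] c chart_in_Te_inf[OF that] in auto)
    show "(\<lambda>z. c (Some z) n) holomorphic_on Te" "(\<lambda>z. c (chart_inf z) n) holomorphic_on Te"
      using hol by blast+
    have "has_moments (F None) (\<lambda>k. (- 1) * c (Some 0) k)"
    proof (rule has_moments_cong)
      show "has_moments (\<lambda>z. (- 1) * F (Some 0) z) (\<lambda>k. (- 1) * c (Some 0) k)"
        by (intro has_moments_scale c) (simp add: Te_inf_def)
      show "F None z = - 1 * F (Some 0) z" if "z \<in> Te_inf" for z
        using z1[OF that] by (simp add: eq_neg_iff_add_eq_0 add.commute)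
    qed
    then have "c None = (\<lambda>k. (- 1) * c (Some 0) k)"
      using has_moments_unique[OF c[of None]] by (simp add: Te_inf_def)
    then show "c (Some 0) n + c None n = 0" by simp
  qed
  then obtain d where "\<And>n. has_moments (\<lambda>z. c z n) (d n)" by metis
  then have "has_moments2 F (\<lambda>(m, n). d n m)"
    unfolding has_moments2_def using c by (intro exI[of _ c]) simp
  then show ?thesis by blast
qed

lemma has_moments2_unique:
  assumes "has_moments2 F \<gamma>" "has_moments2 F \<gamma>'" shows "\<gamma> = \<gamma>'"
proof -
  obtain c c' where c: "\<And>z. z \<in> Te_inf \<Longrightarrow> has_moments (F z) (c z)" "\<And>n. has_moments (\<lambda>z. c z n) (\<lambda>m. \<gamma> (m, n))"
    and c': "\<And>z. z \<in> Te_inf \<Longrightarrow> has_moments (F z) (c' z)" "\<And>n. has_moments (\<lambda>z. c' z n) (\<lambda>m. \<gamma>' (m, n))"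
    using assms unfolding has_moments2_def by metis
  have "has_moments (\<lambda>z. c z n) (\<lambda>m. \<gamma>' (m, n))" for n
    using has_moments_unique[OF c(1) c'(1)] by (intro has_moments_cong[OF _ c'(2)]) simp
  then have "(\<lambda>m. \<gamma> (m, n)) = (\<lambda>m. \<gamma>' (m, n))" for n by (rule has_moments_unique[OF c(2)])
  then show ?thesis by (auto simp: fun_eq_iff)
qed

lemma has_moments2_determine:
  assumes "has_moments2 F \<gamma>" "has_moments2 G \<gamma>" "z1 \<in> Te_inf" "z2 \<in> Te_inf"
  shows "F z1 z2 = G z1 z2"
proof -
  obtain c c' where c: "\<And>z. z \<in> Te_inf \<Longrightarrow> has_moments (F z) (c z)" "\<And>n. has_moments (\<lambda>z. c z n) (\<lambda>m. \<gamma> (m, n))"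
    and c': "\<And>z. z \<in> Te_inf \<Longrightarrow> has_moments (G z) (c' z)" "\<And>n. has_moments (\<lambda>z. c' z n) (\<lambda>m. \<gamma> (m, n))"
    using assms unfolding has_moments2_def by metis
  have "c z1 = c' z1" using has_moments_determine[OF c(2) c'(2) assms(3)] by (rule ext)
  then show ?thesis using has_moments_determine[OF c(1) _ assms(4)] c'(1) assms(3) by simp
qed

lemma has_moments2_cong:
  assumes "\<And>z1 z2. \<lbrakk>z1 \<in> Te_inf; z2 \<in> Te_inf\<rbrakk> \<Longrightarrow> F z1 z2 = G z1 z2" "has_moments2 G \<gamma>"
  shows "has_moments2 F \<gamma>"
  using assms has_moments_cong[of "F _" "G _"] unfolding has_moments2_def by metis

lemma has_moments2_add:
  assumes "has_moments2 F \<gamma>" "has_moments2 G \<delta>"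
  shows "has_moments2 (\<lambda>z1 z2. F z1 z2 + G z1 z2) (\<lambda>p. \<gamma> p + \<delta> p)"
proof -
  obtain c d where "\<And>z. z \<in> Te_inf \<Longrightarrow> has_moments (F z) (c z)" "\<And>n. has_moments (\<lambda>z. c z n) (\<lambda>m. \<gamma> (m, n))"
    "\<And>z. z \<in> Te_inf \<Longrightarrow> has_moments (G z) (d z)" "\<And>n. has_moments (\<lambda>z. d z n) (\<lambda>m. \<delta> (m, n))"
    using assms unfolding has_moments2_def by metis
  then show ?thesis
    unfolding has_moments2_def by (intro exI[of _ "\<lambda>z n. c z n + d z n"]) (simp add: has_moments_add)
qed

lemma has_moments2_scale:
  assumes "has_moments2 F \<gamma>" shows "has_moments2 (\<lambda>z1 z2. a * F z1 z2) (\<lambda>p. a * \<gamma> p)"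
proof -
  obtain c where "\<And>z. z \<in> Te_inf \<Longrightarrow> has_moments (F z) (c z)" "\<And>n. has_moments (\<lambda>z. c z n) (\<lambda>m. \<gamma> (m, n))"
    using assms unfolding has_moments2_def by metis
  then show ?thesis
    unfolding has_moments2_def by (intro exI[of _ "\<lambda>z n. a * c z n"]) (simp add: has_moments_scale)
qed

section \<open>Positive definiteness of the moments\<close>

definition poisson2 :: "(complex option \<Rightarrow> complex option \<Rightarrow> complex) \<Rightarrow> complex \<Rightarrow> complex \<Rightarrow> complex" where
  "poisson2 F w1 w2 = F (Some w1) (Some w2) - F (reflect (Some w1)) (Some w2)
     - F (Some w1) (reflect (Some w2)) + F (reflect (Some w1)) (reflect (Some w2))"

lemma has_integral_nonneg_complex:
  fixes f :: "real \<Rightarrow> complex"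
  assumes "(f has_integral I) {0..1}" "\<And>t. f t \<in> \<real>\<^sub>\<ge>\<^sub>0" shows "I \<in> \<real>\<^sub>\<ge>\<^sub>0"
proof -
  have "0 \<le> Re I"
    using has_integral_Re[OF assms(1)] by (rule has_integral_nonneg) (use assms(2) in \<open>simp add: complex_nonneg_Reals_iff\<close>)
  moreover have "((\<lambda>_. 0) has_integral Im I) {0..1::real}"
    using has_integral_Im[OF assms(1)] assms(2) by (simp add: complex_nonneg_Reals_iff)
  then have "Im I = 0" using has_integral_unique[OF _ has_integral_0] by blast
  ultimately show ?thesis by (simp add: complex_nonneg_Reals_iff)
qed

text \<open>On the torus \<open>\<bar>w1\<bar> = \<bar>w2\<bar> = r\<close> the function \<open>poisson2 (F i j)\<close> has the Fourier coefficients
  \<open>4 r\<^bsup>\<bar>m\<bar> + \<bar>n\<bar>\<^esup> \<gamma> i j (m, n)\<close>. With the characters \<open>\<zeta> \<mapsto> \<zeta>\<^bsup>- p i\<^esup>\<close> as coefficients \<open>a i\<close>, the nonnegative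
  sum integrates to the sum of these coefficients at \<open>p i - p j\<close>; then \<open>r \<rightarrow> 1\<close>. The integral over the
  torus is taken one variable at a time.\<close>

theorem moments_positive_definite:
  fixes N :: nat
  assumes m: "\<And>i j. \<lbrakk>i < N; j < N\<rbrakk> \<Longrightarrow> has_moments2 (F i j) (\<gamma> i j)"
    and pos: "\<And>w1 w2 a. \<lbrakk>cmod w1 < 1; cmod w2 < 1\<rbrakk>
      \<Longrightarrow> (\<Sum>i<N. \<Sum>j<N. a i * cnj (a j) * poisson2 (F i j) w1 w2) \<in> \<real>\<^sub>\<ge>\<^sub>0"
  shows "(\<Sum>i<N. \<Sum>j<N. \<gamma> i j (p i - p j)) \<in> \<real>\<^sub>\<ge>\<^sub>0"
proof -
  have "\<exists>c. (\<forall>z\<in>Te_inf. has_moments (F i j z) (c z)) \<and> (\<forall>n. has_moments (\<lambda>z. c z n) (\<lambda>m. \<gamma> i j (m, n)))"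
    if "i < N" "j < N" for i j using m[OF that] by (simp add: has_moments2_def)
  then obtain c where c1: "\<And>i j z. \<lbrakk>i < N; j < N; z \<in> Te_inf\<rbrakk> \<Longrightarrow> has_moments (F i j z) (c i j z)"
    and c2: "\<And>i j n. \<lbrakk>i < N; j < N\<rbrakk> \<Longrightarrow> has_moments (\<lambda>z. c i j z n) (\<lambda>m. \<gamma> i j (m, n))" by metis
  define M L where "M i j = fst (p i) - fst (p j)" and "L i j = snd (p i) - snd (p j)" for i j
  have pos_r: "(\<Sum>i<N. \<Sum>j<N. 2 * of_real r ^ nat \<bar>L i j\<bar> * (2 * of_real r ^ nat \<bar>M i j\<bar> * \<gamma> i j (p i - p j))) \<in> \<real>\<^sub>\<ge>\<^sub>0"
    if r: "0 < r" "r < 1" for r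
  proof -
    let ?z = "\<lambda>t. of_real r * cis (2 * pi * t)"
    let ?e = "\<lambda>k t. cis (- (2 * pi * of_int k * t))"
    have z: "cmod (?z t) < 1" for t using r by (simp add: norm_mult)
    have zT: "Some (?z t) \<in> Te_inf" "reflect (Some (?z t)) \<in> Te_inf" for t
      using disc_in_Te[OF z[of t]] iffD2[OF cnj_in_Te disc_in_Te[OF z[of t]]] chart_in_Te_inf[of Some] chart_in_Te_inf[of chart_inf "cnj (?z t)"]
      by (simp_all add: reflect_chart)
    define Q where "Q i j t = c i j (Some (?z t)) (L i j) - c i j (reflect (Some (?z t))) (L i j)" for i j t
    have inner: "((\<lambda>s. poisson2 (F i j) (?z t) (?z s) * ?e (L i j) s)
        has_integral 2 * of_real r ^ nat \<bar>L i j\<bar> * Q i j t) {0..1}" if "i < N" "j < N" for i j t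
      using has_integral_diff[OF has_moments_integral[OF c1[OF that zT(1)[of t]] r, of "L i j"]
          has_moments_integral[OF c1[OF that zT(2)[of t]] r, of "L i j"]]
      by (simp add: poisson2_def Q_def algebra_simps)
    have row: "(\<Sum>i<N. \<Sum>j<N. ?e (M i j) t * (2 * of_real r ^ nat \<bar>L i j\<bar> * Q i j t)) \<in> \<real>\<^sub>\<ge>\<^sub>0" for t
    proof (rule has_integral_nonneg_complex)
      show "((\<lambda>s. \<Sum>i<N. \<Sum>j<N. ?e (M i j) t * (poisson2 (F i j) (?z t) (?z s) * ?e (L i j) s))
          has_integral (\<Sum>i<N. \<Sum>j<N. ?e (M i j) t * (2 * of_real r ^ nat \<bar>L i j\<bar> * Q i j t))) {0..1}"
        by (intro has_integral_sum has_integral_mult_right inner) auto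
      fix s
      define a where "a i = cis (- (2 * pi * (of_int (fst (p i)) * t + of_int (snd (p i)) * s)))" for i
      have "a i * cnj (a j) = ?e (M i j) t * ?e (L i j) s" for i j
        by (simp add: a_def M_def L_def cis_cnj cis_mult algebra_simps)
      then have "(\<Sum>i<N. \<Sum>j<N. ?e (M i j) t * (poisson2 (F i j) (?z t) (?z s) * ?e (L i j) s))
          = (\<Sum>i<N. \<Sum>j<N. a i * cnj (a j) * poisson2 (F i j) (?z t) (?z s))"
        by (simp add: mult_ac)
      then show "(\<Sum>i<N. \<Sum>j<N. ?e (M i j) t * (poisson2 (F i j) (?z t) (?z s) * ?e (L i j) s)) \<in> \<real>\<^sub>\<ge>\<^sub>0"
        using pos[OF z z] by simp
    qed
    show ?thesis
    proof (rule has_integral_nonneg_complex)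
      have "((\<lambda>t. Q i j t * ?e (M i j) t) has_integral 2 * of_real r ^ nat \<bar>M i j\<bar> * \<gamma> i j (p i - p j)) {0..1}"
        if "i < N" "j < N" for i j
        using has_moments_integral[OF c2[OF that] r, of "L i j" "M i j"]
        by (simp add: Q_def M_def L_def minus_prod_def)
      then show "((\<lambda>t. \<Sum>i<N. \<Sum>j<N. 2 * of_real r ^ nat \<bar>L i j\<bar> * (Q i j t * ?e (M i j) t)) has_integral
        (\<Sum>i<N. \<Sum>j<N. 2 * of_real r ^ nat \<bar>L i j\<bar> * (2 * of_real r ^ nat \<bar>M i j\<bar> * \<gamma> i j (p i - p j)))) {0..1}"
        by (intro has_integral_sum has_integral_mult_right) auto
      show "(\<Sum>i<N. \<Sum>j<N. 2 * of_real r ^ nat \<bar>L i j\<bar> * (Q i j t * ?e (M i j) t)) \<in> \<real>\<^sub>\<ge>\<^sub>0" for t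
        using row[of t] by (simp add: mult_ac)
    qed
  qed
  let ?S = "\<lambda>r. \<Sum>i<N. \<Sum>j<N. 2 * complex_of_real r ^ nat \<bar>L i j\<bar> * (2 * of_real r ^ nat \<bar>M i j\<bar> * \<gamma> i j (p i - p j))"
  have "(?S \<longlongrightarrow> ?S 1) (at_left 1)" by (intro tendsto_intros)
  moreover have "\<forall>\<^sub>F r in at_left 1. ?S r \<in> \<real>\<^sub>\<ge>\<^sub>0"
    unfolding eventually_at_left_field
    by (intro exI[of _ 0] conjI allI impI pos_r zero_less_one)
  ultimately have "?S 1 \<in> \<real>\<^sub>\<ge>\<^sub>0"
    by (intro Lim_in_closed_set[OF closed_nonneg_Reals_complex]) auto
  also have "?S 1 = 4 * (\<Sum>i<N. \<Sum>j<N. \<gamma> i j (p i - p j))" by (simp add: sum_distrib_left)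
  finally show ?thesis by (simp add: complex_nonneg_Reals_iff)
qed

section \<open>Moments of Cayley transforms\<close>

context complex_hilbert_space
begin

definition upow :: "('a \<Rightarrow> 'a) \<Rightarrow> int \<Rightarrow> 'a \<Rightarrow> 'a" where
  "upow U k x = (if k \<ge> 0 then (U ^^ nat k) x else (uinv U ^^ nat (- k)) x)"

lemma upow_closed: "\<lbrakk>hunitary H U; x \<in> carrier H\<rbrakk> \<Longrightarrow> upow U k x \<in> carrier H"
  by (simp add: upow_def funpow_closed uinv_unitary)

lemma upow_commute:
  assumes U: "hunitary H U" and W: "\<And>x. x \<in> carrier H \<Longrightarrow> W x \<in> carrier H"
    and comm: "\<And>x. x \<in> carrier H \<Longrightarrow> W (U x) = U (W x)" and x: "x \<in> carrier H"
  shows "W (upow U k x) = upow U k (W x)"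
proof -
  have inv: "W (uinv U x) = uinv U (W x)" if "x \<in> carrier H" for x
    using comm[of "uinv U x"] uinv_cancel[OF U] W that by metis
  have pow: "W ((A ^^ n) x) = (A ^^ n) (W x)"
    if "hunitary H A" "\<And>x. x \<in> carrier H \<Longrightarrow> W (A x) = A (W x)" for A n
    by (induction n) (simp_all add: that funpow_closed x)
  show ?thesis using pow[OF U comm] pow[OF uinv_unitary[OF U] inv] by (simp add: upow_def)
qed

lemma cayley_ext_moments:
  assumes U: "hunitary H U" and x: "x \<in> carrier H" and y: "y \<in> carrier H"
  shows "has_moments (\<lambda>z. \<langle>cayley_ext U z x, y\<rangle>) (\<lambda>k. \<langle>upow U k x, y\<rangle>)"
  unfolding has_moments_def
proof (intro allI impI conjI)
  fix z :: complex assume z: "cmod z < 1"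
  note V = uinv_unitary[OF U]
  show "(\<lambda>n. (if n = 0 then 1 else 2) * \<langle>upow U (int n) x, y\<rangle> * z ^ n) sums \<langle>cayley_ext U (Some z) x, y\<rangle>"
    using cayley_sums[OF U z x y] by (simp add: upow_def)
  have "upow U (- int n) x = (uinv U ^^ n) x" for n
    by (cases "n = 0") (simp_all add: upow_def)
  moreover have "- \<langle>cayley_ext U (chart_inf z) x, y\<rangle> = \<langle>cayley H (uinv U) z x, y\<rangle>"
    using cayley_closed[OF V disc_in_Te[OF z] x] y
    by (simp add: cayley_ext_chart_inf[OF U disc_in_Te[OF z] x] inner_simps)
  ultimately show "(\<lambda>n. (if n = 0 then 1 else 2) * \<langle>upow U (- int n) x, y\<rangle> * z ^ n)
      sums (- \<langle>cayley_ext U (chart_inf z) x, y\<rangle>)"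
    using cayley_sums[OF V z x y] by simp
qed

lemma cayley_ext_pair_commute:
  assumes U: "hunitary H U1" "hunitary H U2"
    and comm: "\<And>x. x \<in> carrier H \<Longrightarrow> U1 (U2 x) = U2 (U1 x)"
    and z: "z1 \<in> Te_inf" "z2 \<in> Te_inf" and x: "x \<in> carrier H"
  shows "cayley_ext U1 z1 (U2 x) = U2 (cayley_ext U1 z1 x)"
    "cayley_ext U1 z1 (cayley_ext U2 z2 x) = cayley_ext U2 z2 (cayley_ext U1 z1 x)"
proof -
  have c: "cayley_ext U1 z1 (U2 x) = U2 (cayley_ext U1 z1 x)" if "x \<in> carrier H" for x
    using cayley_ext_commute[OF U(1) z(1) hunitary_linear[OF U(2)] _ that] comm by simp
  show "cayley_ext U1 z1 (U2 x) = U2 (cayley_ext U1 z1 x)" by (rule c[OF x])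
  show "cayley_ext U1 z1 (cayley_ext U2 z2 x) = cayley_ext U2 z2 (cayley_ext U1 z1 x)"
    by (rule cayley_ext_commute[OF U(2) z(2) cayley_ext_linear[OF U(1) z(1)] c x])
qed

text \<open>The moments in the second variable, at a fixed \<open>z1\<close>, are \<open>\<langle>C\<^sub>1(z1) U\<^sub>2\<^sup>n x, y\<rangle>\<close>, because
  \<open>C\<^sub>1(z1)\<close> commutes with \<open>U\<^sub>2\<close>; in the remaining variable these are again of the form treated before.\<close>

lemma cayley_ext_moments2:
  assumes U: "hunitary H U1" "hunitary H U2"
    and comm: "\<And>x. x \<in> carrier H \<Longrightarrow> U1 (U2 x) = U2 (U1 x)"
    and x: "x \<in> carrier H" and y: "y \<in> carrier H"
  shows "has_moments2 (\<lambda>z1 z2. \<langle>cayley_ext U1 z1 (cayley_ext U2 z2 x), y\<rangle>)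
    (\<lambda>(m, n). \<langle>upow U1 m (upow U2 n x), y\<rangle>)"
  unfolding has_moments2_def
proof (intro exI[of _ "\<lambda>z1 n. \<langle>cayley_ext U1 z1 (upow U2 n x), y\<rangle>"] conjI ballI allI)
  fix z1 assume z1: "z1 \<in> Te_inf"
  note A = cayley_ext_closed[OF U(1) z1]
  have "cayley_ext U1 z1 (upow U2 n x) = upow U2 n (cayley_ext U1 z1 x)" for n
    by (rule upow_commute[OF U(2) A _ x]) (simp_all add: cayley_ext_pair_commute(1)[OF U comm z1 z1])
  moreover have "has_moments (\<lambda>z2. \<langle>cayley_ext U1 z1 (cayley_ext U2 z2 x), y\<rangle>)
      (\<lambda>n. \<langle>upow U2 n (cayley_ext U1 z1 x), y\<rangle>)"
    by (rule has_moments_cong[OF _ cayley_ext_moments[OF U(2) A[OF x] y]])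
      (simp add: cayley_ext_pair_commute(2)[OF U comm z1 _ x])
  ultimately show "has_moments (\<lambda>z2. \<langle>cayley_ext U1 z1 (cayley_ext U2 z2 x), y\<rangle>)
      (\<lambda>n. \<langle>cayley_ext U1 z1 (upow U2 n x), y\<rangle>)" by simp
next
  fix n
  show "has_moments (\<lambda>z. \<langle>cayley_ext U1 z (upow U2 n x), y\<rangle>)
      (\<lambda>m. case (m, n) of (m, n) \<Rightarrow> \<langle>upow U1 m (upow U2 n x), y\<rangle>)"
    using cayley_ext_moments[OF U(1) upow_closed[OF U(2) x] y] by simp
qed

lemma reflect_in_Te_inf: "z \<in> Te_inf \<Longrightarrow> reflect z \<in> Te_inf"
proof (cases z)
  case None
  then show ?thesis by (simp add: reflect_def Te_inf_def)
next
  case (Some w)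
  assume "z \<in> Te_inf"
  then have "w \<in> Te" using Some by (auto simp: Te_inf_def)
  then show ?thesis
    unfolding Some reflect_chart by (intro chart_in_Te_inf) auto
qed

lemma cayley_ext_adjoint:
  assumes U: "hunitary H U" and z: "z \<in> Te_inf" and x: "x \<in> carrier H" and y: "y \<in> carrier H"
  shows "\<langle>cayley_ext U z x, y\<rangle> = - \<langle>x, cayley_ext U (reflect z) y\<rangle>"
proof (cases z)
  case None
  then show ?thesis using x y cayley_zero[OF U y] by (simp add: reflect_def inner_simps)
next
  case (Some w)
  then have w: "w \<in> Te" using z by (auto simp: Te_inf_def)
  then show ?thesis
    using cayley_adjoint[OF U w x y] x y cayley_closed[OF uinv_unitary[OF U] _ y, of "cnj w"]
    by (simp add: Some reflect_chart cayley_ext_chart_inf[OF U _ y] inner_simps)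
qed

end

lemma holomorphic2_cong:
  assumes "\<And>z w. \<lbrakk>z \<in> A; w \<in> B\<rbrakk> \<Longrightarrow> f z w = g z w" "holomorphic2_on g (A \<times> B)"
  shows "holomorphic2_on f (A \<times> B)"
  unfolding holomorphic2_on_def
proof
  fix p assume p: "p \<in> A \<times> B"
  then obtain a b where "((\<lambda>(z, w). g z w) has_derivative (\<lambda>(h, k). a * h + b * k)) (at p within A \<times> B)"
    using assms(2) unfolding holomorphic2_on_def by meson
  then have "((\<lambda>(z, w). f z w) has_derivative (\<lambda>(h, k). a * h + b * k)) (at p within A \<times> B)"
    by (rule has_derivative_transform[OF p, rotated]) (use assms(1) in auto)
  then show "\<exists>a b. ((\<lambda>(z, w). f z w) has_derivative (\<lambda>(h, k). a * h + b * k)) (at p within A \<times> B)" by blast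
qed

text \<open>A limit at infinity is continuity at the origin of the coordinate \<open>u = 1 / z\<close>.\<close>

lemma tendsto_at_infinity_chart:
  assumes "(\<lambda>u. \<phi> (chart_inf u)) holomorphic_on Te"
  shows "((\<lambda>z. \<phi> (Some z)) \<longlongrightarrow> \<phi> None) at_infinity"
proof -
  have "isCont (\<lambda>u. \<phi> (chart_inf u)) 0"
    using holomorphic_on_imp_continuous_on[OF assms] open_Te
    by (simp add: continuous_on_eq_continuous_at)
  then have "((\<lambda>z. \<phi> (chart_inf (inverse z))) \<longlongrightarrow> \<phi> (chart_inf 0)) at_infinity"
    by (rule isCont_tendsto_compose) (rule tendsto_inverse_0)
  moreover have "\<forall>\<^sub>F z in at_infinity. \<phi> (chart_inf (inverse z)) = \<phi> (Some z)"
    using eventually_not_equal_at_infinity[of 0] by eventually_elim (simp add: chart_inf_def)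
  ultimately show ?thesis
    using Lim_transform_eventually by (fastforce simp: chart_inf_def)
qed

context complex_hilbert_space
begin

lemma cayley_ext_charts_holomorphic:
  assumes U: "hunitary H U1" "hunitary H U2" and x: "x \<in> carrier H"
  shows "charts_holomorphic (\<lambda>z1 z2. \<langle>cayley_ext U1 z1 (cayley_ext U2 z2 x), x\<rangle>)"
  unfolding charts_holomorphic_def
proof (intro ballI)
  fix c1 c2 :: "complex \<Rightarrow> complex option"
  assume c: "c1 \<in> {Some, chart_inf}" "c2 \<in> {Some, chart_inf}"
  have chart: "\<exists>W s. hunitary H W \<and> (\<forall>z\<in>Te. \<forall>x\<in>carrier H. cayley_ext U (c z) x = s \<odot> cayley H W z x)"
    if U: "hunitary H U" and c: "c \<in> {Some, chart_inf}" for U c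
    using c
  proof (elim insertE emptyE)
    assume "c = Some"
    then show ?thesis using U by (intro exI[of _ U] exI[of _ 1]) (simp add: scale_one cayley_closed)
  next
    assume "c = chart_inf"
    then show ?thesis
      using uinv_unitary[OF U] cayley_ext_chart_inf[OF U] by (intro exI[of _ "uinv U"] exI[of _ "- 1"]) simp
  qed
  obtain W1 s1 where W1: "hunitary H W1" "\<And>z x. \<lbrakk>z \<in> Te; x \<in> carrier H\<rbrakk> \<Longrightarrow> cayley_ext U1 (c1 z) x = s1 \<odot> cayley H W1 z x"
    using chart[OF U(1) c(1)] by blast
  obtain W2 s2 where W2: "hunitary H W2" "\<And>z x. \<lbrakk>z \<in> Te; x \<in> carrier H\<rbrakk> \<Longrightarrow> cayley_ext U2 (c2 z) x = s2 \<odot> cayley H W2 z x"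
    using chart[OF U(2) c(2)] by blast
  show "holomorphic2_on (\<lambda>z1 z2. \<langle>cayley_ext U1 (c1 z1) (cayley_ext U2 (c2 z2) x), x\<rangle>) (Te \<times> Te)"
  proof (rule holomorphic2_cong)
    show "holomorphic2_on (\<lambda>z1 z2. (s1 * s2) * \<langle>cayley H W1 z1 (cayley H W2 z2 x), x\<rangle>) (Te \<times> Te)"
      by (intro holomorphic2_scale cayley2_holomorphic W1 W2 x)
    fix z w assume z: "z \<in> Te" and w: "w \<in> Te"
    have "cayley_ext U1 (c1 z) (cayley_ext U2 (c2 w) x) = s1 \<odot> (s2 \<odot> cayley H W1 z (cayley H W2 w x))"
      using W1(2)[OF z] W2(2)[OF w x] cayley_closed[OF W2(1) w x]
        hlinearD(3)[OF cayley_linear[OF W1(1) z]] by simp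
    then show "\<langle>cayley_ext U1 (c1 z) (cayley_ext U2 (c2 w) x), x\<rangle>
        = (s1 * s2) * \<langle>cayley H W1 z (cayley H W2 w x), x\<rangle>"
      using cayley_closed[OF W1(1) z cayley_closed[OF W2(1) w x]] x by (simp add: inner_simps)
  qed
qed

text \<open>The combination in the positivity condition of the class \<open>H\<^sub>2\<close> factorises through the resolvents into a squared norm.\<close>

lemma cayley_ext_poisson2:
  assumes U: "hunitary H U1" "hunitary H U2"
    and comm: "\<And>x. x \<in> carrier H \<Longrightarrow> U1 (U2 x) = U2 (U1 x)"
    and x: "x \<in> carrier H" and w: "cmod w1 < 1" "cmod w2 < 1"
  shows "poisson2 (\<lambda>z1 z2. \<langle>cayley_ext U1 z1 (cayley_ext U2 z2 x), x\<rangle>) w1 w2 \<in> \<real>\<^sub>\<ge>\<^sub>0"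
proof -
  have wT: "w1 \<in> Te" "w2 \<in> Te" using disc_in_Te w by auto
  define t where "t = resolvent U1 w1 x"
  have t: "t \<in> carrier H" using resolvent_closed[OF U(1) wT(1) x] by (simp add: t_def)
  have step: "\<langle>cayley_ext U1 (Some w1) (cayley_ext U2 z x), x\<rangle>
        - \<langle>cayley_ext U1 (reflect (Some w1)) (cayley_ext U2 z x), x\<rangle>
      = of_real (2 * (1 - (cmod w1)\<^sup>2)) * \<langle>cayley_ext U2 z t, t\<rangle>" if z: "z \<in> Te_inf" for z
  proof -
    have "resolvent U1 w1 (cayley_ext U2 z x) = cayley_ext U2 z t"
      unfolding t_def
      by (rule resolvent_commute[OF U(1) wT(1) cayley_ext_linear[OF U(2) z] _ x, symmetric])
        (rule cayley_ext_pair_commute(1)[OF U(2,1) _ z z], simp add: comm, simp)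
    then show ?thesis
      using poisson_identity[OF U(1) w(1) cayley_ext_closed[OF U(2) z x] x] by (simp add: t_def)
  qed
  have z: "Some w2 \<in> Te_inf" "reflect (Some w2) \<in> Te_inf"
    using wT reflect_in_Te_inf by (auto simp: Te_inf_def)
  have "poisson2 (\<lambda>z1 z2. \<langle>cayley_ext U1 z1 (cayley_ext U2 z2 x), x\<rangle>) w1 w2
      = of_real (2 * (1 - (cmod w1)\<^sup>2)) * (\<langle>cayley_ext U2 (Some w2) t, t\<rangle> - \<langle>cayley_ext U2 (reflect (Some w2)) t, t\<rangle>)"
    using step[OF z(1)] step[OF z(2)] unfolding poisson2_def by (simp only: right_diff_distrib) (simp add: algebra_simps)
  also have "\<dots> = of_real (2 * (1 - (cmod w1)\<^sup>2)) * (of_real (2 * (1 - (cmod w2)\<^sup>2)) * \<langle>resolvent U2 w2 t, resolvent U2 w2 t\<rangle>)"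
    unfolding poisson_identity[OF U(2) w(2) t t] ..
  also have "\<dots> = of_real (2 * (1 - (cmod w1)\<^sup>2) * (2 * (1 - (cmod w2)\<^sup>2)) * \<parallel>resolvent U2 w2 t\<parallel>\<^sup>2)"
    unfolding inner_self[OF resolvent_closed[OF U(2) wT(2) t]] by simp
  also have "\<dots> \<in> \<real>\<^sub>\<ge>\<^sub>0"
  proof -
    have "(cmod w1)\<^sup>2 \<le> 1" "(cmod w2)\<^sup>2 \<le> 1" using w by (simp_all add: power_le_one)
    then show ?thesis by (simp only: nonneg_Reals_of_real_iff) simp
  qed
  finally show ?thesis .
qed

lemma cayley_ext_class_H2:
  assumes U: "hunitary H U1" "hunitary H U2"
    and comm: "\<And>x. x \<in> carrier H \<Longrightarrow> U1 (U2 x) = U2 (U1 x)" and x: "x \<in> carrier H"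
  defines "F \<equiv> \<lambda>z1 z2. \<langle>cayley_ext U1 z1 (cayley_ext U2 z2 x), x\<rangle>"
  shows "class_H2 F" "limit_extension (\<lambda>z1 z2. F (Some z1) (Some z2)) F"
proof -
  have hol: "holomorphic2_on (\<lambda>z1 z2. F (c1 z1) (c2 z2)) (Te \<times> Te)"
    if "c1 \<in> {Some, chart_inf}" "c2 \<in> {Some, chart_inf}" for c1 c2
    using cayley_ext_charts_holomorphic[OF U x] that unfolding charts_holomorphic_def F_def by blast
  have T0: "Some 0 \<in> Te_inf" "None \<in> Te_inf" by (auto simp: Te_inf_def)
  have b: "poisson2 F w1 w2 \<in> \<real>\<^sub>\<ge>\<^sub>0" if "cmod w1 < 1" "cmod w2 < 1" for w1 w2
    unfolding F_def by (rule cayley_ext_poisson2[OF U comm x that])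
  have a: "F (reflect z1) (reflect z2) = cnj (F z1 z2)" if z: "z1 \<in> Te_inf" "z2 \<in> Te_inf" for z1 z2
  proof -
    note r = reflect_in_Te_inf[OF z(1)] reflect_in_Te_inf[OF z(2)]
    have "F z1 z2 = - \<langle>cayley_ext U2 z2 x, cayley_ext U1 (reflect z1) x\<rangle>"
      unfolding F_def by (rule cayley_ext_adjoint[OF U(1) z(1) cayley_ext_closed[OF U(2) z(2) x] x])
    also have "\<langle>cayley_ext U2 z2 x, cayley_ext U1 (reflect z1) x\<rangle>
        = - \<langle>x, cayley_ext U2 (reflect z2) (cayley_ext U1 (reflect z1) x)\<rangle>"
      by (rule cayley_ext_adjoint[OF U(2) z(2) x cayley_ext_closed[OF U(1) r(1) x]])
    also have "cayley_ext U2 (reflect z2) (cayley_ext U1 (reflect z1) x)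
        = cayley_ext U1 (reflect z1) (cayley_ext U2 (reflect z2) x)"
      using cayley_ext_pair_commute(2)[OF U comm r x] by simp
    also have "\<langle>x, \<dots>\<rangle> = cnj (F (reflect z1) (reflect z2))"
      unfolding F_def by (rule inner_commute[OF x cayley_ext_closed[OF U(1) r(1) cayley_ext_closed[OF U(2) r(2) x]]])
    finally show ?thesis by simp
  qed
  have c: "F z1 (Some 0) + F z1 None = 0" "F (Some 0) z1 + F None z1 = 0" if z: "z1 \<in> Te_inf" for z1
    using cayley_ext_closed[OF U(1) z x] cayley_ext_closed[OF U(2) z x] x
    by (simp_all add: F_def cayley_zero U hlinearD(3)[OF cayley_ext_linear[OF U(1) z] x] inner_simps)
  show "class_H2 F"
    unfolding class_H2_def Let_def
    by (intro conjI ballI allI impI hol a c b[unfolded poisson2_def])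
  show "limit_extension (\<lambda>z1 z2. F (Some z1) (Some z2)) F"
    unfolding limit_extension_def
  proof (intro conjI ballI refl)
    show "((\<lambda>z1. F (Some z1) (Some z2)) \<longlongrightarrow> F None (Some z2)) at_infinity" if "z2 \<in> Te" for z2
      using holomorphic2_imp_holomorphic(1)[OF hol[of chart_inf Some] that]
      by (intro tendsto_at_infinity_chart[of "\<lambda>z. F z (Some z2)"]) simp
    show "((\<lambda>z2. F (Some z1) (Some z2)) \<longlongrightarrow> F (Some z1) None) at_infinity" if "z1 \<in> Te" for z1
      using holomorphic2_imp_holomorphic(2)[OF hol[of Some chart_inf] that]
      by (intro tendsto_at_infinity_chart[of "\<lambda>z. F (Some z1) z"]) simp
    show "((\<lambda>z2. F None (Some z2)) \<longlongrightarrow> F None None) at_infinity"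
      using holomorphic2_imp_holomorphic(2)[OF hol[of chart_inf chart_inf], of 0]
      by (intro tendsto_at_infinity_chart[of "\<lambda>z. F None z"]) (simp add: chart_inf_def[of 0])
  qed
qed

end

section \<open>Isometric parts of a unitary operator\<close>

locale unitary_extension = H: complex_hilbert_space H + K: complex_hilbert_space K
  for H :: "'a hspace" and K :: "'b hspace" +
  fixes J :: "'a \<Rightarrow> 'b"
  assumes embed: "hembedding H K J"
begin

lemma J_closed: "x \<in> carrier H \<Longrightarrow> J x \<in> carrier K"
  and J_inner: "\<lbrakk>x \<in> carrier H; y \<in> carrier H\<rbrakk> \<Longrightarrow> hinner K (J x) (J y) = hinner H x y"
  and J_scale: "x \<in> carrier H \<Longrightarrow> J (c \<odot>\<^bsub>H\<^esub> x) = c \<odot>\<^bsub>K\<^esub> J x"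
  and J_minus: "\<lbrakk>x \<in> carrier H; y \<in> carrier H\<rbrakk> \<Longrightarrow> J (x \<ominus>\<^bsub>H\<^esub> y) = J x \<ominus>\<^bsub>K\<^esub> J y"
  using embed by (auto simp: hembedding_def hlinear_def hminus_def Pi_iff)

lemma half_cayley:
  assumes "hunitary K U" "z \<in> Te" "x \<in> carrier H" "y \<in> carrier H"
  shows "(hinner H x y + hinner K (cayley K U z (J x)) (J y)) / 2
    = hinner K (K.resolvent U z (J x)) (J y)"
  using K.cayley_inner(1)[OF assms(1,2) J_closed J_closed, OF assms(3,4)] J_inner[OF assms(3,4)] by simp

lemma resolvent_of_extension:
  assumes U: "hunitary K U" and z: "z \<in> Te" and g: "g \<in> carrier H" "v \<in> carrier H" and ext: "U (J g) = J v"
  shows "K.resolvent U z (J (g \<ominus>\<^bsub>H\<^esub> z \<odot>\<^bsub>H\<^esub> v)) = J g"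
  by (rule K.resolvent_unique[OF U z J_closed[OF g(1)]]) (simp add: ext J_minus J_scale g)

text \<open>Conversely, a single value of the compressed resolvent forces \<open>U\<close> to extend \<open>g \<mapsto> v\<close>.
  With \<open>y = (E - z U)\<^sup>-\<^sup>1 (g - z v)\<close> the vectors \<open>w = y - g\<close> and \<open>U y - v\<close> are both orthogonal to
  \<open>H\<close> and satisfy \<open>w = z (U y - v)\<close>, whereas \<open>\<parallel>U y\<parallel> = \<parallel>y\<parallel>\<close> and \<open>\<parallel>v\<parallel> = \<parallel>g\<parallel>\<close> make their norms equal.
  As \<open>\<bar>z\<bar> \<noteq> 1\<close>, both vanish.\<close>

lemma extension_of_resolvent:
  assumes U: "hunitary K U" and z: "z \<in> Te" "z \<noteq> 0" and g: "g \<in> carrier H" "v \<in> carrier H"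
    and iso: "hnorm H v = hnorm H g"
    and res: "\<And>h. h \<in> carrier H \<Longrightarrow>
      hinner K (K.resolvent U z (J (g \<ominus>\<^bsub>H\<^esub> z \<odot>\<^bsub>H\<^esub> v))) (J h) = hinner H g h"
  shows "U (J g) = J v"
proof -
  let ?x = "J (g \<ominus>\<^bsub>H\<^esub> z \<odot>\<^bsub>H\<^esub> v)"
  define y where "y = K.resolvent U z ?x"
  have xc: "?x \<in> carrier K" using g by (simp add: J_closed)
  have y: "y \<in> carrier K" "U y \<in> carrier K"
    using K.resolvent_closed[OF U z(1) xc] K.hunitary_closed[OF U] by (auto simp: y_def)
  have Jg: "J g \<in> carrier K" and Jv: "J v \<in> carrier K" using g J_closed by auto
  define w where "w = y \<ominus>\<^bsub>K\<^esub> J g"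
  define u where "u = U y \<ominus>\<^bsub>K\<^esub> J v"
  have wc: "w \<in> carrier K" and uc: "u \<in> carrier K" using y Jg Jv by (auto simp: w_def u_def)
  have wu: "w = z \<odot>\<^bsub>K\<^esub> u"
  proof (rule K.vector_eqI)
    fix k assume k: "k \<in> carrier K"
    have "hinner K ?x k = hinner K y k - z * hinner K (U y) k"
      unfolding y_def by (rule K.resolvent_inner(1)[OF U z(1) xc k])
    moreover have "hinner K ?x k = hinner K (J g) k - z * hinner K (J v) k"
      using g Jg Jv k by (simp add: J_minus J_scale K.inner_simps)
    ultimately show "hinner K w k = hinner K (z \<odot>\<^bsub>K\<^esub> u) k"
      using y Jg Jv k by (simp add: w_def u_def K.inner_simps algebra_simps)
  qed (use wc uc in auto)
  have w_perp: "hinner K w (J h) = 0" if h: "h \<in> carrier H" for h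
    using res[OF h] y Jg J_closed[OF h] J_inner[OF g(1) h] by (simp add: w_def y_def K.inner_simps)
  then have u_perp: "hinner K u (J h) = 0" if "h \<in> carrier H" for h
    using that z(2) uc J_closed[OF that] by (fastforce simp: wu K.inner_simps)
  have pyth: "(hnorm K a)\<^sup>2 = (hnorm K (a \<ominus>\<^bsub>K\<^esub> J h))\<^sup>2 + (hnorm H h)\<^sup>2"
    if a: "a \<in> carrier K" and h: "h \<in> carrier H" and perp: "hinner K (a \<ominus>\<^bsub>K\<^esub> J h) (J h) = 0" for a h
  proof -
    have Jh: "J h \<in> carrier K" using J_closed[OF h] .
    have "hinner K a (J h) = hinner H h h"
      using perp a Jh J_inner[OF h h] by (simp add: K.inner_simps)
    moreover have "hinner K (J h) a = cnj (hinner K a (J h))" by (rule K.inner_commute[OF Jh a])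
    ultimately have "Re (hinner K (a \<ominus>\<^bsub>K\<^esub> J h) (a \<ominus>\<^bsub>K\<^esub> J h)) = Re (hinner K a a) - Re (hinner H h h)"
      using a Jh J_inner[OF h h] by (simp add: K.inner_simps)
    then show ?thesis using a h Jh by (simp add: K.norm_sq H.norm_sq)
  qed
  have "(hnorm K w)\<^sup>2 = (hnorm K u)\<^sup>2"
    using pyth[OF y(1) g(1)] pyth[OF y(2) g(2)] w_perp[OF g(1)] u_perp[OF g(2)] iso K.hunitary_norm[OF U y(1)]
    by (simp add: w_def u_def)
  then have "hnorm K w = hnorm K u" using wc uc by (simp add: K.norm_ge_0 power2_eq_iff_nonneg)
  then have "cmod z * hnorm K u = hnorm K u" using K.norm_scale[OF uc, of z] by (simp add: wu)
  then have "hnorm K u = 0" "hnorm K w = 0"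
    using z(1) \<open>hnorm K w = hnorm K u\<close> by (auto simp: Te_def)
  then have "U y = J v" "y = J g"
    using K.dist_zero_iff y Jg Jv by (auto simp: w_def u_def)
  then show ?thesis by simp
qed

end

section \<open>Extension to infinity\<close>

text \<open>The normalisation of the class \<open>H\<^sub>2\<close> leaves no choice for the values at infinity: they are minus the
  values at zero.\<close>

definition ext_inf :: "(complex \<Rightarrow> complex) \<Rightarrow> complex option \<Rightarrow> complex" where
  "ext_inf f z = (case z of None \<Rightarrow> - f 0 | Some w \<Rightarrow> f w)"

definition ext2_inf :: "(complex \<Rightarrow> complex \<Rightarrow> complex) \<Rightarrow> complex option \<Rightarrow> complex option \<Rightarrow> complex" where
  "ext2_inf f z1 z2 = ext_inf (\<lambda>w. ext_inf (f w) z2) z1"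

text \<open>Every value of the extension is a multiple of one finite value, at a point that does not depend on
  the function. Hence linear relations between functions pass to their extensions.\<close>

lemma ext2_inf_form:
  assumes "z1 \<in> Te_inf" "z2 \<in> Te_inf"
  obtains s w1 w2 where "w1 \<in> Te" "w2 \<in> Te" "\<And>f. ext2_inf f z1 z2 = s * f w1 w2"
proof -
  have one: "\<exists>s. \<exists>w\<in>Te. \<forall>f. ext_inf f z = s * f w" if "z \<in> Te_inf" for z
  proof (cases z)
    case None
    then show ?thesis by (intro exI[of _ "- 1"] bexI[of _ 0]) (auto simp: ext_inf_def)
  next
    case (Some w)
    then have "w \<in> Te" using that by (auto simp: Te_inf_def)
    then show ?thesis using Some by (intro exI[of _ 1] bexI[of _ w]) (auto simp: ext_inf_def)
  qed
  obtain s1 w1 where 1: "w1 \<in> Te" "\<And>f. ext_inf f z1 = s1 * f w1" using one[OF assms(1)] by blast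
  obtain s2 w2 where 2: "w2 \<in> Te" "\<And>f. ext_inf f z2 = s2 * f w2" using one[OF assms(2)] by blast
  show thesis by (rule that[OF 1(1) 2(1), of "s1 * s2"]) (simp add: ext2_inf_def 1(2) 2(2))
qed

lemma ext2_inf_Some [simp]: "ext2_inf f (Some z1) (Some z2) = f z1 z2"
  by (simp add: ext2_inf_def ext_inf_def)

lemma class_H2_eq_ext2_inf:
  assumes F: "class_H2 F" and f: "\<And>z1 z2. \<lbrakk>z1 \<in> Te; z2 \<in> Te\<rbrakk> \<Longrightarrow> F (Some z1) (Some z2) = f z1 z2"
    and z: "z1 \<in> Te_inf" "z2 \<in> Te_inf"
  shows "F z1 z2 = ext2_inf f z1 z2"
proof -
  have c: "F z1 None = - F z1 (Some 0)" "F None z1 = - F (Some 0) z1" if "z1 \<in> Te_inf" for z1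
    using F that unfolding class_H2_def by (auto simp: eq_neg_iff_add_eq_0 add.commute)
  have T: "Some 0 \<in> Te_inf" "None \<in> Te_inf" by (auto simp: Te_inf_def)
  show ?thesis
    using z c T by (cases z1; cases z2) (auto simp: ext2_inf_def ext_inf_def Te_inf_def f)
qed

lemma charts_holomorphic_add:
  "\<lbrakk>charts_holomorphic F; charts_holomorphic G\<rbrakk> \<Longrightarrow> charts_holomorphic (\<lambda>z1 z2. F z1 z2 + G z1 z2)"
  by (simp add: charts_holomorphic_def holomorphic2_add)

lemma charts_holomorphic_scale:
  "charts_holomorphic F \<Longrightarrow> charts_holomorphic (\<lambda>z1 z2. c * F z1 z2)"
  by (simp add: charts_holomorphic_def holomorphic2_scale)

lemma has_moments_at_zero:
  assumes "has_moments \<phi> \<gamma>" shows "\<gamma> 0 = \<phi> (Some 0)"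
proof -
  define a where "a n = (if n = 0 then 1 else 2) * \<gamma> (int n)" for n
  have "(\<lambda>n. a n * 0 ^ n) sums \<phi> (Some 0)"
    unfolding a_def by (rule assms[unfolded has_moments_def, rule_format, THEN conjunct1]) simp
  then have "a 0 = \<phi> (Some 0)" by (rule sums_unique2[OF powser_sums_zero])
  then show ?thesis by (simp add: a_def)
qed

lemma has_moments2_at_zero:
  assumes "has_moments2 F \<gamma>" shows "\<gamma> (0, 0) = F (Some 0) (Some 0)"
proof -
  obtain c where "\<And>z. z \<in> Te_inf \<Longrightarrow> has_moments (F z) (c z)" "\<And>n. has_moments (\<lambda>z. c z n) (\<lambda>m. \<gamma> (m, n))"
    using assms unfolding has_moments2_def by metis
  from this(1)[of "Some 0", THEN has_moments_at_zero] this(2)[of 0, THEN has_moments_at_zero]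
  show ?thesis by (simp add: Te_inf_def)
qed

context complex_hilbert_space
begin

primrec lincomb :: "(nat \<Rightarrow> complex) \<Rightarrow> (nat \<Rightarrow> 'a) \<Rightarrow> nat \<Rightarrow> 'a" where
  "lincomb a x 0 = \<zero>"
| "lincomb a x (Suc n) = lincomb a x n \<oplus> a n \<odot> x n"

lemma lincomb_closed: "(\<And>i. i < n \<Longrightarrow> x i \<in> carrier H) \<Longrightarrow> lincomb a x n \<in> carrier H"
  by (induction n) auto

lemma lincomb_form:
  assumes A: "hlinear H H A" and x: "\<And>i. i < n \<Longrightarrow> x i \<in> carrier H"
  shows "\<langle>A (lincomb a x n), lincomb a x n\<rangle> = (\<Sum>i<n. \<Sum>j<n. a i * cnj (a j) * \<langle>A (x i), x j\<rangle>)"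
proof -
  have left: "\<langle>A (lincomb a x n), g\<rangle> = (\<Sum>i<n. a i * \<langle>A (x i), g\<rangle>)"
    if "g \<in> carrier H" "\<And>i. i < n \<Longrightarrow> x i \<in> carrier H" for n g
    using that(2)
  proof (induction n)
    case 0
    have "A \<zero> = A (0 \<odot> \<zero>)" using zero_closed by (auto intro!: arg_cong[of _ _ A] vector_eqI simp: inner_simps)
    also have "\<dots> = 0 \<odot> A \<zero>" by (rule hlinearD(3)[OF A zero_closed])
    finally have "\<langle>A \<zero>, g\<rangle> = 0 * \<langle>A \<zero>, g\<rangle>"
      using inner_scale_left[OF hlinearD(1)[OF A zero_closed] that(1), of 0] by simp
    then show ?case by simp
  next
    case (Suc n)
    then show ?case
      using lincomb_closed[of n x a] hlinearD[OF A] that(1) by (simp add: inner_simps)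
  qed
  have right: "\<langle>g, lincomb a x n\<rangle> = (\<Sum>j<n. cnj (a j) * \<langle>g, x j\<rangle>)"
    if "g \<in> carrier H" "\<And>i. i < n \<Longrightarrow> x i \<in> carrier H" for n g
    using that(2)
  proof (induction n)
    case (Suc n)
    then show ?case using lincomb_closed[of n x a] that(1) by (simp add: inner_simps)
  qed (simp add: inner_simps that(1))
  have "\<langle>A (lincomb a x n), lincomb a x n\<rangle> = (\<Sum>i<n. a i * \<langle>A (x i), lincomb a x n\<rangle>)"
    by (intro left lincomb_closed x)
  also have "\<dots> = (\<Sum>i<n. a i * (\<Sum>j<n. cnj (a j) * \<langle>A (x i), x j\<rangle>))"
    by (intro sum.cong refl arg_cong2[of _ _ _ _ "(*)"] right hlinearD(1)[OF A] x) auto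
  finally show ?thesis by (simp add: sum_distrib_left mult.assoc)
qed

text \<open>The squared norms of \<open>J (x + y) - J x - J y\<close> and \<open>J (c x) - c J x\<close> expand into inner products,
  which are the same as for \<open>J = id\<close>.\<close>

lemma isometry_linear:
  assumes K: "complex_hilbert_space K" and J: "\<And>x. x \<in> carrier H \<Longrightarrow> J x \<in> carrier K"
    and iso: "\<And>x y. \<lbrakk>x \<in> carrier H; y \<in> carrier H\<rbrakk> \<Longrightarrow> hinner K (J x) (J y) = \<langle>x, y\<rangle>"
  shows "hlinear H K J"
proof -
  interpret K: complex_hilbert_space K by fact
  have "J (x \<oplus> y) = J x \<oplus>\<^bsub>K\<^esub> J y" if "x \<in> carrier H" "y \<in> carrier H" for x y
  proof (rule K.minus_eq_zeroD)
    show "J (x \<oplus> y) \<ominus>\<^bsub>K\<^esub> (J x \<oplus>\<^bsub>K\<^esub> J y) = \<zero>\<^bsub>K\<^esub>"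
      by (rule K.inner_eq_zero) (use that J in \<open>simp_all add: K.inner_simps iso inner_simps\<close>)
  qed (use that J in auto)
  moreover have "J (c \<odot> x) = c \<odot>\<^bsub>K\<^esub> J x" if "x \<in> carrier H" for c x
  proof (rule K.minus_eq_zeroD)
    show "J (c \<odot> x) \<ominus>\<^bsub>K\<^esub> (c \<odot>\<^bsub>K\<^esub> J x) = \<zero>\<^bsub>K\<^esub>"
      by (rule K.inner_eq_zero) (use that J in \<open>simp_all add: K.inner_simps iso inner_simps\<close>)
  qed (use that J in auto)
  ultimately show ?thesis using J by (auto simp: hlinear_def)
qed

end


section \<open>Unitary dilation of the operator function\<close>

context complex_hilbert_space
begin

text \<open>Membership of the quadratic forms \<open>\<langle>R h, h\<rangle>\<close> in the class \<open>H\<^sub>2\<close> gives, by polarisation, moments of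
  all functions \<open>\<langle>R x, y\<rangle>\<close>.\<close>

lemma polarised_moments_exist:
  assumes R: "\<And>z1 z2. \<lbrakk>z1 \<in> Te; z2 \<in> Te\<rbrakk> \<Longrightarrow> hlinear H H (R z1 z2)"
    and F: "\<And>h. h \<in> carrier H \<Longrightarrow> class_H2 (F h)"
    and FR: "\<And>h z1 z2. \<lbrakk>h \<in> carrier H; z1 \<in> Te; z2 \<in> Te\<rbrakk> \<Longrightarrow> F h (Some z1) (Some z2) = \<langle>R z1 z2 h, h\<rangle>"
    and x: "x \<in> carrier H" and y: "y \<in> carrier H"
  shows "\<exists>\<gamma>. has_moments2 (ext2_inf (\<lambda>z1 z2. \<langle>R z1 z2 x, y\<rangle>)) \<gamma>"
proof -
  define G where "G z1 z2 = (1/4) * (F (x \<oplus> y) z1 z2 + (- 1) * F (x \<ominus> y) z1 z2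
    + \<i> * F (x \<oplus> \<i> \<odot> y) z1 z2 + (- \<i>) * F (x \<ominus> \<i> \<odot> y) z1 z2)" for z1 z2
  have c: "x \<oplus> y \<in> carrier H" "x \<ominus> y \<in> carrier H" "x \<oplus> \<i> \<odot> y \<in> carrier H" "x \<ominus> \<i> \<odot> y \<in> carrier H"
    using x y by auto
  have F_hol: "charts_holomorphic (F h)" if "h \<in> carrier H" for h
    using F[OF that] unfolding class_H2_def charts_holomorphic_def by blast
  have "\<exists>\<gamma>. has_moments2 G \<gamma>"
  proof (rule has_moments2_exist)
    show "charts_holomorphic G"
      unfolding G_def by (intro charts_holomorphic_add charts_holomorphic_scale F_hol c)
    have "F h z (Some 0) + F h z None = 0" "F h (Some 0) z + F h None z = 0"
      if "z \<in> Te_inf" "h \<in> carrier H" for z h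
      using F[OF that(2)] that(1) unfolding class_H2_def by blast+
    then have b: "F h z None = - F h z (Some 0)" "F h None z = - F h (Some 0) z"
      if "z \<in> Te_inf" "h \<in> carrier H" for z h
      using that by (simp_all add: eq_neg_iff_add_eq_0 add.commute)
    show "G z (Some 0) + G z None = 0" "G (Some 0) z + G None z = 0" if "z \<in> Te_inf" for z
      by (simp_all add: G_def b[OF that] c algebra_simps)
  qed
  then obtain \<gamma> where \<gamma>: "has_moments2 G \<gamma>" by blast
  have "has_moments2 (ext2_inf (\<lambda>z1 z2. \<langle>R z1 z2 x, y\<rangle>)) \<gamma>"
  proof (rule has_moments2_cong[OF _ \<gamma>])
    fix z1 z2 assume z: "z1 \<in> Te_inf" "z2 \<in> Te_inf"
    obtain s w1 w2 where w: "w1 \<in> Te" "w2 \<in> Te" and s: "\<And>f. ext2_inf f z1 z2 = s * f w1 w2"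
      using ext2_inf_form[OF z] by metis
    have Fe: "F h z1 z2 = s * \<langle>R w1 w2 h, h\<rangle>" if "h \<in> carrier H" for h
      using class_H2_eq_ext2_inf[OF F[OF that] FR[OF that] z] by (simp add: s)
    note lin = hlinearD[OF R[OF w]]
    have "\<langle>R w1 w2 x, y\<rangle> = (1/4) * (\<langle>R w1 w2 (x \<oplus> y), x \<oplus> y\<rangle> + (- 1) * \<langle>R w1 w2 (x \<ominus> y), x \<ominus> y\<rangle>
      + \<i> * \<langle>R w1 w2 (x \<oplus> \<i> \<odot> y), x \<oplus> \<i> \<odot> y\<rangle> + (- \<i>) * \<langle>R w1 w2 (x \<ominus> \<i> \<odot> y), x \<ominus> \<i> \<odot> y\<rangle>)"
      using x y by (simp add: lin inner_simps algebra_simps)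
    then show "ext2_inf (\<lambda>z1 z2. \<langle>R z1 z2 x, y\<rangle>) z1 z2 = G z1 z2"
      unfolding s G_def by (simp only: Fe c) (simp add: algebra_simps)
  qed
  then show ?thesis by blast
qed

text \<open>Let \<open>c p x y\<close> be the moments of \<open>\<langle>R x, y\<rangle>\<close>. They are sesquilinear in \<open>x, y\<close> since moments are
  unique, and positive definite in \<open>p\<close> since the positivity condition of the class \<open>H\<^sub>2\<close> holds for
  every linear combination of the vectors involved. Their dilation has \<open>\<langle>U\<^sub>1\<^sup>m U\<^sub>2\<^sup>n x, y\<rangle> = c (m, n) x y\<close>, and these are also the
  moments of the compressed product of Cayley transforms; functions with equal moments agree.\<close>

theorem generalized_resolvent_dilation:
  assumes R: "\<And>z1 z2. \<lbrakk>z1 \<in> Te; z2 \<in> Te\<rbrakk> \<Longrightarrow> hlinear H H (R z1 z2)"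
    and R0: "\<And>h. h \<in> carrier H \<Longrightarrow> R 0 0 h = h"
    and F: "\<And>h. h \<in> carrier H \<Longrightarrow> class_H2 (F h)"
    and FR: "\<And>h z1 z2. \<lbrakk>h \<in> carrier H; z1 \<in> Te; z2 \<in> Te\<rbrakk> \<Longrightarrow> F h (Some z1) (Some z2) = \<langle>R z1 z2 h, h\<rangle>"
  obtains K :: "((int \<times> int \<Rightarrow> 'a) + 'k) hspace" and J U1 U2
  where "complex_hilbert_space K" "hembedding H K J" "hunitary K U1" "hunitary K U2"
    "\<And>x. x \<in> carrier K \<Longrightarrow> U1 (U2 x) = U2 (U1 x)"
    "\<And>z1 z2 x y. \<lbrakk>z1 \<in> Te; z2 \<in> Te; x \<in> carrier H; y \<in> carrier H\<rbrakk>
      \<Longrightarrow> hinner K (cayley K U1 z1 (cayley K U2 z2 (J x))) (J y) = \<langle>R z1 z2 x, y\<rangle>"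
proof -
  define f where "f x y = ext2_inf (\<lambda>z1 z2. \<langle>R z1 z2 x, y\<rangle>)" for x y
  have "\<forall>x\<in>carrier H. \<forall>y\<in>carrier H. \<exists>\<gamma>. has_moments2 (f x y) \<gamma>"
    unfolding f_def using polarised_moments_exist[OF R F FR] by blast
  then obtain g where g: "\<And>x y. \<lbrakk>x \<in> carrier H; y \<in> carrier H\<rbrakk> \<Longrightarrow> has_moments2 (f x y) (g x y)"
    by metis
  have f_form: "\<exists>s w1 w2. w1 \<in> Te \<and> w2 \<in> Te \<and> (\<forall>x y. f x y z1 z2 = s * \<langle>R w1 w2 x, y\<rangle>)"
    if z: "z1 \<in> Te_inf" "z2 \<in> Te_inf" for z1 z2
    using ext2_inf_form[OF z] unfolding f_def by metis
  define c where "c p x y = g x y p" for p x y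
  have c_comb: "c p x x' = a * c p y y' + b * c p z z'"
    if car: "x \<in> carrier H" "x' \<in> carrier H" "y \<in> carrier H" "y' \<in> carrier H" "z \<in> carrier H" "z' \<in> carrier H"
      and R_comb: "\<And>w1 w2. \<lbrakk>w1 \<in> Te; w2 \<in> Te\<rbrakk>
        \<Longrightarrow> \<langle>R w1 w2 x, x'\<rangle> = a * \<langle>R w1 w2 y, y'\<rangle> + b * \<langle>R w1 w2 z, z'\<rangle>" for p x x' y y' z z' a b
  proof -
    have m: "has_moments2 (\<lambda>z1 z2. a * f y y' z1 z2 + b * f z z' z1 z2) (\<lambda>p. a * g y y' p + b * g z z' p)"
      by (intro has_moments2_add has_moments2_scale g car)
    have e: "f x x' z1 z2 = a * f y y' z1 z2 + b * f z z' z1 z2"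
      if z: "z1 \<in> Te_inf" "z2 \<in> Te_inf" for z1 z2
    proof -
      obtain s w1 w2 where w: "w1 \<in> Te" "w2 \<in> Te" "\<And>x y. f x y z1 z2 = s * \<langle>R w1 w2 x, y\<rangle>"
        using f_form[OF z] by metis
      show ?thesis unfolding w(3) R_comb[OF w(1,2)] by (simp add: algebra_simps)
    qed
    have "g x x' = (\<lambda>p. a * g y y' p + b * g z z' p)"
      by (rule has_moments2_unique[OF g[OF car(1,2)] has_moments2_cong[OF e m]])
    then show ?thesis by (simp add: c_def)
  qed
  have add: "c p (x \<oplus> y) z = c p x z + c p y z"
    if "x \<in> carrier H" "y \<in> carrier H" "z \<in> carrier H" for p x y z
    using c_comb[of "x \<oplus> y" z x z y z 1 1] that hlinearD[OF R] by (simp add: inner_simps)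
  have scale_left: "c p (a \<odot> x) y = a * c p x y" if "x \<in> carrier H" "y \<in> carrier H" for p x y a
    using c_comb[of "a \<odot> x" y x y x y a 0] that hlinearD[OF R] by (simp add: inner_simps)
  have scale_right: "c p x (a \<odot> y) = cnj a * c p x y" if "x \<in> carrier H" "y \<in> carrier H" for p x y a
    using c_comb[of x "a \<odot> y" x y x y "cnj a" 0] that hlinearD[OF R] by (simp add: inner_simps)
  have zero: "c 0 x y = \<langle>x, y\<rangle>" if "x \<in> carrier H" "y \<in> carrier H" for x y
    using has_moments2_at_zero[OF g[OF that]] that by (simp add: c_def f_def R0 zero_prod_def)
  have psd: "(\<Sum>(p, x)\<leftarrow>xs. \<Sum>(q, y)\<leftarrow>xs. c (p - q) x y) \<in> \<real>\<^sub>\<ge>\<^sub>0"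
    if xs: "snd ` set xs \<subseteq> carrier H" for xs
  proof -
    \<comment> \<open>The positivity condition for \<open>v = \<Sum> a\<^sub>i x\<^sub>i\<close>, expanded in the coefficients \<open>a\<^sub>i\<close>, is the positivity needed for the moments.\<close>
    define N p x where "N = length xs" and "p i = fst (xs ! i)" and "x i = snd (xs ! i)" for i
    have x: "x i \<in> carrier H" if "i < N" for i
      using xs that by (auto simp: x_def N_def image_subset_iff)
    have "(\<Sum>i<N. \<Sum>j<N. g (x i) (x j) (p i - p j)) \<in> \<real>\<^sub>\<ge>\<^sub>0"
    proof (rule moments_positive_definite)
      show "has_moments2 (f (x i) (x j)) (g (x i) (x j))" if "i < N" "j < N" for i j
        by (intro g x that)
      fix w1 w2 :: complex and a :: "nat \<Rightarrow> complex" assume w: "cmod w1 < 1" "cmod w2 < 1"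
      define v where "v = lincomb a x N"
      have v: "v \<in> carrier H" unfolding v_def by (intro lincomb_closed x)
      have sum_f: "(\<Sum>i<N. \<Sum>j<N. a i * cnj (a j) * f (x i) (x j) z1 z2) = F v z1 z2"
        if z: "z1 \<in> Te_inf" "z2 \<in> Te_inf" for z1 z2
      proof -
        obtain s w1 w2 where w: "w1 \<in> Te" "w2 \<in> Te" "\<And>x y. f x y z1 z2 = s * \<langle>R w1 w2 x, y\<rangle>"
          using f_form[OF z] by metis
        have "F v z1 z2 = f v v z1 z2"
          unfolding f_def by (rule class_H2_eq_ext2_inf[OF F[OF v] FR[OF v] z])
        also have "\<dots> = s * (\<Sum>i<N. \<Sum>j<N. a i * cnj (a j) * \<langle>R w1 w2 (x i), x j\<rangle>)"
          unfolding w(3) v_def using lincomb_form[OF R[OF w(1,2)] x] by simp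
        finally show ?thesis by (simp add: w(3) sum_distrib_left mult_ac)
      qed
      have z: "Some w1 \<in> Te_inf" "Some w2 \<in> Te_inf" "reflect (Some w1) \<in> Te_inf" "reflect (Some w2) \<in> Te_inf"
        using disc_in_Te w reflect_in_Te_inf by (auto simp: Te_inf_def)
      have "(\<Sum>i<N. \<Sum>j<N. a i * cnj (a j) * poisson2 (f (x i) (x j)) w1 w2) = poisson2 (F v) w1 w2"
        unfolding poisson2_def sum_f[OF z(1,2), symmetric] sum_f[OF z(3,2), symmetric]
          sum_f[OF z(1,4), symmetric] sum_f[OF z(3,4), symmetric]
        by (simp add: algebra_simps sum.distrib sum_subtractf)
      moreover have "poisson2 (F v) w1 w2 \<in> \<real>\<^sub>\<ge>\<^sub>0"
        using F[OF v] w unfolding class_H2_def poisson2_def Let_def by blast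
      ultimately show "(\<Sum>i<N. \<Sum>j<N. a i * cnj (a j) * poisson2 (f (x i) (x j)) w1 w2) \<in> \<real>\<^sub>\<ge>\<^sub>0" by simp
    qed
    then show ?thesis
      by (simp add: sum_list_sum_nth case_prod_unfold atLeast0LessThan c_def N_def p_def x_def)
  qed
  obtain K :: "((int \<times> int \<Rightarrow> 'a) + 'k) hspace" and E U1 U2 where K: "complex_hilbert_space K"
    and E: "\<And>p x. x \<in> carrier H \<Longrightarrow> E p x \<in> carrier K"
    and E_inner: "\<And>p q x y. \<lbrakk>x \<in> carrier H; y \<in> carrier H\<rbrakk> \<Longrightarrow> hinner K (E p x) (E q y) = c (p - q) x y"
    and U: "hunitary K U1" "hunitary K U2" and comm: "\<And>x. x \<in> carrier K \<Longrightarrow> U1 (U2 x) = U2 (U1 x)"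
    and UE: "\<And>p x. x \<in> carrier H \<Longrightarrow> U1 (E p x) = E (p + (1, 0)) x"
      "\<And>p x. x \<in> carrier H \<Longrightarrow> U2 (E p x) = E (p + (0, 1)) x"
    by (rule lattice_dilation[of c, OF add scale_left scale_right zero psd]) blast+
  interpret K: complex_hilbert_space K by fact
  have shift: "K.upow U k (E p x) = E (p + (of_int k * fst d, of_int k * snd d)) x"
    if "hunitary K U" and x: "x \<in> carrier H" and U: "\<And>p. U (E p x) = E (p + d) x" for U k p x d
  proof -
    have inv: "K.uinv U (E p x) = E (p - d) x" for p
      using U[of "p - d"] K.uinv_cancel(1)[OF \<open>hunitary K U\<close> E[OF x], of "p - d"] by simp
    have "(U ^^ n) (E p x) = E (p + (int n * fst d, int n * snd d)) x" for n
      by (induction n) (auto simp: U algebra_simps plus_prod_def)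
    moreover have "(K.uinv U ^^ n) (E p x) = E (p + (- int n * fst d, - int n * snd d)) x" for n
      by (induction n) (auto simp: inv algebra_simps plus_prod_def minus_prod_def)
    ultimately show ?thesis by (simp add: K.upow_def)
  qed
  define J where "J = E 0"
  have J: "J x \<in> carrier K" if "x \<in> carrier H" for x using E[OF that] by (simp add: J_def)
  have J_iso: "hinner K (J x) (J y) = \<langle>x, y\<rangle>" if "x \<in> carrier H" "y \<in> carrier H" for x y
    using E_inner[OF that, of 0 0] zero[OF that] by (simp add: J_def)
  show thesis
  proof (rule that[of K J U1 U2])
    show "hembedding H K J"
      using isometry_linear[OF K J J_iso] J_iso by (simp add: hembedding_def)
    fix z1 z2 x y assume z: "z1 \<in> Te" "z2 \<in> Te" and x: "x \<in> carrier H" and y: "y \<in> carrier H"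
    have "K.upow U1 m (K.upow U2 n (J x)) = E (m, n) x" for m n
      using shift[OF U(1) x UE(1)[OF x]] shift[OF U(2) x UE(2)[OF x]] by (simp add: J_def)
    then have "hinner K (K.upow U1 m (K.upow U2 n (J x))) (J y) = c (m, n) x y" for m n
      using E_inner[OF x y, of "(m, n)" 0] by (simp add: J_def)
    then have "has_moments2 (\<lambda>z1 z2. hinner K (K.cayley_ext U1 z1 (K.cayley_ext U2 z2 (J x))) (J y)) (g x y)"
      using K.cayley_ext_moments2[OF U comm J[OF x] J[OF y]] by (simp add: c_def case_prod_unfold)
    then have "hinner K (K.cayley_ext U1 (Some z1) (K.cayley_ext U2 (Some z2) (J x))) (J y) = f x y (Some z1) (Some z2)"
      by (rule has_moments2_determine[OF _ g[OF x y]]) (use z in \<open>auto simp: Te_inf_def\<close>)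
    then show "hinner K (cayley K U1 z1 (cayley K U2 z2 (J x))) (J y) = \<langle>R z1 z2 x, y\<rangle>"
      by (simp add: f_def)
  qed (use K U comm in auto)
qed

end

section \<open>The characterisation\<close>

lemma closed_isometric_operatorD:
  assumes "closed_isometric_operator H V" "g \<in> dom V"
  shows "g \<in> carrier H" "the (V g) \<in> carrier H" "hnorm H (the (V g)) = hnorm H g"
  using assms unfolding closed_isometric_operator_def linear_operator_def by (auto intro: ranI)

text \<open>\<open>Te\<close> misses only the unit circle, which does not affect limits at infinity.\<close>

lemma limit_extension_cong:
  assumes "limit_extension f F" "\<And>z1 z2. \<lbrakk>z1 \<in> Te; z2 \<in> Te\<rbrakk> \<Longrightarrow> f z1 z2 = g z1 z2"
  shows "limit_extension g F"
proof -
  have ev: "\<forall>\<^sub>F z in at_infinity. z \<in> Te"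
    unfolding eventually_at_infinity by (intro exI[of _ 2]) (auto simp: Te_def)
  have transf: "(q \<longlongrightarrow> l) at_infinity" if "(p \<longlongrightarrow> l) at_infinity" "\<And>z. z \<in> Te \<Longrightarrow> p z = q z"
    for p q :: "complex \<Rightarrow> complex" and l
    by (rule Lim_transform_eventually[OF that(1) eventually_mono[OF ev that(2)]])
  have "((\<lambda>z1. g z1 z2) \<longlongrightarrow> l) at_infinity" if "((\<lambda>z1. f z1 z2) \<longlongrightarrow> l) at_infinity" "z2 \<in> Te" for z2 l
    by (rule transf[OF that(1)]) (use that assms(2) in simp)
  moreover have "((\<lambda>z2. g z1 z2) \<longlongrightarrow> l) at_infinity" if "((\<lambda>z2. f z1 z2) \<longlongrightarrow> l) at_infinity" "z1 \<in> Te" for z1 l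
    by (rule transf[OF that(1)]) (use that assms(2) in simp)
  ultimately show ?thesis using assms unfolding limit_extension_def by simp
qed

theorem theorem4:
  fixes H :: "'a hspace"
    and R :: "complex \<Rightarrow> complex \<Rightarrow> 'a \<Rightarrow> 'a"
    and V1 V2 :: "'a \<rightharpoonup> 'a"
  assumes "complex_hilbert_space H"
    and "\<And>z1 z2. z1 \<in> Te \<Longrightarrow> z2 \<in> Te \<Longrightarrow> hbounded_linear H (R z1 z2)"
    and "closed_isometric_operator H V1"
    and "closed_isometric_operator H V2"
    and "\<And>h. h \<in> dom (V1 \<circ>\<^sub>m V2) \<inter> dom (V2 \<circ>\<^sub>m V1) \<Longrightarrow> (V1 \<circ>\<^sub>m V2) h = (V2 \<circ>\<^sub>m V1) h"
  shows "generalized_resolvent TYPE((int \<times> int \<Rightarrow> 'a) + 'k) H V1 V2 R \<longleftrightarrow>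
      (\<forall>h\<in>carrier H. R 0 0 h = h) \<and>
      (\<forall>z1\<in>Te - {0}. \<forall>z2\<in>Te - {0}. is_adjoint H (R z1 z2) (R (1 / cnj z1) (1 / cnj z2))) \<and>
      (\<forall>h\<in>carrier H. \<exists>F. limit_extension (\<lambda>z1 z2. hinner H (R z1 z2 h) h) F \<and> class_H2 F) \<and>
      (\<forall>\<zeta>\<in>Te. \<forall>g\<in>dom V1. let x = g \<ominus>\<^bsub>H\<^esub> \<zeta> \<odot>\<^bsub>H\<^esub> the (V1 g)
         in (1 / 2) \<odot>\<^bsub>H\<^esub> (x \<oplus>\<^bsub>H\<^esub> R \<zeta> 0 x) = g) \<and>
      (\<forall>\<zeta>\<in>Te. \<forall>g\<in>dom V2. let x = g \<ominus>\<^bsub>H\<^esub> \<zeta> \<odot>\<^bsub>H\<^esub> the (V2 g)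
         in (1 / 2) \<odot>\<^bsub>H\<^esub> (x \<oplus>\<^bsub>H\<^esub> R 0 \<zeta> x) = g)"
    (is "?resolvent \<longleftrightarrow> ?c1 \<and> ?c2 \<and> ?c3 \<and> ?c4 \<and> ?c5")
proof
  interpret H: complex_hilbert_space H by fact
  have R_lin: "hlinear H H (R z1 z2)" if "z1 \<in> Te" "z2 \<in> Te" for z1 z2
    using assms(2)[OF that] by (simp add: hbounded_linear_def)
  note R_closed = H.hlinearD(1)[OF R_lin]
  note V1 = closed_isometric_operatorD[OF assms(3)] and V2 = closed_isometric_operatorD[OF assms(4)]
  {
    assume ?resolvent
    then obtain K :: "((int \<times> int \<Rightarrow> 'a) + 'k) hspace" and J U1 U2 where
      ext_all: "complex_hilbert_space K \<and> hembedding H K J \<and>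
       hunitary K U1 \<and> hunitary K U2 \<and> (\<forall>x\<in>carrier K. U1 (U2 x) = U2 (U1 x)) \<and>
       (\<forall>h\<in>dom V1. U1 (J h) = J (the (V1 h))) \<and>
       (\<forall>h\<in>dom V2. U2 (J h) = J (the (V2 h))) \<and>
       (\<forall>z1\<in>Te. \<forall>z2\<in>Te. \<forall>h\<in>carrier H.
          is_orth_proj K (J ` carrier H) (cayley K U1 z1 (cayley K U2 z2 (J h))) (J (R z1 z2 h)))"
      unfolding generalized_resolvent_def by (elim exE) (rule that)
    then have K: "complex_hilbert_space K" and J: "hembedding H K J" and U: "hunitary K U1" "hunitary K U2"
      and comm: "\<And>x. x \<in> carrier K \<Longrightarrow> U1 (U2 x) = U2 (U1 x)"
      and ext: "\<And>h. h \<in> dom V1 \<Longrightarrow> U1 (J h) = J (the (V1 h))" "\<And>h. h \<in> dom V2 \<Longrightarrow> U2 (J h) = J (the (V2 h))"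
      and proj: "\<And>z1 z2 h. \<lbrakk>z1 \<in> Te; z2 \<in> Te; h \<in> carrier H\<rbrakk>
        \<Longrightarrow> is_orth_proj K (J ` carrier H) (cayley K U1 z1 (cayley K U2 z2 (J h))) (J (R z1 z2 h))"
      by blast+
    interpret unitary_extension H K J
      by (intro unitary_extension.intro unitary_extension_axioms.intro assms(1) K J)
    have R_inner: "hinner H (R z1 z2 x) y = hinner K (cayley K U1 z1 (cayley K U2 z2 (J x))) (J y)"
      if z: "z1 \<in> Te" "z2 \<in> Te" and x: "x \<in> carrier H" and y: "y \<in> carrier H" for z1 z2 x y
    proof -
      have "hinner K (cayley K U1 z1 (cayley K U2 z2 (J x)) \<ominus>\<^bsub>K\<^esub> J (R z1 z2 x)) (J y) = 0"
        using proj[OF z x] y by (auto simp: is_orth_proj_def)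
      moreover have "cayley K U1 z1 (cayley K U2 z2 (J x)) \<in> carrier K"
        by (intro K.cayley_closed U z J_closed x)
      ultimately show ?thesis
        using J_inner[OF R_closed[OF z x] y] J_closed[OF R_closed[OF z x]] J_closed[OF y]
        by (simp add: K.inner_simps)
    qed
    have c1: ?c1
    proof
      fix h assume h: "h \<in> carrier H"
      show "R 0 0 h = h"
        by (rule H.vector_eqI)
          (use h in \<open>simp_all add: R_closed R_inner K.cayley_zero[OF U(1)] K.cayley_zero[OF U(2)] J_closed J_inner\<close>)
    qed
    have c2: ?c2
    proof (intro ballI, unfold is_adjoint_def, intro ballI)
      fix z1 z2 x y assume "z1 \<in> Te - {0}" "z2 \<in> Te - {0}" and x: "x \<in> carrier H" and y: "y \<in> carrier H"
      then have z: "z1 \<in> Te" "z1 \<noteq> 0" "z2 \<in> Te" "z2 \<noteq> 0" by auto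
      have w: "1 / cnj z1 \<in> Te" "1 / cnj z2 \<in> Te"
        using inverse_in_Te[of "cnj z1"] inverse_in_Te[of "cnj z2"] z by (simp_all add: inverse_eq_divide)
      have r: "reflect (Some z1) = Some (1 / cnj z1)" "reflect (Some z2) = Some (1 / cnj z2)"
        using z by (simp_all add: reflect_def inverse_eq_divide)
      have T: "Some z1 \<in> Te_inf" "Some z2 \<in> Te_inf" "Some (1 / cnj z1) \<in> Te_inf" "Some (1 / cnj z2) \<in> Te_inf"
        using z w by (auto simp: Te_inf_def)
      note Jx = J_closed[OF x] and Jy = J_closed[OF y]
      have "hinner H (R z1 z2 x) y = - hinner K (cayley K U2 z2 (J x)) (cayley K U1 (1 / cnj z1) (J y))"
        unfolding R_inner[OF z(1,3) x y]
        using K.cayley_ext_adjoint[OF U(1) T(1) K.cayley_closed[OF U(2) z(3) Jx] Jy] by (simp add: r)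
      also have "\<dots> = hinner K (J x) (cayley K U2 (1 / cnj z2) (cayley K U1 (1 / cnj z1) (J y)))"
        using K.cayley_ext_adjoint[OF U(2) T(2) Jx K.cayley_closed[OF U(1) w(1) Jy]] by (simp add: r)
      also have "\<dots> = hinner K (J x) (cayley K U1 (1 / cnj z1) (cayley K U2 (1 / cnj z2) (J y)))"
        using K.cayley_ext_pair_commute(2)[OF U comm T(3,4) Jy] by simp
      also have "\<dots> = cnj (hinner H (R (1 / cnj z1) (1 / cnj z2) y) x)"
        unfolding R_inner[OF w y x]
        by (intro K.inner_commute K.cayley_closed U w Jx Jy)
      also have "\<dots> = hinner H x (R (1 / cnj z1) (1 / cnj z2) y)"
        by (rule H.inner_commute[OF x R_closed[OF w y], symmetric])
      finally show "hinner H (R z1 z2 x) y = hinner H x (R (1 / cnj z1) (1 / cnj z2) y)" .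
    qed
    have c3: ?c3
    proof
      fix h assume h: "h \<in> carrier H"
      define F where "F z1 z2 = hinner K (K.cayley_ext U1 z1 (K.cayley_ext U2 z2 (J h))) (J h)" for z1 z2
      have "class_H2 F" "limit_extension (\<lambda>z1 z2. F (Some z1) (Some z2)) F"
        unfolding F_def by (rule K.cayley_ext_class_H2[OF U comm J_closed[OF h]]; assumption)+
      moreover have "F (Some z1) (Some z2) = hinner H (R z1 z2 h) h" if "z1 \<in> Te" "z2 \<in> Te" for z1 z2
        using R_inner[OF that h h] by (simp add: F_def)
      ultimately have "limit_extension (\<lambda>z1 z2. hinner H (R z1 z2 h) h) F"
        using limit_extension_cong[of "\<lambda>z1 z2. F (Some z1) (Some z2)" F] by simp
      then show "\<exists>F. limit_extension (\<lambda>z1 z2. hinner H (R z1 z2 h) h) F \<and> class_H2 F"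
        using \<open>class_H2 F\<close> by blast
    qed
    \<comment> \<open>Half of \<open>E + C(\<zeta>)\<close> is the resolvent, which takes \<open>(E - \<zeta> V) g\<close> back to \<open>g\<close>.\<close>
    have half: "(1 / 2) \<odot>\<^bsub>H\<^esub> (x \<oplus>\<^bsub>H\<^esub> y) = g"
      if x: "x = g \<ominus>\<^bsub>H\<^esub> \<zeta> \<odot>\<^bsub>H\<^esub> v" and gv: "g \<in> carrier H" "v \<in> carrier H" and y: "y \<in> carrier H"
        and \<zeta>: "\<zeta> \<in> Te" and W: "hunitary K W" "W (J g) = J v"
        and yW: "\<And>k. k \<in> carrier H \<Longrightarrow> hinner H y k = hinner K (cayley K W \<zeta> (J x)) (J k)"
      for x y g v \<zeta> W
    proof (rule H.vector_eqI)
      have xc: "x \<in> carrier H" using gv by (simp add: x)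
      fix k assume k: "k \<in> carrier H"
      have "hinner H ((1 / 2) \<odot>\<^bsub>H\<^esub> (x \<oplus>\<^bsub>H\<^esub> y)) k = hinner K (K.resolvent W \<zeta> (J x)) (J k)"
        using half_cayley[OF W(1) \<zeta> xc k] xc y k by (simp add: H.inner_simps yW)
      also have "K.resolvent W \<zeta> (J x) = J g"
        unfolding x by (rule resolvent_of_extension[OF W(1) \<zeta> gv W(2)])
      finally show "hinner H ((1 / 2) \<odot>\<^bsub>H\<^esub> (x \<oplus>\<^bsub>H\<^esub> y)) k = hinner H g k"
        using J_inner[OF gv(1) k] by simp
    qed (use gv y x in auto)
    have c4: ?c4
      unfolding Let_def
    proof (intro ballI)
      fix \<zeta> g assume \<zeta>: "\<zeta> \<in> Te" and g: "g \<in> dom V1"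
      let ?x = "g \<ominus>\<^bsub>H\<^esub> \<zeta> \<odot>\<^bsub>H\<^esub> the (V1 g)"
      have x: "?x \<in> carrier H" using V1(1,2)[OF g] by simp
      show "(1 / 2) \<odot>\<^bsub>H\<^esub> (?x \<oplus>\<^bsub>H\<^esub> R \<zeta> 0 ?x) = g"
        by (rule half[OF refl V1(1,2)[OF g] R_closed[OF \<zeta> zero_in_Te x] \<zeta> U(1) ext(1)[OF g]])
          (simp add: R_inner[OF \<zeta> zero_in_Te x] K.cayley_zero[OF U(2) J_closed[OF x]])
    qed
    have c5: ?c5
      unfolding Let_def
    proof (intro ballI)
      fix \<zeta> g assume \<zeta>: "\<zeta> \<in> Te" and g: "g \<in> dom V2"
      let ?x = "g \<ominus>\<^bsub>H\<^esub> \<zeta> \<odot>\<^bsub>H\<^esub> the (V2 g)"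
      have x: "?x \<in> carrier H" using V2(1,2)[OF g] by simp
      show "(1 / 2) \<odot>\<^bsub>H\<^esub> (?x \<oplus>\<^bsub>H\<^esub> R 0 \<zeta> ?x) = g"
        by (rule half[OF refl V2(1,2)[OF g] R_closed[OF zero_in_Te \<zeta> x] \<zeta> U(2) ext(2)[OF g]])
          (simp add: R_inner[OF zero_in_Te \<zeta> x]
            K.cayley_zero[OF U(1) K.cayley_closed[OF U(2) \<zeta> J_closed[OF x]]])
    qed
    show "?c1 \<and> ?c2 \<and> ?c3 \<and> ?c4 \<and> ?c5" using c1 c2 c3 c4 c5 by blast
  }
  {
    assume c: "?c1 \<and> ?c2 \<and> ?c3 \<and> ?c4 \<and> ?c5"
    then obtain F where F: "\<And>h. h \<in> carrier H \<Longrightarrow> class_H2 (F h)"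
      and F_lim: "\<And>h. h \<in> carrier H \<Longrightarrow> limit_extension (\<lambda>z1 z2. hinner H (R z1 z2 h) h) (F h)"
      by metis
    have FR: "F h (Some z1) (Some z2) = hinner H (R z1 z2 h) h"
      if "h \<in> carrier H" "z1 \<in> Te" "z2 \<in> Te" for h z1 z2
      using F_lim[OF that(1)] that(2,3) by (simp add: limit_extension_def)
    have R0: "R 0 0 h = h" if "h \<in> carrier H" for h using c that by blast
    obtain K :: "((int \<times> int \<Rightarrow> 'a) + 'k) hspace" and J U1 U2 where K: "complex_hilbert_space K"
      and J: "hembedding H K J" and U: "hunitary K U1" "hunitary K U2"
      and comm: "\<And>x. x \<in> carrier K \<Longrightarrow> U1 (U2 x) = U2 (U1 x)"
      and R_inner: "\<And>z1 z2 x y. \<lbrakk>z1 \<in> Te; z2 \<in> Te; x \<in> carrier H; y \<in> carrier H\<rbrakk>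
        \<Longrightarrow> hinner K (cayley K U1 z1 (cayley K U2 z2 (J x))) (J y) = hinner H (R z1 z2 x) y"
      by (rule H.generalized_resolvent_dilation[of R F, OF R_lin R0 F FR]) blast+
    interpret unitary_extension H K J
      by (intro unitary_extension.intro unitary_extension_axioms.intro assms(1) K J)
    \<comment> \<open>The relation at any single \<open>\<zeta>\<close> of \<open>Te - {0}\<close> determines \<open>W\<close> on the domain; \<open>\<zeta> = 1/2\<close> serves.\<close>
    have extends: "W (J g) = J v"
      if gv: "g \<in> carrier H" "v \<in> carrier H" "hnorm H v = hnorm H g" and y: "y \<in> carrier H"
        and eq: "(1 / 2) \<odot>\<^bsub>H\<^esub> ((g \<ominus>\<^bsub>H\<^esub> (1/2) \<odot>\<^bsub>H\<^esub> v) \<oplus>\<^bsub>H\<^esub> y) = g" and W: "hunitary K W"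
        and yW: "\<And>k. k \<in> carrier H
          \<Longrightarrow> hinner K (cayley K W (1/2) (J (g \<ominus>\<^bsub>H\<^esub> (1/2) \<odot>\<^bsub>H\<^esub> v))) (J k) = hinner H y k"
      for W g v y
    proof (rule extension_of_resolvent[OF W _ _ gv, of "1/2"])
      let ?x = "g \<ominus>\<^bsub>H\<^esub> (1/2) \<odot>\<^bsub>H\<^esub> v"
      have T: "1/2 \<in> Te" by (simp add: Te_def)
      fix h assume h: "h \<in> carrier H"
      have x: "?x \<in> carrier H" using gv by simp
      have "hinner K (K.resolvent W (1/2) (J ?x)) (J h) = (hinner H ?x h + hinner H y h) / 2"
        using half_cayley[OF W T x h] by (simp add: yW[OF h])
      also have "\<dots> = hinner H ((1 / 2) \<odot>\<^bsub>H\<^esub> (?x \<oplus>\<^bsub>H\<^esub> y)) h"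
        using x y h by (simp add: H.inner_add_left H.inner_scale_left)
      finally show "hinner K (K.resolvent W (1/2) (J ?x)) (J h) = hinner H g h" unfolding eq .
    qed (auto simp: Te_def)
    have T: "1/2 \<in> Te" by (simp add: Te_def)
    have "U1 (J g) = J (the (V1 g))" if g: "g \<in> dom V1" for g
    proof -
      let ?x = "g \<ominus>\<^bsub>H\<^esub> (1/2) \<odot>\<^bsub>H\<^esub> the (V1 g)"
      have x: "?x \<in> carrier H" using V1(1,2)[OF g] by simp
      have "(1 / 2) \<odot>\<^bsub>H\<^esub> (?x \<oplus>\<^bsub>H\<^esub> R (1/2) 0 ?x) = g" using c T g unfolding Let_def by blast
      then show ?thesis
        by (rule extends[OF V1[OF g] R_closed[OF T zero_in_Te x] _ U(1)])
          (use R_inner[OF T zero_in_Te x] in \<open>simp add: K.cayley_zero[OF U(2) J_closed[OF x]]\<close>)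
    qed
    moreover have "U2 (J g) = J (the (V2 g))" if g: "g \<in> dom V2" for g
    proof -
      let ?x = "g \<ominus>\<^bsub>H\<^esub> (1/2) \<odot>\<^bsub>H\<^esub> the (V2 g)"
      have x: "?x \<in> carrier H" using V2(1,2)[OF g] by simp
      have "(1 / 2) \<odot>\<^bsub>H\<^esub> (?x \<oplus>\<^bsub>H\<^esub> R 0 (1/2) ?x) = g" using c T g unfolding Let_def by blast
      then show ?thesis
        by (rule extends[OF V2[OF g] R_closed[OF zero_in_Te T x] _ U(2)])
          (use R_inner[OF zero_in_Te T x] in
            \<open>simp add: K.cayley_zero[OF U(1) K.cayley_closed[OF U(2) T J_closed[OF x]]]\<close>)
    qed
    moreover have "is_orth_proj K (J ` carrier H) (cayley K U1 z1 (cayley K U2 z2 (J h))) (J (R z1 z2 h))"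
      if z: "z1 \<in> Te" "z2 \<in> Te" and h: "h \<in> carrier H" for z1 z2 h
      unfolding is_orth_proj_def
    proof (intro conjI ballI)
      have Rh: "R z1 z2 h \<in> carrier H" by (rule R_closed[OF z h])
      then show "J (R z1 z2 h) \<in> J ` carrier H" by blast
      fix m assume "m \<in> J ` carrier H"
      then obtain g where g: "g \<in> carrier H" "m = J g" by blast
      have "cayley K U1 z1 (cayley K U2 z2 (J h)) \<in> carrier K"
        by (intro K.cayley_closed U z J_closed h)
      then show "hinner K (cayley K U1 z1 (cayley K U2 z2 (J h)) \<ominus>\<^bsub>K\<^esub> J (R z1 z2 h)) m = 0"
        using R_inner[OF z h g(1)] J_inner[OF Rh g(1)] J_closed[OF Rh] J_closed[OF g(1)]
        by (simp add: g(2) K.inner_simps)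
    qed
    ultimately show ?resolvent
      unfolding generalized_resolvent_def using K J U comm by blast
  }
qed

end
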